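(* Let $f$ be a tempered distribution on $\mathbf{R}^d$, and let $g(x,y)=\langle f,\exp(h(x,y,t))\rangle$ for $(x,y)\in\Omega$. If differential operators $P_1,\dots,P_s\in D_t$ annihilate $f$, then the differential operators $$\varphi(P_k)\ (1\le k\le s),\qquad \partial_{x_{ij}}-2\partial_{y_i}\partial_{y_j}\ (1\le i<j\le d),\qquad \partial_{x_{ii}}-\partial_{y_i}^2\ (1\le i\le d)$$ annihilate the function $g(x,y)$. Moreover, these differential operators generate a holonomic (left) ideal in $D_{xy}$ if $P_1,\dots,P_s$ generate a holonomic (left) ideal in $D_t$.
   Context: $\Omega$ is the set of $(x,y)$ with $x$ a real symmetric $d\times d$ matrix such that $-x$ is positive definite and $y\in\mathbf{R}^d$; $h(x,y,t)=\sum_{i,j=1}^d x_{ij}t_it_j+\sum_{i=1}^d y_it_i$. For $(x,y)\in\Omega$ the function $t\mapsto\exp(h(x,y,t))$ is rapidly decreasing, so the pairing $\langle f,\exp(h(x,y,t))\rangle$ (in the variable $t$) is defined. $D_t=\mathbf{C}\langle t_i,\partial_{t_i}: 1\le i\le d\rangle$ and $D_{xy}=\mathbf{C}\langle x_{ij},y_k,\partial_{x_{ij}},\partial_{y_k}: 1\le i\le j\le d,\ 1\le k\le d\rangle$ are the Weyl algebras, where $\partial_z=\partial/\partial z$. The coordinates on symmetric matrices $x$ are $x_{ij}$ with $i\le j$, and we put $x_{ij}=x_{ji}$, $\partial_{x_{ij}}=\partial_{x_{ji}}$. The $\mathbf{C}$-algebra morphism $\varphi:D_t\to D_{xy}$ is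 defined by $t_i\mapsto\partial_{y_i}$ and $\partial_{t_i}\mapsto -y_i-2\sum_{k=1}^d x_{ik}\partial_{y_k}$ (it is well defined). A left ideal $I$ of a Weyl algebra $D$ is holonomic if $D/I$ is a holonomic left $D$-module. *)

theory Defs
  imports
    "HOL-Analysis.Analysis"
    "HOL-Library.Uprod"
    "HOL-Computational_Algebra.Polynomial"
begin

definition partial :: "'v::finite \<Rightarrow> (real^'v \<Rightarrow> complex) \<Rightarrow> (real^'v \<Rightarrow> complex)" where
  "partial i u = (\<lambda>x. frechet_derivative u (at x) (axis i 1))"

definition iter_partial :: "'v::finite list \<Rightarrow> (real^'v \<Rightarrow> complex) \<Rightarrow> (real^'v \<Rightarrow> complex)" where
  "iter_partial js u = foldr partial js u"

text \<open>Meant for open \<open>S\<close>; since every iterated partial derivative is totally differentiable,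
  they are all continuous and this is the usual notion of a \<open>C\<close>-infinity function.\<close>

definition smooth_on :: "(real^'v::finite) set \<Rightarrow> (real^'v \<Rightarrow> complex) \<Rightarrow> bool" where
  "smooth_on S u \<longleftrightarrow> (\<forall>js. \<forall>x\<in>S. iter_partial js u differentiable (at x))"

definition schwartz_space :: "(real^'v::finite \<Rightarrow> complex) set" where
  "schwartz_space = {u. smooth_on UNIV u \<and>
     (\<forall>k js. bdd_above (range (\<lambda>x. (1 + norm x) ^ k * cmod (iter_partial js u x))))}"

definition schwartz_seminorm :: "nat \<Rightarrow> 'v::finite list \<Rightarrow> (real^'v \<Rightarrow> complex) \<Rightarrow> real" where
  "schwartz_seminorm k js u = (SUP x. (1 + norm x) ^ k * cmod (iter_partial js u x))"

text \<open>A tempered distribution is a linear functional on the Schwartz space that is continuous for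
  the topology defined by the seminorms above. Its values outside the Schwartz space are irrelevant.\<close>

definition tempered_distribution :: "((real^'v::finite \<Rightarrow> complex) \<Rightarrow> complex) \<Rightarrow> bool" where
  "tempered_distribution f \<longleftrightarrow>
     (\<forall>u\<in>schwartz_space. \<forall>v\<in>schwartz_space. f (\<lambda>x. u x + v x) = f u + f v) \<and>
     (\<forall>c. \<forall>u\<in>schwartz_space. f (\<lambda>x. c * u x) = c * f u) \<and>
     (\<forall>u\<in>schwartz_space. \<forall>e>0. \<exists>d>0. \<exists>N. \<forall>v\<in>schwartz_space.
        (\<forall>k js. k \<le> N \<and> length js \<le> N \<longrightarrow> schwartz_seminorm k js (\<lambda>x. v x - u x) < d)
        \<longrightarrow> cmod (f v - f u) < e)"

lemma iter_partial_simps [simp]: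
  "iter_partial [] u = u" "iter_partial (i # js) u = partial i (iter_partial js u)"
  by (simp_all add: iter_partial_def)

lemma iter_partial_snoc: "iter_partial (js @ [i]) u = iter_partial js (partial i u)"
  by (simp add: iter_partial_def)

lemma partial_eqI:
  "(u has_derivative D) (at x) \<Longrightarrow> partial i u x = D (axis i 1)"
  unfolding partial_def using frechet_derivative_at by metis

lemma partial_cong:
  assumes "open S" "x \<in> S" "\<And>y. y \<in> S \<Longrightarrow> u y = v y"
  shows "partial i u x = partial i v x"
proof -
  have "(u has_derivative D) (at x) \<longleftrightarrow> (v has_derivative D) (at x)" for D
    using assms by (metis has_derivative_transform_within_open)
  then show ?thesis by (simp add: partial_def frechet_derivative_def)
qed

lemma differentiable_cong_open:
  fixes u v :: "real^'v::finite \<Rightarrow> complex"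
  assumes "open S" "x \<in> S" "\<And>y. y \<in> S \<Longrightarrow> u y = v y" "v differentiable (at x)"
  shows "u differentiable (at x)"
  using assms has_derivative_transform_within_open[of v _ x UNIV S u]
  unfolding differentiable_def by metis

lemma smooth_on_differentiable: "smooth_on S u \<Longrightarrow> x \<in> S \<Longrightarrow> u differentiable (at x)"
  unfolding smooth_on_def by (metis iter_partial_simps(1))

lemma smooth_on_deriv:
  "smooth_on S u \<Longrightarrow> x \<in> S \<Longrightarrow> (u has_derivative frechet_derivative u (at x)) (at x)"
  using smooth_on_differentiable frechet_derivative_works by blast

lemma smooth_on_partial: "smooth_on S u \<Longrightarrow> smooth_on S (partial i u)"
  unfolding smooth_on_def by (metis iter_partial_snoc)

lemma iter_partial_coinduct:
  assumes S: "open S" and Q: "Q u"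
    and step: "\<And>u i. Q u \<Longrightarrow> \<exists>v. Q v \<and> (\<forall>x\<in>S. partial i u x = v x)"
  shows "\<exists>v. Q v \<and> (\<forall>x\<in>S. iter_partial js u x = v x)"
proof (induction js)
  case Nil
  then show ?case using Q by auto
next
  case (Cons i js)
  then obtain v where v: "Q v" "\<forall>x\<in>S. iter_partial js u x = v x" by blast
  obtain w where w: "Q w" "\<forall>x\<in>S. partial i v x = w x" using step[OF v(1)] by blast
  show ?case using w v partial_cong[OF S, of _ "iter_partial js u" v i] by auto
qed

lemma smooth_on_coinduct:
  assumes S: "open S" and Q: "Q u"
    and diff: "\<And>u x. Q u \<Longrightarrow> x \<in> S \<Longrightarrow> u differentiable (at x)"
    and step: "\<And>u i. Q u \<Longrightarrow> \<exists>v. Q v \<and> (\<forall>x\<in>S. partial i u x = v x)"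
  shows "smooth_on S u"
  unfolding smooth_on_def
proof (intro allI ballI)
  fix js x assume x: "x \<in> S"
  obtain v where v: "Q v" "\<forall>x\<in>S. iter_partial js u x = v x"
    using iter_partial_coinduct[of S Q u js] S Q step by blast
  show "iter_partial js u differentiable (at x)"
    using differentiable_cong_open[OF S x, of "iter_partial js u" v] v diff x by blast
qed

lemma partial_add:
  "u differentiable (at x) \<Longrightarrow> v differentiable (at x) \<Longrightarrow>
    partial i (\<lambda>x. u x + v x) x = partial i u x + partial i v x"
  unfolding frechet_derivative_works
  by (subst partial_eqI[OF has_derivative_add]) (auto simp: partial_def)

lemma partial_cmult:
  "u differentiable (at x) \<Longrightarrow> partial i (\<lambda>x. c * u x) x = c * partial i u x"
  unfolding frechet_derivative_works
  by (subst partial_eqI[OF has_derivative_mult_right]) (auto simp: partial_def)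

lemma coord_has_derivative:
  assumes "(u has_derivative D) (at x)"
  shows "((\<lambda>x. complex_of_real (x $ j) * u x) has_derivative
     (\<lambda>h. complex_of_real (x $ j) * D h + complex_of_real (h $ j) * u x)) (at x)"
proof -
  have "((\<lambda>x. complex_of_real (x $ j)) has_derivative (\<lambda>h. complex_of_real (h $ j))) (at x)"
    by (intro bounded_linear_imp_has_derivative bounded_linear_compose[OF bounded_linear_of_real]
        bounded_linear_vec_nth)
  from has_derivative_mult[OF this assms] show ?thesis by simp
qed

lemma partial_coord:
  "u differentiable (at x) \<Longrightarrow> partial i (\<lambda>x. complex_of_real (x $ j) * u x) x =
    complex_of_real (x $ j) * partial i u x + (if i = j then 1 else 0) * u x"
  unfolding frechet_derivative_works
  by (subst partial_eqI[OF coord_has_derivative]) (auto simp: partial_def axis_def)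

lemma coord_differentiable:
  "u differentiable (at x) \<Longrightarrow> (\<lambda>x. complex_of_real (x $ j) * u x) differentiable (at x)"
  using coord_has_derivative unfolding differentiable_def by blast

lemma smooth_on_add:
  assumes "open S" "smooth_on S u" "smooth_on S v"
  shows "smooth_on S (\<lambda>x. u x + v x)"
proof (rule smooth_on_coinduct[where Q = "\<lambda>w. \<exists>u v. smooth_on S u \<and> smooth_on S v \<and> w = (\<lambda>x. u x + v x)"])
  fix w :: "real^'a \<Rightarrow> complex" and i
  assume "\<exists>u v. smooth_on S u \<and> smooth_on S v \<and> w = (\<lambda>x. u x + v x)"
  then obtain u v where uv: "smooth_on S u" "smooth_on S v" "w = (\<lambda>x. u x + v x)" by blast
  show "\<exists>w'. (\<exists>u v. smooth_on S u \<and> smooth_on S v \<and> w' = (\<lambda>x. u x + v x))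
     \<and> (\<forall>x\<in>S. partial i w x = w' x)"
    by (rule exI[of _ "\<lambda>x. partial i u x + partial i v x"])
      (use uv smooth_on_partial partial_add smooth_on_differentiable in blast)
qed (use assms smooth_on_differentiable in \<open>auto intro!: differentiable_add\<close>)

lemma smooth_on_cmult:
  assumes "open S" "smooth_on S u"
  shows "smooth_on S (\<lambda>x. c * u x)"
proof (rule smooth_on_coinduct[where Q = "\<lambda>w. \<exists>u. smooth_on S u \<and> w = (\<lambda>x. c * u x)"])
  fix w :: "real^'a \<Rightarrow> complex" and i
  assume "\<exists>u. smooth_on S u \<and> w = (\<lambda>x. c * u x)"
  then obtain u where uv: "smooth_on S u" "w = (\<lambda>x. c * u x)" by blast
  show "\<exists>w'. (\<exists>u. smooth_on S u \<and> w' = (\<lambda>x. c * u x)) \<and> (\<forall>x\<in>S. partial i w x = w' x)"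
    by (rule exI[of _ "\<lambda>x. c * partial i u x"])
      (use uv smooth_on_partial partial_cmult smooth_on_differentiable in blast)
qed (use assms smooth_on_differentiable in \<open>auto intro!: differentiable_mult differentiable_const\<close>)

lemma smooth_on_coord:
  assumes S: "open S" and u: "smooth_on S u"
  shows "smooth_on S (\<lambda>x. complex_of_real (x $ j) * u x)"
proof -
  let ?Q = "\<lambda>w. \<exists>u v. smooth_on S u \<and> smooth_on S v \<and> w = (\<lambda>x. complex_of_real (x $ j) * u x + v x)"
  have "smooth_on S (\<lambda>x. complex_of_real (x $ j) * u x + 0 * u x)"
  proof (rule smooth_on_coinduct[where Q = ?Q])
    show "?Q (\<lambda>x. complex_of_real (x $ j) * u x + 0 * u x)"
      using u smooth_on_cmult[OF S u] by blast
    fix w :: "real^'a \<Rightarrow> complex"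
    assume "?Q w"
    then obtain u v where uv: "smooth_on S u" "smooth_on S v"
      "w = (\<lambda>x. complex_of_real (x $ j) * u x + v x)" by blast
    show "w differentiable (at x)" if "x \<in> S" for x
      unfolding uv(3) using uv that
      by (intro differentiable_add coord_differentiable smooth_on_differentiable)
    fix i
    have *: "smooth_on S (\<lambda>x. (if i = j then 1 else 0) * u x + partial i v x)"
      using uv by (intro smooth_on_add smooth_on_cmult S smooth_on_partial)
    have "partial i w x = complex_of_real (x $ j) * partial i u x +
        ((if i = j then 1 else 0) * u x + partial i v x)" if "x \<in> S" for x
    proof -
      have d: "u differentiable (at x)" "v differentiable (at x)"
        using uv that smooth_on_differentiable by blast+
      show ?thesis unfolding uv(3) partial_add[OF coord_differentiable[OF d(1)] d(2)]
          partial_coord[OF d(1)] by simp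
    qed
    then show "\<exists>w'. ?Q w' \<and> (\<forall>x\<in>S. partial i w x = w' x)"
      by (intro exI[of _ "\<lambda>x. complex_of_real (x $ j) * partial i u x +
        ((if i = j then 1 else 0) * u x + partial i v x)"])
        (use * smooth_on_partial[OF uv(1)] in blast)
  qed (rule S)
  then show ?thesis by simp
qed

lemma line_deriv:
  fixes w :: "real^'v::finite \<Rightarrow> complex"
  assumes "w differentiable (at (a + s *\<^sub>R axis i 1))"
  shows "((\<lambda>s. w (a + s *\<^sub>R axis i 1)) has_vector_derivative partial i w (a + s *\<^sub>R axis i 1)) (at s)"
proof -
  have 1: "((\<lambda>s. a + s *\<^sub>R axis i 1) has_derivative (\<lambda>h. h *\<^sub>R axis i 1)) (at s)"
    by (auto intro!: derivative_eq_intros)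
  have 2: "(w has_derivative frechet_derivative w (at (a + s *\<^sub>R axis i 1))) (at (a + s *\<^sub>R axis i 1))"
    using assms frechet_derivative_works by blast
  have "linear (frechet_derivative w (at (a + s *\<^sub>R axis i 1)))"
    using assms linear_frechet_derivative by blast
  then show ?thesis
    using has_derivative_compose[OF 1 2] 
    by (simp add: has_vector_derivative_def partial_def linear_cmul)
qed

lemma mixed_difference:
  fixes u :: "real^'v::finite \<Rightarrow> complex" and L :: "complex \<Rightarrow> real"
  assumes L: "bounded_linear L" and S: "ball x (3 * h) \<subseteq> S" "smooth_on S u" and h: "0 < h"
  shows "\<exists>p\<in>ball x (3 * h). L (u (x + h *\<^sub>R axis i 1 + h *\<^sub>R axis j 1)) - L (u (x + h *\<^sub>R axis i 1))
     - L (u (x + h *\<^sub>R axis j 1)) + L (u x) = h * (h * L (partial j (partial i u) p))"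
proof -
  have inS: "x + s *\<^sub>R axis i 1 + t *\<^sub>R axis j 1 \<in> ball x (3 * h)"
    if "0 \<le> s" "s \<le> h" "0 \<le> t" "t \<le> h" for s t
  proof -
    have "norm (s *\<^sub>R axis i (1::real) + t *\<^sub>R axis j (1::real)) \<le>
       norm (s *\<^sub>R axis i (1::real)) + norm (t *\<^sub>R axis j (1::real))" by (rule norm_triangle_ineq)
    also have "\<dots> < 3 * h" using that h by simp
    finally show ?thesis by (simp add: dist_norm algebra_simps norm_minus_commute)
  qed
  note inS' = inS[THEN subsetD[OF S(1)]]
  have lin: "((\<lambda>s. L (w (a + s *\<^sub>R axis k 1))) has_real_derivative
      L (partial k w (a + s *\<^sub>R axis k 1))) (at s)"
    if "w differentiable (at (a + s *\<^sub>R axis k 1))" for w a s k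
    using bounded_linear.has_vector_derivative[OF L line_deriv[OF that]]
    by (simp add: has_real_derivative_iff_has_vector_derivative)
  define F where "F = (\<lambda>s. L (u ((x + h *\<^sub>R axis j 1) + s *\<^sub>R axis i 1)) - L (u (x + s *\<^sub>R axis i 1)))"
  have "\<exists>z. 0 < z \<and> z < h \<and> F h - F 0 = (h - 0) *
     (L (partial i u ((x + h *\<^sub>R axis j 1) + z *\<^sub>R axis i 1)) - L (partial i u (x + z *\<^sub>R axis i 1)))"
  proof (rule MVT2[OF h])
    fix s assume "0 \<le> s" "s \<le> h"
    then show "(F has_real_derivative (L (partial i u ((x + h *\<^sub>R axis j 1) + s *\<^sub>R axis i 1))
        - L (partial i u (x + s *\<^sub>R axis i 1)))) (at s)"
      unfolding F_def using inS'[of s h] inS'[of s 0] h S(2)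
      by (intro DERIV_diff lin smooth_on_differentiable[of S]) (auto simp: algebra_simps)
  qed
  then obtain z where z: "0 < z" "z < h" "F h - F 0 = h *
     (L (partial i u ((x + h *\<^sub>R axis j 1) + z *\<^sub>R axis i 1)) - L (partial i u (x + z *\<^sub>R axis i 1)))"
    by auto
  have "\<exists>t. 0 < t \<and> t < h \<and> L (partial i u ((x + z *\<^sub>R axis i 1) + h *\<^sub>R axis j 1))
       - L (partial i u ((x + z *\<^sub>R axis i 1) + 0 *\<^sub>R axis j 1)) =
     (h - 0) * L (partial j (partial i u) ((x + z *\<^sub>R axis i 1) + t *\<^sub>R axis j 1))"
  proof (rule MVT2[OF h])
    fix t assume "0 \<le> t" "t \<le> h"
    then show "((\<lambda>t. L (partial i u ((x + z *\<^sub>R axis i 1) + t *\<^sub>R axis j 1))) has_real_derivative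
       L (partial j (partial i u) ((x + z *\<^sub>R axis i 1) + t *\<^sub>R axis j 1))) (at t)"
      using inS'[of z t] z S(2)
      by (intro lin smooth_on_differentiable[of S] smooth_on_partial) auto
  qed
  then obtain t where t: "0 < t" "t < h" "L (partial i u ((x + z *\<^sub>R axis i 1) + h *\<^sub>R axis j 1))
       - L (partial i u (x + z *\<^sub>R axis i 1)) =
     h * L (partial j (partial i u) ((x + z *\<^sub>R axis i 1) + t *\<^sub>R axis j 1))"
    by auto
  have "F h - F 0 = h * (h * L (partial j (partial i u) ((x + z *\<^sub>R axis i 1) + t *\<^sub>R axis j 1)))"
    using z(3) t(3) by (simp add: algebra_simps)
  then show ?thesis
    using inS[of z t] z t unfolding F_def
    by (intro bexI[of _ "(x + z *\<^sub>R axis i 1) + t *\<^sub>R axis j 1"]) (auto simp: algebra_simps)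
qed

lemma partial_commute:
  assumes S: "open S" and u: "smooth_on S u" and x: "x \<in> S"
  shows "partial i (partial j u) x = partial j (partial i u) x"
proof -
  have main: "L (partial j (partial i u) x) = L (partial i (partial j u) x)"
    if L: "bounded_linear L" for L :: "complex \<Rightarrow> real"
  proof -
    let ?A = "\<lambda>p. L (partial j (partial i u) p)" and ?B = "\<lambda>p. L (partial i (partial j u) p)"
    have cont: "isCont ?A x" "isCont ?B x"
      using u x smooth_on_partial smooth_on_differentiable
      by (blast intro: bounded_linear.isCont[OF L] differentiable_imp_continuous_within)+
    have "\<bar>?A x - ?B x\<bar> \<le> e" if e: "e > 0" for e
    proof -
      obtain d1 where d1: "d1 > 0" "\<And>y. dist y x < d1 \<Longrightarrow> dist (?A y) (?A x) < e / 2"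
        using cont(1) e unfolding continuous_at_eps_delta by (metis half_gt_zero)
      obtain d2 where d2: "d2 > 0" "\<And>y. dist y x < d2 \<Longrightarrow> dist (?B y) (?B x) < e / 2"
        using cont(2) e unfolding continuous_at_eps_delta by (metis half_gt_zero)
      obtain d3 where d3: "d3 > 0" "ball x d3 \<subseteq> S" using S x open_contains_ball by blast
      define h where "h = min d1 (min d2 d3) / 3"
      have h: "h > 0" "3 * h \<le> d1" "3 * h \<le> d2" "3 * h \<le> d3" using d1 d2 d3 by (auto simp: h_def)
      have sub: "ball x (3 * h) \<subseteq> S" using d3 h by auto
      obtain p where p: "p \<in> ball x (3 * h)" "L (u (x + h *\<^sub>R axis i 1 + h *\<^sub>R axis j 1))
          - L (u (x + h *\<^sub>R axis i 1)) - L (u (x + h *\<^sub>R axis j 1)) + L (u x) = h * (h * ?A p)"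
        using mixed_difference[OF L sub u h(1), of i j] by blast
      obtain q where q: "q \<in> ball x (3 * h)" "L (u (x + h *\<^sub>R axis j 1 + h *\<^sub>R axis i 1))
          - L (u (x + h *\<^sub>R axis j 1)) - L (u (x + h *\<^sub>R axis i 1)) + L (u x) = h * (h * ?B q)"
        using mixed_difference[OF L sub u h(1), of j i] by blast
      have sw: "x + h *\<^sub>R axis j 1 + h *\<^sub>R axis i 1 = x + h *\<^sub>R axis i 1 + h *\<^sub>R axis j 1" by simp
      have "L (u (x + h *\<^sub>R axis i 1 + h *\<^sub>R axis j 1))
          - L (u (x + h *\<^sub>R axis j 1)) - L (u (x + h *\<^sub>R axis i 1)) + L (u x) = h * (h * ?B q)"
        by (rule q(2)[unfolded sw])
      with p(2) have "h * (h * ?A p) = h * (h * ?B q)" by linarith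
      then have "?A p = ?B q" using h(1) by simp
      moreover have "dist (?A p) (?A x) < e / 2" "dist (?B q) (?B x) < e / 2"
        using d1(2)[of p] d2(2)[of q] p(1) q(1) h by (auto simp: dist_commute)
      ultimately show ?thesis unfolding dist_real_def by linarith
    qed
    then have "\<bar>?A x - ?B x\<bar> \<le> 0" by (rule field_le_epsilon[of _ 0, simplified])
    then show ?thesis by simp
  qed
  show ?thesis
    using main[OF bounded_linear_Re] main[OF bounded_linear_Im] by (simp add: complex_eq_iff)
qed

lemma schwartz_space_smooth: "u \<in> schwartz_space \<Longrightarrow> smooth_on UNIV u"
  by (simp add: schwartz_space_def)

lemma schwartz_space_bdd:
  "u \<in> schwartz_space \<Longrightarrow> \<exists>B. \<forall>x. (1 + norm x) ^ k * cmod (iter_partial js u x) \<le> B"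
  unfolding schwartz_space_def bdd_above_def by auto

lemma schwartz_space_bdd0: "u \<in> schwartz_space \<Longrightarrow> \<exists>B. \<forall>x. (1 + norm x) ^ k * cmod (u x) \<le> B"
  using schwartz_space_bdd[of u k "[]"] by simp

lemma schwartz_space_differentiable: "u \<in> schwartz_space \<Longrightarrow> u differentiable (at x)"
  using schwartz_space_smooth smooth_on_differentiable by blast

lemma schwartz_space_partial: "u \<in> schwartz_space \<Longrightarrow> partial i u \<in> schwartz_space"
  unfolding schwartz_space_def by (simp add: smooth_on_partial flip: iter_partial_snoc)

lemma schwartz_space_coinduct:
  assumes Q: "Q u"
    and diff: "\<And>u x. Q u \<Longrightarrow> u differentiable (at x)"
    and bdd: "\<And>u k. Q u \<Longrightarrow> \<exists>B. \<forall>x. (1 + norm x) ^ k * cmod (u x) \<le> B"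
    and step: "\<And>u i. Q u \<Longrightarrow> Q (partial i u)"
  shows "u \<in> schwartz_space"
proof -
  have Qi: "Q (iter_partial js u)" for js by (induction js) (auto simp: Q step)
  then show ?thesis
    using diff bdd[OF Qi] unfolding schwartz_space_def smooth_on_def bdd_above_def by fastforce
qed

lemma schwartz_space_add:
  assumes "u \<in> schwartz_space" "v \<in> schwartz_space"
  shows "(\<lambda>x. u x + v x) \<in> schwartz_space"
proof (rule schwartz_space_coinduct[where
      Q = "\<lambda>w. \<exists>u\<in>schwartz_space. \<exists>v\<in>schwartz_space. w = (\<lambda>x. u x + v x)"])
  fix w :: "real^'a \<Rightarrow> complex"
  assume "\<exists>u\<in>schwartz_space. \<exists>v\<in>schwartz_space. w = (\<lambda>x. u x + v x)"
  then obtain u v where uv: "u \<in> schwartz_space" "v \<in> schwartz_space" "w = (\<lambda>x. u x + v x)" by blast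
  show "w differentiable (at x)" for x
    unfolding uv(3) using uv by (intro differentiable_add schwartz_space_differentiable)
  show "\<exists>B. \<forall>x. (1 + norm x) ^ k * cmod (w x) \<le> B" for k
  proof -
    obtain B C where B: "\<And>x. (1 + norm x) ^ k * cmod (u x) \<le> B"
      and C: "\<And>x. (1 + norm x) ^ k * cmod (v x) \<le> C"
      using schwartz_space_bdd0[OF uv(1)] schwartz_space_bdd0[OF uv(2)] by metis
    have "(1 + norm x) ^ k * cmod (w x) \<le> B + C" for x
    proof -
      have "(1 + norm x) ^ k * cmod (w x) \<le> (1 + norm x) ^ k * (cmod (u x) + cmod (v x))"
        unfolding uv(3) by (intro mult_left_mono norm_triangle_ineq) auto
      then show ?thesis using B[of x] C[of x] by (simp add: distrib_left)
    qed
    then show ?thesis by blast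
  qed
  have "partial i w = (\<lambda>x. partial i u x + partial i v x)" for i
    unfolding uv(3) using uv by (auto simp: partial_add schwartz_space_differentiable)
  then show "\<exists>u\<in>schwartz_space. \<exists>v\<in>schwartz_space. partial i w = (\<lambda>x. u x + v x)" for i
    using uv schwartz_space_partial by blast
qed (use assms in auto)

lemma schwartz_space_cmult:
  assumes "u \<in> schwartz_space"
  shows "(\<lambda>x. c * u x) \<in> schwartz_space"
proof (rule schwartz_space_coinduct[where Q = "\<lambda>w. \<exists>u\<in>schwartz_space. w = (\<lambda>x. c * u x)"])
  fix w :: "real^'a \<Rightarrow> complex"
  assume "\<exists>u\<in>schwartz_space. w = (\<lambda>x. c * u x)"
  then obtain u where u: "u \<in> schwartz_space" "w = (\<lambda>x. c * u x)" by blast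
  show "w differentiable (at x)" for x
    unfolding u(2) using u by (intro differentiable_mult differentiable_const schwartz_space_differentiable)
  show "\<exists>B. \<forall>x. (1 + norm x) ^ k * cmod (w x) \<le> B" for k
  proof -
    obtain B where B: "\<And>x. (1 + norm x) ^ k * cmod (u x) \<le> B"
      using schwartz_space_bdd0[OF u(1)] by metis
    have "(1 + norm x) ^ k * cmod (w x) \<le> cmod c * B" for x
      using mult_left_mono[OF B[of x], of "cmod c"] by (simp add: u(2) norm_mult ac_simps)
    then show ?thesis by blast
  qed
  have "partial i w = (\<lambda>x. c * partial i u x)" for i
    unfolding u(2) using u by (auto simp: partial_cmult schwartz_space_differentiable)
  then show "\<exists>u\<in>schwartz_space. partial i w = (\<lambda>x. c * u x)" for i
    using u schwartz_space_partial by blast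
qed (use assms in auto)

lemma schwartz_space_coord:
  assumes u: "u \<in> schwartz_space"
  shows "(\<lambda>x. complex_of_real (x $ j) * u x) \<in> schwartz_space"
proof -
  let ?Q = "\<lambda>w. \<exists>u\<in>schwartz_space. \<exists>v\<in>schwartz_space. w = (\<lambda>x. complex_of_real (x $ j) * u x + v x)"
  have "(\<lambda>x. complex_of_real (x $ j) * u x + 0 * u x) \<in> schwartz_space"
  proof (rule schwartz_space_coinduct[where Q = ?Q])
    show "?Q (\<lambda>x. complex_of_real (x $ j) * u x + 0 * u x)"
      by (intro bexI[of _ u] bexI[of _ "\<lambda>x. 0 * u x"] refl u schwartz_space_cmult)
    fix w :: "real^'a \<Rightarrow> complex"
    assume "?Q w"
    then obtain u v where uv: "u \<in> schwartz_space" "v \<in> schwartz_space"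
      "w = (\<lambda>x. complex_of_real (x $ j) * u x + v x)" by blast
    note d = schwartz_space_differentiable[OF uv(1)] schwartz_space_differentiable[OF uv(2)]
    show "w differentiable (at x)" for x
      unfolding uv(3) by (intro differentiable_add coord_differentiable d)
    show "\<exists>B. \<forall>x. (1 + norm x) ^ k * cmod (w x) \<le> B" for k
    proof -
      obtain B C where B: "\<And>x. (1 + norm x) ^ Suc k * cmod (u x) \<le> B"
        and C: "\<And>x. (1 + norm x) ^ k * cmod (v x) \<le> C"
        using schwartz_space_bdd0[OF uv(1)] schwartz_space_bdd0[OF uv(2)] by metis
      have "(1 + norm x) ^ k * cmod (w x) \<le> B + C" for x
      proof -
        have "cmod (w x) \<le> \<bar>x $ j\<bar> * cmod (u x) + cmod (v x)"
          unfolding uv(3) using norm_triangle_ineq[of "complex_of_real (x $ j) * u x" "v x"]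
          by (simp add: norm_mult)
        also have "\<dots> \<le> (1 + norm x) * cmod (u x) + cmod (v x)"
          using component_le_norm_cart[of x j]
          by (intro add_right_mono mult_right_mono) auto
        finally have "(1 + norm x) ^ k * cmod (w x) \<le>
            (1 + norm x) ^ k * ((1 + norm x) * cmod (u x) + cmod (v x))"
          by (intro mult_left_mono) auto
        then show ?thesis using B[of x] C[of x] by (simp add: distrib_left mult.assoc mult.left_commute)
      qed
      then show ?thesis by blast
    qed
    fix i
    have "partial i w = (\<lambda>x. complex_of_real (x $ j) * partial i u x +
        ((if i = j then 1 else 0) * u x + partial i v x))"
    proof
      fix x
      show "partial i w x = complex_of_real (x $ j) * partial i u x +
        ((if i = j then 1 else 0) * u x + partial i v x)"
        unfolding uv(3) partial_add[OF coord_differentiable[OF d(1)] d(2)] partial_coord[OF d(1)]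
        by simp
    qed
    moreover have "(\<lambda>x. (if i = j then 1 else 0) * u x + partial i v x) \<in> schwartz_space"
      using uv by (intro schwartz_space_add schwartz_space_cmult schwartz_space_partial)
    ultimately show "?Q (partial i w)"
      by (intro bexI[of _ "partial i u"]
          bexI[of _ "\<lambda>x. (if i = j then 1 else 0) * u x + partial i v x"]
          schwartz_space_partial uv(1))
  qed
  then show ?thesis by simp
qed


text \<open>The Weyl algebra over the complex numbers in commuting variables indexed by \<open>'v\<close> is given by
  generators and relations: noncommutative polynomial expressions modulo the congruence generated
  by the axioms of a unital associative complex algebra and the Weyl relations.\<close>

datatype 'v wexpr =
    WConst complex
  | WVar 'v
  | WDer 'v
  | WAdd "'v wexpr" "'v wexpr"
  | WMul "'v wexpr" "'v wexpr"

inductive weq :: "'v wexpr \<Rightarrow> 'v wexpr \<Rightarrow> bool" where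
  weq_refl: "weq a a"
| weq_sym: "weq a b \<Longrightarrow> weq b a"
| weq_trans: "weq a b \<Longrightarrow> weq b c \<Longrightarrow> weq a c"
| weq_add: "weq a b \<Longrightarrow> weq c e \<Longrightarrow> weq (WAdd a c) (WAdd b e)"
| weq_mul: "weq a b \<Longrightarrow> weq c e \<Longrightarrow> weq (WMul a c) (WMul b e)"
| weq_add_assoc: "weq (WAdd (WAdd a b) c) (WAdd a (WAdd b c))"
| weq_add_commute: "weq (WAdd a b) (WAdd b a)"
| weq_add_zero: "weq (WAdd (WConst 0) a) a"
| weq_add_uminus: "weq (WAdd (WMul (WConst (-1)) a) a) (WConst 0)"
| weq_mul_assoc: "weq (WMul (WMul a b) c) (WMul a (WMul b c))"
| weq_one_mul: "weq (WMul (WConst 1) a) a"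
| weq_distrib_right: "weq (WMul (WAdd a b) c) (WAdd (WMul a c) (WMul b c))"
| weq_distrib_left: "weq (WMul a (WAdd b c)) (WAdd (WMul a b) (WMul a c))"
| weq_const_add: "weq (WConst (c + e)) (WAdd (WConst c) (WConst e))"
| weq_const_mul: "weq (WConst (c * e)) (WMul (WConst c) (WConst e))"
| weq_const_central: "weq (WMul (WConst c) a) (WMul a (WConst c))"
| weq_var_commute: "weq (WMul (WVar i) (WVar j)) (WMul (WVar j) (WVar i))"
| weq_der_commute: "weq (WMul (WDer i) (WDer j)) (WMul (WDer j) (WDer i))"
| weq_der_var: "weq (WMul (WDer i) (WVar j))
     (WAdd (WMul (WVar j) (WDer i)) (WConst (if i = j then 1 else 0)))"

quotient_type 'v weyl = "'v wexpr" / weq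
proof (rule equivpI)
  show "reflp weq" by (rule reflpI) (rule weq_refl)
  show "symp weq" by (rule sympI) (rule weq_sym)
  show "transp weq" by (rule transpI) (rule weq_trans)
qed

primrec wexpr_act :: "'v::finite wexpr \<Rightarrow> (real^'v \<Rightarrow> complex) \<Rightarrow> (real^'v \<Rightarrow> complex)" where
  "wexpr_act (WConst c) u = (\<lambda>x. c * u x)"
| "wexpr_act (WVar i) u = (\<lambda>x. complex_of_real (x $ i) * u x)"
| "wexpr_act (WDer i) u = partial i u"
| "wexpr_act (WAdd a b) u = (\<lambda>x. wexpr_act a u x + wexpr_act b u x)"
| "wexpr_act (WMul a b) u = wexpr_act a (wexpr_act b u)"

primrec wexpr_dact :: "'v::finite wexpr \<Rightarrow>
    ((real^'v \<Rightarrow> complex) \<Rightarrow> complex) \<Rightarrow> ((real^'v \<Rightarrow> complex) \<Rightarrow> complex)" where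
  "wexpr_dact (WConst c) f = (\<lambda>u. c * f u)"
| "wexpr_dact (WVar i) f = (\<lambda>u. f (\<lambda>x. complex_of_real (x $ i) * u x))"
| "wexpr_dact (WDer i) f = (\<lambda>u. - f (partial i u))"
| "wexpr_dact (WAdd a b) f = (\<lambda>u. wexpr_dact a f u + wexpr_dact b f u)"
| "wexpr_dact (WMul a b) f = wexpr_dact a (wexpr_dact b f)"

lemma wexpr_act_smooth:
  "open S \<Longrightarrow> smooth_on S u \<Longrightarrow> smooth_on S (wexpr_act a u)"
  by (induction a arbitrary: u)
    (auto intro: smooth_on_add smooth_on_cmult smooth_on_coord smooth_on_partial)

lemma wexpr_act_cong:
  assumes S: "open S"
  shows "(\<And>x. x \<in> S \<Longrightarrow> u x = v x) \<Longrightarrow> x \<in> S \<Longrightarrow> wexpr_act a u x = wexpr_act a v x"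
proof (induction a arbitrary: u v x)
  case (WDer i)
  have "partial i u x = partial i v x" using S WDer(2,1) by (rule partial_cong)
  then show ?case by simp
next
  case (WMul a b)
  have "wexpr_act b u y = wexpr_act b v y" if "y \<in> S" for y
    using WMul.prems(1) that by (rule WMul.IH(2))
  then have "wexpr_act a (wexpr_act b u) x = wexpr_act a (wexpr_act b v) x"
    using WMul.prems(2) by (rule WMul.IH(1))
  then show ?case by simp
next
  case (WAdd a b)
  have "wexpr_act a u x = wexpr_act a v x" using WAdd.prems by (rule WAdd.IH(1))
  moreover have "wexpr_act b u x = wexpr_act b v x" using WAdd.prems by (rule WAdd.IH(2))
  ultimately show ?case by simp
qed simp_all

lemma wexpr_act_add:
  assumes S: "open S"
  shows "smooth_on S u \<Longrightarrow> smooth_on S v \<Longrightarrow> x \<in> S \<Longrightarrow>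
    wexpr_act a (\<lambda>x. u x + v x) x = wexpr_act a u x + wexpr_act a v x"
proof (induction a arbitrary: u v x)
  case (WDer i)
  then show ?case by (simp add: partial_add smooth_on_differentiable)
next
  case (WMul a b)
  have "wexpr_act a (wexpr_act b (\<lambda>x. u x + v x)) x =
      wexpr_act a (\<lambda>x. wexpr_act b u x + wexpr_act b v x) x"
    using WMul.prems by (intro wexpr_act_cong[OF S]) (rule WMul.IH(2))
  then show ?case
    using WMul.IH(1)[OF wexpr_act_smooth[OF S WMul.prems(1)] wexpr_act_smooth[OF S WMul.prems(2)]]
      WMul.prems(3) by simp
next
  case (WAdd a b)
  show ?case using WAdd.IH(1)[OF WAdd.prems] WAdd.IH(2)[OF WAdd.prems] by (simp add: algebra_simps)
next
  case (WConst c)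
  show ?case by (simp add: distrib_left)
next
  case (WVar i)
  show ?case by (simp add: distrib_left)
qed

lemma wexpr_act_cmult:
  assumes S: "open S"
  shows "smooth_on S u \<Longrightarrow> x \<in> S \<Longrightarrow> wexpr_act a (\<lambda>x. c * u x) x = c * wexpr_act a u x"
proof (induction a arbitrary: u x)
  case (WDer i)
  then show ?case by (simp add: partial_cmult smooth_on_differentiable)
next
  case (WMul a b)
  have "wexpr_act a (wexpr_act b (\<lambda>x. c * u x)) x = wexpr_act a (\<lambda>x. c * wexpr_act b u x) x"
    using WMul.prems by (intro wexpr_act_cong[OF S]) (rule WMul.IH(2))
  then show ?case
    using WMul.IH(1)[OF wexpr_act_smooth[OF S WMul.prems(1)]] WMul.prems(2) by simp
next
  case (WAdd a b)
  show ?case by (simp only: wexpr_act.simps WAdd.IH[OF WAdd.prems] distrib_left)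
qed simp_all

lemma wexpr_act_weq:
  assumes S: "open S"
  shows "weq a b \<Longrightarrow> smooth_on S u \<Longrightarrow> x \<in> S \<Longrightarrow> wexpr_act a u x = wexpr_act b u x"
proof (induction arbitrary: u x rule: weq.induct)
  case (weq_mul a b c e)
  have "wexpr_act a (wexpr_act c u) x = wexpr_act a (wexpr_act e u) x"
    by (rule wexpr_act_cong[OF S]) (use weq_mul in auto)
  also have "\<dots> = wexpr_act b (wexpr_act e u) x"
    using weq_mul wexpr_act_smooth[OF S] by blast
  finally show ?case by simp
next
  case (weq_distrib_left a b c)
  then show ?case
    using wexpr_act_add[OF S wexpr_act_smooth[OF S] wexpr_act_smooth[OF S], of u u x a b c] by simp
next
  case (weq_const_central c a)
  then show ?case using wexpr_act_cmult[OF S, of u x a c] by simp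
next
  case (weq_der_commute i j)
  then show ?case using partial_commute[OF S, of u x i j] by simp
next
  case (weq_der_var i j)
  then show ?case by (simp add: partial_coord smooth_on_differentiable)
qed (simp_all add: algebra_simps)

definition schwartz_linear :: "((real^'v::finite \<Rightarrow> complex) \<Rightarrow> complex) \<Rightarrow> bool" where
  "schwartz_linear f \<longleftrightarrow>
     (\<forall>u\<in>schwartz_space. \<forall>v\<in>schwartz_space. f (\<lambda>x. u x + v x) = f u + f v) \<and>
     (\<forall>c. \<forall>u\<in>schwartz_space. f (\<lambda>x. c * u x) = c * f u)"

lemma schwartz_linear_add:
  "schwartz_linear f \<Longrightarrow> u \<in> schwartz_space \<Longrightarrow> v \<in> schwartz_space \<Longrightarrow>
     f (\<lambda>x. u x + v x) = f u + f v"
  by (simp add: schwartz_linear_def)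

lemma schwartz_linear_cmult:
  "schwartz_linear f \<Longrightarrow> u \<in> schwartz_space \<Longrightarrow> f (\<lambda>x. c * u x) = c * f u"
  by (simp add: schwartz_linear_def)

lemma tempered_distribution_linear: "tempered_distribution f \<Longrightarrow> schwartz_linear f"
  by (simp add: schwartz_linear_def tempered_distribution_def)

lemma partial_add_schwartz:
  "u \<in> schwartz_space \<Longrightarrow> v \<in> schwartz_space \<Longrightarrow>
     partial i (\<lambda>x. u x + v x) = (\<lambda>x. partial i u x + partial i v x)"
  by (auto simp: partial_add schwartz_space_differentiable)

lemma partial_cmult_schwartz:
  "u \<in> schwartz_space \<Longrightarrow> partial i (\<lambda>x. c * u x) = (\<lambda>x. c * partial i u x)"
  by (auto simp: partial_cmult schwartz_space_differentiable)

lemma wexpr_dact_linear: "schwartz_linear f \<Longrightarrow> schwartz_linear (wexpr_dact a f)"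
proof (induction a arbitrary: f)
  case (WConst c)
  then show ?case by (simp add: schwartz_linear_def algebra_simps)
next
  case (WVar i)
  then show ?case
    using schwartz_linear_add[OF WVar schwartz_space_coord schwartz_space_coord]
      schwartz_linear_cmult[OF WVar schwartz_space_coord]
    by (simp add: schwartz_linear_def distrib_left mult.left_commute)
next
  case (WDer i)
  then show ?case
    using schwartz_linear_add[OF WDer schwartz_space_partial schwartz_space_partial]
      schwartz_linear_cmult[OF WDer schwartz_space_partial]
    by (simp add: schwartz_linear_def partial_add_schwartz partial_cmult_schwartz)
next
  case (WAdd a b)
  have "schwartz_linear (wexpr_dact a f)" "schwartz_linear (wexpr_dact b f)" using WAdd by auto
  then show ?case by (simp add: schwartz_linear_def algebra_simps)
next
  case (WMul a b)
  then show ?case by simp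
qed

lemma wexpr_dact_cong:
  "(\<And>u. u \<in> schwartz_space \<Longrightarrow> f u = g u) \<Longrightarrow> u \<in> schwartz_space \<Longrightarrow>
     wexpr_dact a f u = wexpr_dact a g u"
proof (induction a arbitrary: f g u)
  case (WMul a b)
  have "wexpr_dact b f w = wexpr_dact b g w" if "w \<in> schwartz_space" for w
    using WMul.prems(1) that by (rule WMul.IH(2))
  then have "wexpr_dact a (wexpr_dact b f) u = wexpr_dact a (wexpr_dact b g) u"
    using WMul.prems(2) by (rule WMul.IH(1))
  then show ?case by simp
next
  case (WAdd a b)
  have "wexpr_dact a f u = wexpr_dact a g u" using WAdd.prems by (rule WAdd.IH(1))
  moreover have "wexpr_dact b f u = wexpr_dact b g u" using WAdd.prems by (rule WAdd.IH(2))
  ultimately show ?case by simp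
qed (auto simp: schwartz_space_coord schwartz_space_partial)

lemma wexpr_dact_add:
  "u \<in> schwartz_space \<Longrightarrow>
     wexpr_dact a (\<lambda>u. f u + g u) u = wexpr_dact a f u + wexpr_dact a g u"
proof (induction a arbitrary: f g u)
  case (WMul a b)
  have "wexpr_dact a (wexpr_dact b (\<lambda>u. f u + g u)) u =
      wexpr_dact a (\<lambda>u. wexpr_dact b f u + wexpr_dact b g u) u"
    using WMul.prems by (intro wexpr_dact_cong) (rule WMul.IH(2))
  then show ?case using WMul.IH(1)[OF WMul.prems] by simp
next
  case (WAdd a b)
  show ?case by (simp only: wexpr_dact.simps WAdd.IH[OF WAdd.prems] ac_simps)
qed (auto simp: schwartz_space_coord schwartz_space_partial algebra_simps)

lemma wexpr_dact_cmult:
  "u \<in> schwartz_space \<Longrightarrow> wexpr_dact a (\<lambda>u. c * f u) u = c * wexpr_dact a f u"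
proof (induction a arbitrary: f u)
  case (WMul a b)
  have "wexpr_dact a (wexpr_dact b (\<lambda>u. c * f u)) u = wexpr_dact a (\<lambda>u. c * wexpr_dact b f u) u"
    using WMul.prems by (intro wexpr_dact_cong) (rule WMul.IH(2))
  then show ?case using WMul.IH(1)[OF WMul.prems] by simp
next
  case (WAdd a b)
  show ?case by (simp only: wexpr_dact.simps WAdd.IH[OF WAdd.prems] distrib_left)
qed (auto simp: schwartz_space_coord schwartz_space_partial algebra_simps)

lemma wexpr_dact_weq:
  "weq a b \<Longrightarrow> schwartz_linear f \<Longrightarrow> u \<in> schwartz_space \<Longrightarrow> wexpr_dact a f u = wexpr_dact b f u"
proof (induction arbitrary: f u rule: weq.induct)
  case (weq_mul a b c e)
  have "wexpr_dact a (wexpr_dact c f) u = wexpr_dact a (wexpr_dact e f) u"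
    by (rule wexpr_dact_cong) (use weq_mul in auto)
  also have "\<dots> = wexpr_dact b (wexpr_dact e f) u"
    using weq_mul wexpr_dact_linear by blast
  finally show ?case by simp
next
  case (weq_distrib_left a b c)
  then show ?case by (simp add: wexpr_dact_add)
next
  case (weq_const_central c a)
  then show ?case by (simp add: wexpr_dact_cmult)
next
  case (weq_var_commute i j)
  then show ?case by (simp add: mult.left_commute)
next
  case (weq_der_commute i j)
  have "partial i (partial j u) = partial j (partial i u)"
    using partial_commute[OF open_UNIV schwartz_space_smooth] weq_der_commute by blast
  then show ?case by simp
next
  case (weq_der_var i j)
  have "partial i (\<lambda>x. complex_of_real (x $ j) * u x) =
     (\<lambda>x. complex_of_real (x $ j) * partial i u x + (if i = j then 1 else 0) * u x)"
    using weq_der_var by (auto simp: partial_coord schwartz_space_differentiable)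
  then show ?case
    using weq_der_var(1)
      schwartz_linear_add[OF weq_der_var(1) schwartz_space_coord schwartz_space_cmult,
        OF schwartz_space_partial weq_der_var(2), OF weq_der_var(2), of j i "if i = j then 1 else 0"]
      schwartz_linear_cmult[OF weq_der_var, of "if i = j then 1 else 0"]
    by simp
qed (simp_all add: algebra_simps)

text \<open>Both actions are computed on a representative; \<open>weyl_act_abs\<close> and \<open>weyl_dact_abs\<close> show that
  the choice is irrelevant for smooth functions and for tempered distributions.\<close>

definition weyl_act :: "'v::finite weyl \<Rightarrow> (real^'v \<Rightarrow> complex) \<Rightarrow> (real^'v \<Rightarrow> complex)" where
  "weyl_act P = wexpr_act (rep_weyl P)"

definition weyl_dact :: "'v::finite weyl \<Rightarrow>
    ((real^'v \<Rightarrow> complex) \<Rightarrow> complex) \<Rightarrow> ((real^'v \<Rightarrow> complex) \<Rightarrow> complex)" where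
  "weyl_dact P = wexpr_dact (rep_weyl P)"

lemma weq_rep_abs: "weq (rep_weyl (abs_weyl a)) a"
  by (rule Quotient3_rep_abs[OF Quotient3_weyl]) (rule weq_refl)

lemma weyl_act_abs:
  "open S \<Longrightarrow> smooth_on S u \<Longrightarrow> x \<in> S \<Longrightarrow> weyl_act (abs_weyl a) u x = wexpr_act a u x"
  unfolding weyl_act_def by (rule wexpr_act_weq[OF _ weq_rep_abs])

lemma weyl_dact_abs:
  "tempered_distribution f \<Longrightarrow> u \<in> schwartz_space \<Longrightarrow> weyl_dact (abs_weyl a) f u = wexpr_dact a f u"
  unfolding weyl_dact_def
  by (rule wexpr_dact_weq[OF weq_rep_abs tempered_distribution_linear])

text \<open>Only smooth functions form a module over the Weyl algebra, so smoothness is part of being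
  annihilated.\<close>

definition annihilates_on :: "(real^'v::finite) set \<Rightarrow> 'v weyl \<Rightarrow> (real^'v \<Rightarrow> complex) \<Rightarrow> bool" where
  "annihilates_on S P u \<longleftrightarrow> smooth_on S u \<and> (\<forall>x\<in>S. weyl_act P u x = 0)"

definition annihilates_dist :: "'v::finite weyl \<Rightarrow> ((real^'v \<Rightarrow> complex) \<Rightarrow> complex) \<Rightarrow> bool" where
  "annihilates_dist P f \<longleftrightarrow> (\<forall>u\<in>schwartz_space. weyl_dact P f u = 0)"

instantiation weyl :: (finite) ring_1
begin

lift_definition zero_weyl :: "'a weyl" is "WConst 0" .
lift_definition one_weyl :: "'a weyl" is "WConst 1" .
lift_definition plus_weyl :: "'a weyl \<Rightarrow> 'a weyl \<Rightarrow> 'a weyl" is WAdd by (rule weq_add)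
lift_definition times_weyl :: "'a weyl \<Rightarrow> 'a weyl \<Rightarrow> 'a weyl" is WMul by (rule weq_mul)
lift_definition uminus_weyl :: "'a weyl \<Rightarrow> 'a weyl" is "WMul (WConst (-1))"
  by (rule weq_mul[OF weq_refl])
definition minus_weyl :: "'a weyl \<Rightarrow> 'a weyl \<Rightarrow> 'a weyl" where
  "minus_weyl P Q = P + - Q"

instance
proof
  fix P Q R :: "'a weyl"
  show "P + Q + R = P + (Q + R)" by transfer (rule weq_add_assoc)
  show "P + Q = Q + P" by transfer (rule weq_add_commute)
  show "0 + P = P" by transfer (rule weq_add_zero)
  show "- P + P = 0" by transfer (rule weq_add_uminus)
  show "P - Q = P + - Q" by (rule minus_weyl_def)
  show "P * Q * R = P * (Q * R)" by transfer (rule weq_mul_assoc)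
  show "1 * P = P" by transfer (rule weq_one_mul)
  show "P * 1 = P" by transfer (rule weq_trans[OF weq_sym[OF weq_const_central] weq_one_mul])
  show "(P + Q) * R = P * R + Q * R" by transfer (rule weq_distrib_right)
  show "P * (Q + R) = P * Q + P * R" by transfer (rule weq_distrib_left)
  show "(0::'a weyl) \<noteq> 1"
  proof (transfer, rule notI)
    assume *: "weq (WConst 0) (WConst 1 :: 'a wexpr)"
    have "smooth_on UNIV ((\<lambda>_. 1) :: real^'a \<Rightarrow> complex)"
    proof (rule smooth_on_coinduct[where Q = "\<lambda>u. \<exists>c. u = (\<lambda>_. c)"])
      fix u :: "real^'a \<Rightarrow> complex" and i
      assume "\<exists>c. u = (\<lambda>_. c)"
      then show "\<exists>v. (\<exists>c. v = (\<lambda>_. c)) \<and> (\<forall>x\<in>UNIV. partial i u x = v x)"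
        by (auto simp: partial_def)
    qed auto
    from wexpr_act_weq[OF open_UNIV * this] show False by simp
  qed
qed

end

lift_definition weyl_const :: "complex \<Rightarrow> 'v::finite weyl" is WConst .
lift_definition weyl_var :: "'v::finite \<Rightarrow> 'v weyl" is WVar .
lift_definition weyl_der :: "'v::finite \<Rightarrow> 'v weyl" is WDer .

lemma weyl_const_simps:
  "weyl_const 0 = 0" "weyl_const 1 = 1"
  "weyl_const (c + e) = weyl_const c + weyl_const e"
  "weyl_const (c * e) = weyl_const c * weyl_const e"
proof -
  show "weyl_const 0 = 0" "weyl_const 1 = 1" by (transfer; rule weq_refl)+
  show "weyl_const (c + e) = weyl_const c + weyl_const e" by transfer (rule weq_const_add)
  show "weyl_const (c * e) = weyl_const c * weyl_const e" by transfer (rule weq_const_mul)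
qed

lemma weyl_const_central: "weyl_const c * P = P * weyl_const c"
  by transfer (rule weq_const_central)

lemma weyl_relations:
  "weyl_var i * weyl_var j = weyl_var j * weyl_var i"
  "weyl_der i * weyl_der j = weyl_der j * weyl_der i"
  "weyl_der i * weyl_var j = weyl_var j * weyl_der i + (if i = j then 1 else 0)"
proof -
  have "weyl_der i * weyl_var j = weyl_var j * weyl_der i + weyl_const (if i = j then 1 else 0)"
    by transfer (rule weq_der_var)
  then show "weyl_der i * weyl_var j = weyl_var j * weyl_der i + (if i = j then 1 else 0)"
    by (cases "i = j") (simp_all add: weyl_const_simps(1,2))
  show "weyl_var i * weyl_var j = weyl_var j * weyl_var i" by transfer (rule weq_var_commute)
  show "weyl_der i * weyl_der j = weyl_der j * weyl_der i" by transfer (rule weq_der_commute)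
qed

definition weyl_scale :: "complex \<Rightarrow> 'v::finite weyl \<Rightarrow> 'v weyl" where
  "weyl_scale c P = weyl_const c * P"

global_interpretation weyl: vector_space "weyl_scale :: complex \<Rightarrow> 'v::finite weyl \<Rightarrow> 'v weyl"
  by unfold_locales (simp_all add: weyl_scale_def weyl_const_simps distrib_left distrib_right mult.assoc)

definition left_ideal :: "'r::ring_1 set \<Rightarrow> bool" where
  "left_ideal I \<longleftrightarrow> 0 \<in> I \<and> (\<forall>a\<in>I. \<forall>b\<in>I. a + b \<in> I) \<and> (\<forall>r. \<forall>a\<in>I. r * a \<in> I)"

text \<open>The Bernstein filtration: \<open>bernstein k\<close> is the span of the monomials
  \<open>x\<^sup>\<alpha> \<partial>\<^sup>\<beta>\<close> with \<open>\<bar>\<alpha>\<bar> + \<bar>\<beta>\<bar> \<le> k\<close>.\<close>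

definition bernstein :: "nat \<Rightarrow> 'v::finite weyl set" where
  "bernstein k = weyl.span {prod_list (map weyl_var is) * prod_list (map weyl_der js) | is js.
     length is + length js \<le> k}"

text \<open>The dimension of \<open>F\<^sub>k / (F\<^sub>k \<inter> I)\<close>, that is, of the \<open>k\<close>-th step of the
  filtration of \<open>D / I\<close> induced by the Bernstein filtration \<open>F\<close> of \<open>D\<close> (which is a good
  filtration, as \<open>D / I\<close> is cyclic).\<close>

definition hilbert_function :: "'v::finite weyl set \<Rightarrow> nat \<Rightarrow> nat" where
  "hilbert_function I k = weyl.dim (bernstein k :: 'v weyl set) - weyl.dim (bernstein k \<inter> I)"

text \<open>The module \<open>D / I\<close> is holonomic if it is zero or if its dimension, the degree of its Hilbert
  polynomial, equals the number of variables.\<close>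

definition holonomic_ideal :: "'v::finite weyl set \<Rightarrow> bool" where
  "holonomic_ideal I \<longleftrightarrow> left_ideal I \<and>
     (I = UNIV \<or>
      (\<exists>p::rat poly. degree p = CARD('v) \<and>
         (\<forall>\<^sub>F k in sequentially. of_nat (hilbert_function I k) = poly p (of_nat k))))"

text \<open>The coordinates on pairs \<open>(x, y)\<close> are indexed by \<open>'d uprod + 'd\<close>: an unordered pair
  \<open>Upair i j = Upair j i\<close> (with \<open>i = j\<close> allowed) stands for the coordinate \<open>x\<^sub>i\<^sub>j = x\<^sub>j\<^sub>i\<close>, and an
  element of \<open>'d\<close> for a coordinate of \<open>y\<close>.\<close>

instance uprod :: (finite) finite
  by standard simp

type_synonym 'd xy = "'d uprod + 'd"

abbreviation xvar :: "'d \<Rightarrow> 'd \<Rightarrow> 'd xy" where "xvar i j \<equiv> Inl (Upair i j)"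
abbreviation yvar :: "'d \<Rightarrow> 'd xy" where "yvar k \<equiv> Inr k"

definition xmat :: "real^('d::finite xy) \<Rightarrow> real^'d^'d" where
  "xmat p = (\<chi> i j. p $ xvar i j)"

definition yvec :: "real^('d::finite xy) \<Rightarrow> real^'d" where
  "yvec p = (\<chi> k. p $ yvar k)"

definition Omega :: "(real^('d::finite xy)) set" where
  "Omega = {p. \<forall>v. v \<noteq> 0 \<longrightarrow> 0 < v \<bullet> ((- xmat p) *v v)}"

definition hfun :: "real^('d::finite xy) \<Rightarrow> real^'d \<Rightarrow> real" where
  "hfun p t = (\<Sum>i\<in>UNIV. \<Sum>j\<in>UNIV. xmat p $ i $ j * t $ i * t $ j) + (\<Sum>i\<in>UNIV. yvec p $ i * t $ i)"

primrec phi_expr :: "'d::finite wexpr \<Rightarrow> 'd xy weyl" where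
  "phi_expr (WConst c) = weyl_const c"
| "phi_expr (WVar i) = weyl_der (yvar i)"
| "phi_expr (WDer i) = - weyl_var (yvar i) - 2 * (\<Sum>k\<in>UNIV. weyl_var (xvar i k) * weyl_der (yvar k))"
| "phi_expr (WAdd a b) = phi_expr a + phi_expr b"
| "phi_expr (WMul a b) = phi_expr a * phi_expr b"

lemma phi_der_var:
  fixes i j :: "'d::finite"
  shows "phi_expr (WDer i) * phi_expr (WVar j) =
     phi_expr (WVar j) * phi_expr (WDer i) + (if i = j then 1 else 0)"
proof -
  have y: "weyl_der (yvar j) * weyl_var (yvar i) =
      weyl_var (yvar i) * weyl_der (yvar j) + (if i = j then 1 else 0 :: 'd xy weyl)"
    by (simp add: weyl_relations(3))
  have "weyl_der (yvar j) * (weyl_var (xvar i k) * weyl_der (yvar k)) =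
      weyl_var (xvar i k) * weyl_der (yvar k) * weyl_der (yvar j)" for k
  proof -
    have "weyl_der (yvar j) * (weyl_var (xvar i k) * weyl_der (yvar k)) =
        (weyl_der (yvar j) * weyl_var (xvar i k)) * weyl_der (yvar k)" by (simp only: mult.assoc)
    also have "weyl_der (yvar j) * weyl_var (xvar i k) = weyl_var (xvar i k) * weyl_der (yvar j)"
      by (simp add: weyl_relations(3))
    also have "weyl_var (xvar i k) * weyl_der (yvar j) * weyl_der (yvar k) =
        weyl_var (xvar i k) * (weyl_der (yvar j) * weyl_der (yvar k))" by (simp only: mult.assoc)
    also have "weyl_der (yvar j) * weyl_der (yvar k) = weyl_der (yvar k) * weyl_der (yvar j)"
      by (rule weyl_relations(2))
    finally show ?thesis by (simp only: mult.assoc)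
  qed
  then have "weyl_der (yvar j) * (\<Sum>k\<in>UNIV. weyl_var (xvar i k) * weyl_der (yvar k)) =
     (\<Sum>k\<in>UNIV. weyl_var (xvar i k) * weyl_der (yvar k)) * weyl_der (yvar j)"
    by (simp add: sum_distrib_left sum_distrib_right)
  then show ?thesis
    using y by (simp add: algebra_simps mult_2 mult_2_right)
qed

lemma phi_der_commute:
  fixes i j :: "'d::finite"
  shows "phi_expr (WDer i) * phi_expr (WDer j) = phi_expr (WDer j) * phi_expr (WDer i)"
proof -
  let ?T = "\<lambda>i. \<Sum>k\<in>UNIV. weyl_var (xvar i k) * weyl_der (yvar k) :: 'd xy weyl"
  have "weyl_var (xvar i k) * weyl_der (yvar k) * weyl_var (yvar j) = weyl_var (yvar j) * (weyl_var (xvar i k) * weyl_der (yvar k))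
      + (if k = j then weyl_var (xvar i j) else 0 :: 'd xy weyl)" for i j k :: 'd
  proof -
    have "weyl_var (xvar i k) * weyl_der (yvar k) * weyl_var (yvar j) =
        weyl_var (xvar i k) * (weyl_der (yvar k) * weyl_var (yvar j))" by (simp only: mult.assoc)
    also have "weyl_der (yvar k) * weyl_var (yvar j) =
        weyl_var (yvar j) * weyl_der (yvar k) + (if k = j then 1 else 0 :: 'd xy weyl)"
      by (simp add: weyl_relations(3))
    also have "weyl_var (xvar i k) * \<dots> = (weyl_var (xvar i k) * weyl_var (yvar j)) * weyl_der (yvar k)
        + (if k = j then weyl_var (xvar i j) else 0)" by (simp add: distrib_left mult.assoc)
    also have "weyl_var (xvar i k) * weyl_var (yvar j) = (weyl_var (yvar j) * weyl_var (xvar i k) :: 'd xy weyl)"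
      by (rule weyl_relations(1))
    finally show ?thesis by (simp only: mult.assoc)
  qed
  then have ty: "?T i * weyl_var (yvar j) = weyl_var (yvar j) * ?T i + weyl_var (xvar i j)" for i j :: 'd
    by (simp add: sum_distrib_left sum_distrib_right sum.distrib)
  have dx: "weyl_der (yvar k) * weyl_var (xvar j l) = (weyl_var (xvar j l) * weyl_der (yvar k) :: 'd xy weyl)" for k j l :: 'd
    by (simp add: weyl_relations(3))
  have "weyl_var (xvar i k) * weyl_der (yvar k) * (weyl_var (xvar j l) * weyl_der (yvar l)) =
      (weyl_var (xvar j l) * weyl_der (yvar l)) * (weyl_var (xvar i k) * weyl_der (yvar k) :: 'd xy weyl)" for k l :: 'd
  proof -
    have "weyl_var (xvar i k) * weyl_der (yvar k) * (weyl_var (xvar j l) * weyl_der (yvar l)) =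
       weyl_var (xvar i k) * (weyl_der (yvar k) * weyl_var (xvar j l)) * (weyl_der (yvar l) :: 'd xy weyl)"
      by (simp add: mult.assoc)
    also have "\<dots> = (weyl_var (xvar i k) * weyl_var (xvar j l)) * (weyl_der (yvar k) * weyl_der (yvar l))"
      by (simp add: dx mult.assoc)
    also have "\<dots> = (weyl_var (xvar j l) * weyl_var (xvar i k)) * (weyl_der (yvar l) * weyl_der (yvar k))"
      by (rule arg_cong2[where f = "(*)"]) (rule weyl_relations)+
    also have "\<dots> = weyl_var (xvar j l) * (weyl_der (yvar l) * weyl_var (xvar i k)) * weyl_der (yvar k)"
      by (simp add: dx mult.assoc)
    finally show ?thesis by (simp add: mult.assoc)
  qed
  then have "?T i * ?T j = (\<Sum>k\<in>UNIV. \<Sum>l\<in>UNIV.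
      (weyl_var (xvar j l) * weyl_der (yvar l)) * (weyl_var (xvar i k) * weyl_der (yvar k)))"
    by (simp add: sum_product)
  also have "\<dots> = ?T j * ?T i"
    unfolding sum_product by (rule sum.swap)
  finally have tt: "?T i * ?T j = ?T j * ?T i" .
  have sym: "xvar i j = xvar j i" by simp
  show ?thesis
    using ty[of i j] ty[of j i] tt weyl_relations(1)[of "yvar i" "yvar j"] sym
    by (simp add: algebra_simps mult_2 mult_2_right)
qed

lift_definition phi :: "'d::finite weyl \<Rightarrow> 'd xy weyl" is phi_expr
proof -
  fix a b :: "'d wexpr"
  show "weq a b \<Longrightarrow> phi_expr a = phi_expr b"
  proof (induction rule: weq.induct)
    case (weq_add_uminus a)
    have "weyl_const (- 1) + 1 = (0 :: 'd xy weyl)"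
      unfolding weyl_const_simps(1,2)[symmetric] weyl_const_simps(3)[symmetric] by simp
    then have "weyl_const (- 1) * phi_expr a + 1 * phi_expr a = 0"
      unfolding distrib_right[symmetric] by simp
    then show ?case by (simp add: weyl_const_simps)
  next
    case (weq_der_commute i j)
    then show ?case using phi_der_commute by simp
  next
    case (weq_der_var i j)
    then show ?case using phi_der_var[of i j] by (auto simp: weyl_const_simps)
  next
    case (weq_const_central c a)
    show ?case by (simp only: phi_expr.simps) (rule weyl_const_central)
  next
    case (weq_var_commute i j)
    show ?case by (simp only: phi_expr.simps) (rule weyl_relations(2))
  qed (simp_all add: weyl_const_simps add.assoc mult.assoc distrib_left distrib_right add.commute)
qed

lemma phi_morphism:
  "phi (weyl_const c) = weyl_const c"
  "phi (P + Q) = phi P + phi Q"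
  "phi (P * Q) = phi P * phi Q"
  "phi (weyl_var i) = weyl_der (yvar i)"
  "phi (weyl_der i) = - weyl_var (yvar i) - 2 * (\<Sum>k\<in>UNIV. weyl_var (xvar i k) * weyl_der (yvar k))"
  by (transfer; simp)+

definition heat_ops :: "'d::finite xy weyl set" where
  "heat_ops = {weyl_der (xvar i j) - 2 * weyl_der (yvar i) * weyl_der (yvar j) | i j. i \<noteq> j}
     \<union> {weyl_der (xvar i i) - weyl_der (yvar i) ^ 2 | i. True}"

end

theory Submission
  imports Defs "HOL-Computational_Algebra.Primes"
begin

text \<open>Annihilation: put \<open>G T p = T (exp (hfun p t))\<close>. Since \<open>hfun p t\<close> is linear in \<open>p\<close>, a continuous
  functional may be differentiated under the pairing, so that \<open>\<partial>\<close> in \<open>y\<^sub>i\<close> multiplies by \<open>t\<^sub>i\<close> and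
  \<open>\<partial>\<close> in \<open>x\<^sub>i\<^sub>j\<close> multiplies by \<open>t\<^sub>i t\<^sub>j\<close> (doubled for \<open>i \<noteq> j\<close>); by induction on \<open>P\<close>, \<open>phi P\<close> sends
  \<open>G T\<close> to \<open>G (P T)\<close>.

  Holonomicity: let \<open>I\<close> be the ideal of the \<open>P\<^sub>k\<close> and \<open>J\<close> the one generated in \<open>D\<^sub>x\<^sub>y\<close>. The heat operators
  commute with the image of \<open>phi\<close>, so modulo \<open>J\<close> every operator is a combination of products
  \<open>x\<^sup>B phi Q\<close> with \<open>Q\<close> running over representatives of \<open>D\<^sub>t / I\<close>. These products are independent modulo \<open>J\<close>,
  because \<open>D\<^sub>x\<^sub>y\<close> acts on power series in \<open>x\<close> with coefficients in \<open>D\<^sub>t\<close> in such a way that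
  \<open>x\<^sup>B phi Q\<close> sends \<open>1\<close> to \<open>Q x\<^sup>B\<close> while \<open>J\<close> sends \<open>1\<close> to series with coefficients in \<open>I\<close>. Passing
  between the Bernstein filtration and these normal forms at most triples degrees, so the Hilbert
  function of \<open>J\<close> has the growth of that of \<open>I\<close> times \<open>k\<close> to the number of \<open>x\<close>-variables. It is eventually
  a polynomial, as it counts the monomials outside the set of leading monomials of \<open>J\<close>, which is
  closed under multiplication.\<close>

section \<open>Counting outside monomial ideals\<close>

text \<open>Behind the holonomicity lies a change of generators. The \<open>x\<close>-variables, the
  heat operators and the image of \<open>phi\<close> generate D_xy, because \<open>y_i\<close> can
  be solved from the formula for \<open>phi (weyl_der i)\<close>, and they satisfy exactly the
  relations of the tensor product of D_x and D_t, the heat operators taking the place of the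
  \<open>x\<close>-derivatives. In these generators D_xy / J is the tensor product of C[x] and D_t /
  I, whose dimension is the number of \<open>x\<close>-variables plus \<open>d\<close>, as required.
  The obstacle is that holonomicity is measured by the Bernstein filtration, which this change of
  generators does not respect: an \<open>x\<close>-derivative corresponds to a quadratic polynomial
  in \<open>t\<close>, and \<open>phi (weyl_der i)\<close> contains terms of degree two. The Hilbert
  functions of I and J can thus be compared only at rescaled arguments. This determines an order of
  growth but not polynomiality, which is therefore proved for arbitrary left ideals; growth then
  only has to fix the degree.\<close>

definition eventually_poly :: "(nat \<Rightarrow> nat) \<Rightarrow> bool" where
  "eventually_poly f \<longleftrightarrow> (\<exists>p::rat poly. \<forall>\<^sub>F k in sequentially. of_nat (f k) = poly p (of_nat k))"

text \<open>Summing the differences of consecutive powers of exponent \<open>Suc m\<close>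
  telescopes, and the binomial theorem turns each difference into the power of exponent
  \<open>m\<close> plus lower powers. Solving for the former gives the strong induction.\<close>

lemma sum_power_poly:
  "\<exists>q::'a::field_char_0 poly. \<forall>n. (\<Sum>i\<le>n. of_nat i ^ m) = poly q (of_nat n)"
proof (induction m rule: less_induct)
  case (less m)
  then obtain q :: "nat \<Rightarrow> 'a poly"
    where q: "\<And>j n. j < m \<Longrightarrow> (\<Sum>i\<le>n. of_nat i ^ j) = poly (q j) (of_nat n)" by metis
  let ?r = "smult (1 / of_nat (Suc m))
    ([:1, 1:] ^ Suc m - (\<Sum>j<m. smult (of_nat (Suc m choose j)) (q j)))"
  have "(\<Sum>i\<le>n. of_nat i ^ m) = poly ?r (of_nat n)" for n
  proof -
    have step: "(of_nat i + 1) ^ Suc m - of_nat i ^ Suc m =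
        of_nat (Suc m) * of_nat i ^ m + (\<Sum>j<m. of_nat (Suc m choose j) * (of_nat i :: 'a) ^ j)" for i
    proof -
      have "(of_nat i + 1 :: 'a) ^ Suc m = (\<Sum>j\<le>Suc m. of_nat (Suc m choose j) * of_nat i ^ j)"
        by (subst binomial_ring) simp
      then show ?thesis by (simp add: lessThan_Suc_atMost[symmetric] del: binomial_Suc_Suc power_Suc)
    qed
    have "(of_nat n + 1 :: 'a) ^ Suc m = (\<Sum>i\<le>n. (of_nat i + 1) ^ Suc m - of_nat i ^ Suc m)"
      by (induction n) (simp_all add: add.commute)
    also have "\<dots> = of_nat (Suc m) * (\<Sum>i\<le>n. of_nat i ^ m)
        + (\<Sum>j<m. of_nat (Suc m choose j) * poly (q j) (of_nat n))"
      unfolding step sum.distrib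
      by (subst sum.swap[of _ "{..<m}"]) (simp add: sum_distrib_left[symmetric] q)
    finally show ?thesis
      by (simp add: poly_sum field_simps del: of_nat_Suc)
  qed
  then show ?case by blast
qed

lemma sum_poly_poly:
  fixes p :: "'a::field_char_0 poly"
  shows "\<exists>q. \<forall>n. (\<Sum>i\<le>n. poly p (of_nat i)) = poly q (of_nat n)"
proof -
  obtain q :: "nat \<Rightarrow> 'a poly" where q: "\<And>m n. (\<Sum>i\<le>n. of_nat i ^ m) = poly (q m) (of_nat n)"
    using sum_power_poly by metis
  have "(\<Sum>i\<le>n. poly p (of_nat i)) = poly (\<Sum>m\<le>degree p. smult (coeff p m) (q m)) (of_nat n)" for n
    unfolding poly_altdef[of p] by (subst sum.swap) (simp add: sum_distrib_left[symmetric] q poly_sum)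
  then show ?thesis by blast
qed

lemma eventually_poly_const: "eventually_poly (\<lambda>_. c)"
  unfolding eventually_poly_def by (intro exI[of _ "[:of_nat c:]"]) simp

lemma eventually_poly_add:
  assumes "eventually_poly f" "eventually_poly g"
  shows "eventually_poly (\<lambda>k. f k + g k)"
proof -
  obtain p q :: "rat poly" where "\<forall>\<^sub>F k in sequentially. of_nat (f k) = poly p (of_nat k)"
    "\<forall>\<^sub>F k in sequentially. of_nat (g k) = poly q (of_nat k)"
    using assms unfolding eventually_poly_def by blast
  then have "\<forall>\<^sub>F k in sequentially. of_nat (f k + g k) = poly (p + q) (of_nat k)"
    by eventually_elim simp
  then show ?thesis unfolding eventually_poly_def by blast
qed

lemma eventually_poly_sum:
  "(\<And>j. j \<in> A \<Longrightarrow> eventually_poly (f j)) \<Longrightarrow> eventually_poly (\<lambda>k. \<Sum>j\<in>A. f j k)"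
  by (induction A rule: infinite_finite_induct)
    (auto intro: eventually_poly_add eventually_poly_const)

lemma eventually_poly_shift:
  assumes "eventually_poly f"
  shows "eventually_poly (\<lambda>k. f (k - j))"
proof -
  obtain p :: "rat poly" where p: "\<forall>\<^sub>F k in sequentially. of_nat (f k) = poly p (of_nat k)"
    using assms unfolding eventually_poly_def by blast
  then obtain N where N: "\<And>k. k \<ge> N \<Longrightarrow> of_nat (f k) = poly p (of_nat k)"
    by (auto simp: eventually_sequentially)
  have "of_nat (f (k - j)) = poly (pcompose p [:- of_nat j, 1:]) (of_nat k)" if "k \<ge> N + j" for k
    using that by (simp add: N poly_pcompose of_nat_diff)
  then show ?thesis unfolding eventually_poly_def eventually_sequentially by blast
qed

lemma eventually_poly_cumulative:
  assumes "eventually_poly f"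
  shows "eventually_poly (\<lambda>k. \<Sum>i\<le>k. f i)"
proof -
  obtain p :: "rat poly" where p: "\<forall>\<^sub>F k in sequentially. of_nat (f k) = poly p (of_nat k)"
    using assms unfolding eventually_poly_def by blast
  then obtain N where N: "\<And>k. k \<ge> N \<Longrightarrow> of_nat (f k) = poly p (of_nat k)"
    by (auto simp: eventually_sequentially)
  obtain q where q: "\<And>n. (\<Sum>i\<le>n. poly p (of_nat i)) = poly q (of_nat n)"
    using sum_poly_poly by metis
  \<comment> \<open>The values up to \<open>N\<close>, where \<open>f\<close> and \<open>p\<close>
    may disagree, change the sum only by a constant.\<close>
  define c where "c = (\<Sum>i\<le>N. of_nat (f i)) - (\<Sum>i\<le>N. poly p (of_nat i))"
  have "of_nat (\<Sum>i\<le>k. f i) = poly (q + [:c:]) (of_nat k)" if "k \<ge> N" for k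
    using that
  proof (induction k rule: dec_induct)
    case base
    then show ?case by (simp add: c_def q[symmetric])
  next
    case (step k)
    have "poly q (of_nat (Suc k)) = poly q (of_nat k) + of_nat (f (Suc k))"
      using q[of "Suc k"] q[of k] N[of "Suc k"] step.hyps by simp
    then show ?case using step.IH by simp
  qed
  then show ?thesis unfolding eventually_poly_def eventually_sequentially by blast
qed

section \<open>Monomial ideals as upward closed sets of exponent multisets, and Dickson's
  lemma\<close>

definition upset :: "'a multiset set \<Rightarrow> bool" where
  "upset U \<longleftrightarrow> (\<forall>M\<in>U. \<forall>N. M + N \<in> U)"

lemma upset_subset: "upset U \<Longrightarrow> M \<in> U \<Longrightarrow> M \<subseteq># N \<Longrightarrow> N \<in> U"
  unfolding upset_def by (metis subset_mset.add_diff_inverse)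

text \<open>The colon ideal of \<open>U\<close> by the \<open>j\<close>-th power of
  \<open>s\<close>. Read on monomials free of \<open>s\<close>, it describes the members of
  \<open>U\<close> of exponent exactly \<open>j\<close> in \<open>s\<close>, which allows induction
  on the number of variables.\<close>

definition slice :: "'a \<Rightarrow> 'a multiset set \<Rightarrow> nat \<Rightarrow> 'a multiset set" where
  "slice s U j = {M. M + replicate_mset j s \<in> U}"

lemma upset_slice:
  assumes "upset U"
  shows "upset (slice s U j)"
proof -
  have "M + N + replicate_mset j s \<in> U" if "M + replicate_mset j s \<in> U" for M N
  proof -
    have "M + replicate_mset j s + N \<in> U" using assms that unfolding upset_def by blast
    then show ?thesis by (simp only: ac_simps)
  qed
  then show ?thesis by (simp add: upset_def slice_def)
qed

lemma slice_mono: "upset U \<Longrightarrow> i \<le> j \<Longrightarrow> slice s U i \<subseteq> slice s U j"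
proof
  fix M assume "upset U" "i \<le> j" "M \<in> slice s U i"
  then have "M + replicate_mset i s + replicate_mset (j - i) s \<in> U"
    by (simp add: slice_def upset_def)
  moreover have "replicate_mset i s + replicate_mset (j - i) s = replicate_mset j s"
    using \<open>i \<le> j\<close> by (intro multiset_eqI) simp
  ultimately show "M \<in> slice s U j" by (simp add: slice_def add.assoc)
qed

lemma upset_UN: "(\<And>j. upset (V j)) \<Longrightarrow> upset (\<Union>j. V j)"
  unfolding upset_def by blast

lemma mset_insert_decompose:
  assumes "set_mset M \<subseteq> insert s S"
  obtains M' j where "M = M' + replicate_mset j s" "set_mset M' \<subseteq> S"
proof
  show "M = filter_mset (\<lambda>x. x \<noteq> s) M + replicate_mset (count M s) s"
    by (rule multiset_eqI) (simp add: not_in_iff)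
  show "set_mset (filter_mset (\<lambda>x. x \<noteq> s) M) \<subseteq> S" using assms by auto
qed

text \<open>The slices increase with \<open>j\<close>. A finite basis of their union already lies in
  one slice, and from there on the chain is constant on monomials over \<open>S\<close>.\<close>

lemma chain_stable_of_basis:
  assumes up: "upset U" and B: "finite B" "B \<subseteq> (\<Union>j. slice s U j)"
    and gen: "\<forall>M\<in>(\<Union>j. slice s U j). set_mset M \<subseteq> S \<longrightarrow> (\<exists>b\<in>B. b \<subseteq># M)"
  shows "\<exists>J. B \<subseteq> slice s U J \<and> (\<forall>j\<ge>J. \<forall>M. set_mset M \<subseteq> S \<longrightarrow> M \<in> slice s U j \<longleftrightarrow> M \<in> slice s U J)"
proof -
  have "\<forall>b\<in>B. \<exists>j. b \<in> slice s U j" using B by blast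
  then obtain c where c: "\<And>b. b \<in> B \<Longrightarrow> b \<in> slice s U (c b)" by metis
  \<comment> \<open>The sum serves as a common upper bound of the indices and also covers an empty
    \<open>B\<close>.\<close>
  define J where "J = (\<Sum>b\<in>B. c b)"
  have BJ: "b \<in> slice s U J" if "b \<in> B" for b
    using slice_mono[OF up member_le_sum[of b B c]] c[OF that] that B(1) unfolding J_def by auto
  have "M \<in> slice s U J" if "M \<in> slice s U j" "set_mset M \<subseteq> S" for M j
    using gen that BJ upset_subset[OF upset_slice[OF up]] by blast
  then show ?thesis using slice_mono[OF up] BJ by blast
qed

text \<open>Dickson's lemma, one variable at a time. Exponents of \<open>s\<close> from
  \<open>J\<close> on are served by the basis of the union of all slices, lifted by the
  \<open>J\<close>-th power of \<open>s\<close>; each of the finitely many smaller exponents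
  contributes a basis of its own slice.\<close>

lemma dickson:
  assumes "finite S" "upset U"
  shows "\<exists>B. finite B \<and> B \<subseteq> U \<and> (\<forall>M\<in>U. set_mset M \<subseteq> S \<longrightarrow> (\<exists>b\<in>B. b \<subseteq># M))"
  using assms
proof (induction S arbitrary: U rule: finite_induct)
  case empty
  show ?case by (rule exI[of _ "U \<inter> {{#}}"]) auto
next
  case (insert s S)
  let ?V = "\<Union>j. slice s U j"
  have "upset ?V" using insert.prems by (intro upset_UN upset_slice)
  from insert.IH[OF this] obtain B where B: "finite B" "B \<subseteq> ?V"
    "\<forall>M\<in>?V. set_mset M \<subseteq> S \<longrightarrow> (\<exists>b\<in>B. b \<subseteq># M)" by (elim exE conjE)
  from chain_stable_of_basis[OF insert.prems B] obtain J where J: "B \<subseteq> slice s U J"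
    by (elim exE conjE)
  have "\<forall>j. \<exists>C. finite C \<and> C \<subseteq> slice s U j \<and>
      (\<forall>M\<in>slice s U j. set_mset M \<subseteq> S \<longrightarrow> (\<exists>b\<in>C. b \<subseteq># M))"
    using insert.IH upset_slice[OF insert.prems] by blast
  then obtain C where C: "\<And>j. finite (C j)" "\<And>j. C j \<subseteq> slice s U j"
    "\<And>j M. M \<in> slice s U j \<Longrightarrow> set_mset M \<subseteq> S \<Longrightarrow> \<exists>b\<in>C j. b \<subseteq># M" by metis
  define B' where "B' = (\<lambda>M. M + replicate_mset J s) ` B \<union> (\<Union>j<J. (\<lambda>M. M + replicate_mset j s) ` C j)"
  have "finite B'" unfolding B'_def using B(1) C(1) by auto
  moreover have "B' \<subseteq> U" unfolding B'_def using J C(2) by (auto simp: slice_def)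
  moreover have "\<exists>b\<in>B'. b \<subseteq># M" if M: "M \<in> U" "set_mset M \<subseteq> insert s S" for M
  proof -
    obtain M' j where dec: "M = M' + replicate_mset j s" and S': "set_mset M' \<subseteq> S"
      using M(2) by (rule mset_insert_decompose)
    have M': "set_mset M' \<subseteq> S" "M' \<in> slice s U j" using M(1) S' dec by (auto simp: slice_def)
    show ?thesis
    proof (cases "j < J")
      case True
      then obtain b where "b \<in> C j" "b \<subseteq># M'" using C(3) M' by blast
      then have "b + replicate_mset j s \<in> B'" "b + replicate_mset j s \<subseteq># M"
        unfolding B'_def using True dec by (auto simp: subset_mset.add_right_mono)
      then show ?thesis by blast
    next
      case False
      obtain b where b: "b \<in> B" "b \<subseteq># M'" using B(3) M' by blast
      have "replicate_mset J s \<subseteq># replicate_mset j s"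
        using False by (simp add: subseteq_mset_def)
      then have "b + replicate_mset J s \<in> B'" "b + replicate_mset J s \<subseteq># M"
        unfolding B'_def using b dec by (auto intro: subset_mset.add_mono)
      then show ?thesis by blast
    qed
  qed
  ultimately show ?case by blast
qed

lemma finite_multisets_le: "finite S \<Longrightarrow> finite {M. set_mset M \<subseteq> S \<and> size M \<le> k}"
proof -
  assume S: "finite S"
  have "{M. set_mset M \<subseteq> S \<and> size M \<le> k} \<subseteq> mset ` {xs. set xs \<subseteq> S \<and> length xs \<le> k}"
  proof
    fix M assume "M \<in> {M. set_mset M \<subseteq> S \<and> size M \<le> k}"
    moreover obtain xs where "M = mset xs" using ex_mset by metis
    ultimately show "M \<in> mset ` {xs. set xs \<subseteq> S \<and> length xs \<le> k}" by auto
  qed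
  then show ?thesis using finite_lists_length_le[OF S] finite_subset by blast
qed

definition count_outside :: "'a set \<Rightarrow> 'a multiset set \<Rightarrow> nat \<Rightarrow> nat" where
  "count_outside S U k = card {M. set_mset M \<subseteq> S \<and> size M \<le> k \<and> M \<notin> U}"

lemma count_outside_insert:
  assumes S: "finite S" "s \<notin> S"
  shows "count_outside (insert s S) U k = (\<Sum>j\<le>k. count_outside S (slice s U j) (k - j))"
proof -
  let ?A = "\<lambda>j. {M. set_mset M \<subseteq> S \<and> size M \<le> k - j \<and> M \<notin> slice s U j}"
  let ?f = "\<lambda>j M. M + replicate_mset j s"
  have cnt: "count M s = 0" if "set_mset M \<subseteq> S" for M
    using that S(2) by (auto simp: not_in_iff[symmetric])
  have "{M. set_mset M \<subseteq> insert s S \<and> size M \<le> k \<and> M \<notin> U} = (\<Union>j\<in>{..k}. ?f j ` ?A j)"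
    (is "?L = ?R")
  proof
    show "?R \<subseteq> ?L" by (auto simp: slice_def split: if_splits)
    show "?L \<subseteq> ?R"
    proof
      fix M assume M: "M \<in> ?L"
      then have "set_mset M \<subseteq> insert s S" by simp
      then obtain M' j where dec: "M = M' + replicate_mset j s" and S': "set_mset M' \<subseteq> S"
        by (rule mset_insert_decompose)
      then have "j \<in> {..k}" "M' \<in> ?A j" using M by (auto simp: slice_def)
      then show "M \<in> ?R" using dec by blast
    qed
  qed
  moreover have "card (\<Union>j\<in>{..k}. ?f j ` ?A j) = (\<Sum>j\<le>k. card (?f j ` ?A j))"
  proof (rule card_UN_disjoint)
    show "\<forall>j\<in>{..k}. finite (?f j ` ?A j)"
      by (intro ballI finite_imageI finite_subset[OF _ finite_multisets_le[OF S(1)]]) auto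
    have "\<forall>M \<in> ?f i ` ?A i. count M s = i" for i
      by (simp add: cnt)
    then show "\<forall>i\<in>{..k}. \<forall>j\<in>{..k}. i \<noteq> j \<longrightarrow> ?f i ` ?A i \<inter> ?f j ` ?A j = {}"
      by (metis (no_types, lifting) disjoint_iff)
  qed simp
  moreover have "card (?f j ` ?A j) = card (?A j)" for j
    by (rule card_image) (simp add: inj_on_def)
  ultimately show ?thesis by (simp add: count_outside_def)
qed

text \<open>Monomials are sorted by their exponent in \<open>s\<close>. Exponents below
  \<open>J\<close> give finitely many shifted counting functions; all later slices agree, so
  together they give the cumulative sum of a single counting function.\<close>

lemma eventually_poly_count_outside:
  assumes "finite S" "upset U"
  shows "eventually_poly (count_outside S U)"
  using assms
proof (induction S arbitrary: U rule: finite_induct)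
  case empty
  have "count_outside {} U = (\<lambda>_. card ({{#}} - U))"
    unfolding count_outside_def by (intro ext arg_cong[of _ _ card]) auto
  then show ?case using eventually_poly_const by metis
next
  case (insert s S)
  let ?c = "\<lambda>j. count_outside S (slice s U j)"
  have "upset (\<Union>j. slice s U j)" using insert.prems by (intro upset_UN upset_slice)
  from dickson[OF insert.hyps(1) this] obtain B where B: "finite B" "B \<subseteq> (\<Union>j. slice s U j)"
    and gen: "\<forall>M\<in>(\<Union>j. slice s U j). set_mset M \<subseteq> S \<longrightarrow> (\<exists>b\<in>B. b \<subseteq># M)" by (elim exE conjE)
  from chain_stable_of_basis[OF insert.prems B gen] obtain J
    where J: "\<forall>j\<ge>J. \<forall>M. set_mset M \<subseteq> S \<longrightarrow> M \<in> slice s U j \<longleftrightarrow> M \<in> slice s U J"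
    by (elim exE conjE)
  have stable: "?c j = ?c J" if "j \<ge> J" for j
    unfolding count_outside_def using J[rule_format, OF that] by (intro ext arg_cong[of _ _ card]) auto
  have eq: "count_outside (insert s S) U k = (\<Sum>j<J. ?c j (k - j)) + (\<Sum>i\<le>k - J. ?c J i)"
    if "k \<ge> J" for k
  proof -
    have split: "{..k} = {..<J} \<union> {J..k}" using that by auto
    have "(\<Sum>j\<le>k. ?c j (k - j)) = (\<Sum>j<J. ?c j (k - j)) + (\<Sum>j=J..k. ?c j (k - j))"
      unfolding split by (rule sum.union_disjoint) auto
    also have "(\<Sum>j=J..k. ?c j (k - j)) = (\<Sum>j=J..k. ?c J (k - j))"
      by (intro sum.cong refl fun_cong[OF stable]) simp
    also have "\<dots> = (\<Sum>i\<le>k - J. ?c J i)"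
      by (rule sum.reindex_bij_witness[of _ "\<lambda>i. k - i" "\<lambda>j. k - j"]) (use that in auto)
    finally show ?thesis using count_outside_insert[OF insert.hyps] by simp
  qed
  have "eventually_poly (\<lambda>k. (\<Sum>j<J. ?c j (k - j)) + (\<Sum>i\<le>k - J. ?c J i))"
    using insert.IH[OF upset_slice[OF insert.prems]]
    by (intro eventually_poly_add eventually_poly_sum eventually_poly_shift
        eventually_poly_shift[where f = "\<lambda>n. \<Sum>i\<le>n. ?c J i"] eventually_poly_cumulative)
  then obtain p :: "rat poly" where "\<forall>\<^sub>F k in sequentially.
      of_nat ((\<Sum>j<J. ?c j (k - j)) + (\<Sum>i\<le>k - J. ?c J i)) = poly p (of_nat k)"
    unfolding eventually_poly_def by blast
  then have "\<forall>\<^sub>F k in sequentially. of_nat (count_outside (insert s S) U k) = poly p (of_nat k)"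
    using eventually_ge_at_top[of J] by eventually_elim (simp add: eq)
  then show ?case unfolding eventually_poly_def by blast
qed

section \<open>Order of growth of the number of monomials of bounded degree\<close>

lemma card_multisets_le_upper:
  "card {M :: 'v::finite multiset. size M \<le> k} \<le> (k + 1) ^ CARD('v)"
proof -
  have "inj_on count {M :: 'v multiset. size M \<le> k}" by (simp add: inj_on_def count_inject)
  moreover have "count ` {M :: 'v multiset. size M \<le> k} \<subseteq> Pi\<^sub>E UNIV (\<lambda>_. {..k})"
    using count_le_size order_trans by (fastforce simp: PiE_def)
  ultimately have "card {M :: 'v multiset. size M \<le> k} \<le> card (Pi\<^sub>E (UNIV :: 'v set) (\<lambda>_. {..k}))"
    by (intro card_inj_on_le) (auto intro: finite_PiE)
  then show ?thesis by (simp add: card_PiE)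
qed

text \<open>A box of exponents up to \<open>k\<close> fits into the simplex of total degree
  \<open>CARD('v) * k\<close>. Rescaling the degree is harmless for orders of growth.\<close>

lemma card_multisets_le_lower:
  "(k + 1) ^ CARD('v) \<le> card {M :: 'v::finite multiset. size M \<le> CARD('v) * k}"
proof -
  have c: "count (Abs_multiset f) = f" for f :: "'v \<Rightarrow> nat" by (simp add: count_Abs_multiset)
  have "inj_on Abs_multiset (Pi\<^sub>E (UNIV :: 'v set) (\<lambda>_. {..k}))" by (metis c inj_onI)
  moreover have "Abs_multiset ` (Pi\<^sub>E UNIV (\<lambda>_. {..k})) \<subseteq> {M :: 'v multiset. size M \<le> CARD('v) * k}"
  proof clarify
    fix f :: "'v \<Rightarrow> nat" assume f: "f \<in> Pi\<^sub>E UNIV (\<lambda>_. {..k})"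
    have "size (Abs_multiset f) = (\<Sum>x\<in>set_mset (Abs_multiset f). f x)"
      by (simp add: size_multiset_overloaded_eq c)
    also have "\<dots> \<le> (\<Sum>x\<in>UNIV. f x)" by (rule sum_mono2) auto
    also have "\<dots> \<le> of_nat (card (UNIV :: 'v set)) * k" using f by (intro sum_bounded_above) auto
    finally show "size (Abs_multiset f) \<le> CARD('v) * k" by simp
  qed
  ultimately have "card (Pi\<^sub>E (UNIV :: 'v set) (\<lambda>_. {..k})) \<le> card {M :: 'v multiset. size M \<le> CARD('v) * k}"
    using finite_multisets_le[of "UNIV :: 'v set"] by (intro card_inj_on_le) auto
  then show ?thesis by (simp add: card_PiE)
qed

section \<open>Dimensions of subspaces\<close>

context vector_space
begin

lemma finite_basis:
  assumes "W \<subseteq> span F" "finite F"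
  obtains A where "A \<subseteq> W" "independent A" "W \<subseteq> span A" "finite A" "card A = dim W"
proof -
  obtain A where A: "A \<subseteq> W" "independent A" "W \<subseteq> span A" "card A = dim W"
    using basis_exists by blast
  have "finite A" using independent_span_bound[OF assms(2) A(2)] A(1) assms(1) by blast
  with A that show ?thesis by blast
qed

lemma card_independent_le_dim:
  assumes "V \<subseteq> span F" "finite F" "B \<subseteq> V" "independent B"
  shows "finite B \<and> card B \<le> dim V"
proof -
  obtain A where A: "A \<subseteq> V" "V \<subseteq> span A" "finite A" "card A = dim V"
    using finite_basis[OF assms(1,2)] by metis
  show ?thesis using independent_span_bound[OF A(3) assms(4)] assms(3) A by auto
qed

lemma dim_insert_notin:
  assumes "subspace W" "W \<subseteq> span F" "finite F" "w \<notin> W"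
  shows "dim (span (insert w W)) = Suc (dim W)"
proof -
  obtain A where A: "A \<subseteq> W" "independent A" "W \<subseteq> span A" "finite A" "card A = dim W"
    using finite_basis[OF assms(2,3)] by metis
  have W: "span A = W" using A assms(1) by (metis span_subspace)
  have "independent (insert w A)" using A(2) W assms(4) by (simp add: independent_insertI)
  moreover have "span (insert w A) = span (insert w W)"
    unfolding span_insert W using assms(1) by (simp add: span_eq_iff[THEN iffD2])
  ultimately have "dim (span (insert w W)) = card (insert w A)"
    by (metis dim_span_eq_card_independent)
  moreover have "w \<notin> A" using A assms by blast
  ultimately show ?thesis using A by simp
qed

text \<open>Gaussian elimination, by induction on the basis vector with the largest
  \<open>key\<close>. If some vector of \<open>W\<close> has it as leading term, then
  \<open>W\<close> is spanned by that vector together with its part below, so the dimension grows by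
  one; otherwise \<open>W\<close> lies in the span of the remaining basis.\<close>

lemma dim_eq_card_leading:
  fixes key :: "'i \<Rightarrow> 'k::linorder"
  assumes "finite B" "inj_on key B" "inj_on e B" "independent (e ` B)"
    and "subspace W" "W \<subseteq> span (e ` B)"
  shows "dim W = card {b\<in>B. \<exists>w\<in>W. w - e b \<in> span (e ` {b'\<in>B. key b' < key b})}"
  using assms
proof (induction B arbitrary: W rule: finite_ranking_induct[where f = key])
  case empty
  then have "W \<subseteq> span {}" by simp
  from dim_le_card[OF this] show ?case by simp
next
  case (insert x S)
  show ?case
  proof (cases "x \<in> S")
    case True
    then show ?thesis using insert by (simp add: insert_absorb)
  next
    case False
    let ?W = "W \<inter> span (e ` S)"
    let ?L = "\<lambda>S W. {b\<in>S. \<exists>w\<in>W. w - e b \<in> span (e ` {b'\<in>S. key b' < key b})}"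
    have W': "subspace ?W" "?W \<subseteq> span (e ` S)" "finite (e ` S)"
      using insert by (auto intro: subspace_inter subspace_span)
    have IH: "dim ?W = card (?L S ?W)"
      using insert(4-6) W' independent_mono[OF insert(6)] by (intro insert(3)) auto
    have less: "key b < key x" if "b \<in> S" for b
      using insert(2)[OF that] insert(4) False that by (metis inj_on_eq_iff insertCI order_le_less)
    have low: "{b'\<in>insert x S. key b' < key x} = S"
      using less by auto
    have low': "{b'\<in>insert x S. key b' < key b} = {b'\<in>S. key b' < key b}" if "b \<in> S" for b
      using less[OF that] by auto
    have inS: "w \<in> span (e ` S)" if b: "b \<in> S" and w: "w - e b \<in> span (e ` {b'\<in>S. key b' < key b})" for w b
    proof -
      have "span (e ` {b'\<in>S. key b' < key b}) \<subseteq> span (e ` S)" by (intro span_mono image_mono) auto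
      then have "w - e b \<in> span (e ` S)" using w by (rule subsetD)
      moreover have "e b \<in> span (e ` S)" using b by (intro span_base imageI)
      ultimately have "w - e b + e b \<in> span (e ` S)" by (rule span_add)
      then show ?thesis by simp
    qed
    define P where "P b \<longleftrightarrow> (\<exists>w\<in>W. w - e b \<in> span (e ` {b'\<in>insert x S. key b' < key b}))" for b
    have PS: "P b \<longleftrightarrow> (\<exists>w\<in>?W. w - e b \<in> span (e ` {b'\<in>S. key b' < key b}))" if "b \<in> S" for b
      unfolding P_def low'[OF that] using inS[OF that] by blast
    have Px: "P x \<longleftrightarrow> (\<exists>w\<in>W. w - e x \<in> span (e ` S))"
      unfolding P_def low by (rule refl)
    have "{b\<in>insert x S. P b} = {b\<in>S. P b} \<union> {b. b = x \<and> P x}" by blast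
    also have "{b\<in>S. P b} = ?L S ?W" using PS by (rule Collect_cong[OF conj_cong[OF refl]])
    finally have L: "?L (insert x S) W = ?L S ?W \<union> {b. b = x \<and> (\<exists>w\<in>W. w - e x \<in> span (e ` S))}"
      unfolding P_def[symmetric] Px[symmetric] by simp
    have ex: "e x \<notin> span (e ` S)"
      using insert(5,6) False by (auto simp: independent_insert inj_on_def split: if_splits)
    have dec: "\<exists>k. v - scale k (e x) \<in> span (e ` S)" if "v \<in> W" for v
      using that insert(8) span_breakdown_eq[of v "e x" "e ` S"] by auto
    show ?thesis
    proof (cases "\<exists>w\<in>W. w - e x \<in> span (e ` S)")
      case True
      then obtain w where w: "w \<in> W" "w - e x \<in> span (e ` S)" by blast
      have "W = span (insert w ?W)"
      proof
        show "span (insert w ?W) \<subseteq> W" using w(1) insert(7) by (intro span_minimal) auto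
        show "W \<subseteq> span (insert w ?W)"
        proof
          fix v assume v: "v \<in> W"
          then obtain k where k: "v - scale k (e x) \<in> span (e ` S)" using dec by blast
          have "(v - scale k (e x)) - scale k (w - e x) \<in> span (e ` S)"
            by (rule span_diff[OF k span_scale[OF w(2)]])
          then have "v - scale k w \<in> span (e ` S)" by (simp add: algebra_simps)
          moreover have "v - scale k w \<in> W"
            using v w insert(7) by (intro subspace_diff subspace_scale)
          ultimately have "v - scale k w \<in> ?W" by blast
          then show "v \<in> span (insert w ?W)"
            using span_breakdown_eq[of v w ?W] span_base by blast
        qed
      qed
      moreover have "w \<notin> ?W"
        using ex w(2) span_diff[of w "e ` S" "w - e x"] by auto
      ultimately have "dim W = Suc (dim ?W)"
        using dim_insert_notin[OF W'] by metis
      moreover have "card (?L (insert x S) W) = Suc (card (?L S ?W))"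
        unfolding L using True False \<open>finite S\<close> by (subst card_Un_disjoint) auto
      ultimately show ?thesis using IH by simp
    next
      case no: False
      have "v \<in> span (e ` S)" if v: "v \<in> W" for v
      proof -
        obtain k where k: "v - scale k (e x) \<in> span (e ` S)" using dec[OF v] by blast
        have "k = 0"
        proof (rule ccontr)
          assume "k \<noteq> 0"
          then have "scale (1 / k) v - e x = scale (1 / k) (v - scale k (e x))"
            by (simp add: scale_right_diff_distrib)
          then show False
            using no k v insert(7) by (metis span_scale subspace_scale)
        qed
        then show ?thesis using k by simp
      qed
      then have "?W = W" by blast
      then show ?thesis using L IH no by auto
    qed
  qed
qed

text \<open>\<open>C\<close> represents a basis of the quotient of \<open>V\<close> by
  \<open>W\<close>. Independence modulo \<open>W\<close> is expressed by coefficients, so that no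
  quotient space has to be formed.\<close>

lemma complement_exists:
  assumes "subspace W" "W \<subseteq> V" "V \<subseteq> span F" "finite F"
  obtains C where "C \<subseteq> V" "finite C" "card C = dim V - dim W" "V \<subseteq> span (W \<union> C)"
    "\<And>c x. (\<Sum>x\<in>C. scale (c x) x) \<in> W \<Longrightarrow> x \<in> C \<Longrightarrow> c x = 0"
proof -
  obtain A where A: "A \<subseteq> W" "independent A" "W \<subseteq> span A" "finite A" "card A = dim W"
    using finite_basis[of W F] assms by (metis subset_trans)
  have AW: "span A = W" using A assms(1) by (metis span_subspace)
  obtain B where B: "A \<subseteq> B" "B \<subseteq> V" "independent B" "V \<subseteq> span B"
    using maximal_independent_subset_extend[OF _ A(2)] A(1) assms(2) by (metis subset_trans)
  have fB: "finite B" "card B = dim V"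
    using card_independent_le_dim[OF assms(3,4) B(2,3)] basis_card_eq_dim[OF B(2,4,3)] by auto
  show ?thesis
  proof (rule that[of "B - A"])
    show "card (B - A) = dim V - dim W" using B(1) fB A by (simp add: card_Diff_subset)
    have "B \<subseteq> W \<union> (B - A)" using A(1) by blast
    then show "V \<subseteq> span (W \<union> (B - A))" using B(4) span_mono by blast
    fix c x assume c: "(\<Sum>x\<in>B - A. scale (c x) x) \<in> W" "x \<in> B - A"
    then obtain d where d: "(\<Sum>x\<in>B - A. scale (c x) x) = (\<Sum>a\<in>A. scale (d a) a)"
      unfolding AW[symmetric] span_finite[OF A(4)] by auto
    define f where "f = (\<lambda>x. if x \<in> A then - d x else c x)"
    have "(\<Sum>x\<in>B. scale (f x) x) = (\<Sum>x\<in>B - A. scale (f x) x) + (\<Sum>a\<in>A. scale (f a) a)"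
      using B(1) fB(1) by (rule sum.subset_diff)
    also have "\<dots> = (\<Sum>x\<in>B - A. scale (c x) x) + (\<Sum>a\<in>A. - (scale (d a) a))"
      by (intro arg_cong2[where f = "(+)"] sum.cong) (auto simp: f_def)
    finally have "(\<Sum>x\<in>B. scale (f x) x) = 0" using d by (simp add: sum_negf)
    then have "f x = 0" using independentD[OF B(3) fB(1) subset_refl] c(2) by blast
    then show "c x = 0" using c(2) by (simp add: f_def)
  qed (use B fB in auto)
qed

lemma dim_diff_le_card:
  assumes "W \<subseteq> span F" "finite F" "finite S" "V \<subseteq> span (W \<union> S)"
  shows "dim V - dim W \<le> card S"
proof -
  obtain A where A: "W \<subseteq> span A" "finite A" "card A = dim W"
    using finite_basis[OF assms(1,2)] by metis
  have "span (W \<union> S) \<subseteq> span (A \<union> S)"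
    by (rule span_minimal) (use A(1) span_mono[of A "A \<union> S"] span_superset[of "A \<union> S"] in auto)
  then have "dim V \<le> card (A \<union> S)" using assms(3,4) A(2) by (intro dim_le_card) auto
  also have "\<dots> \<le> dim W + card S" using A(3) card_Un_le by metis
  finally show ?thesis by simp
qed

text \<open>Independence is assumed for an indexed family; two equal members would admit a relation
  with coefficients 1 and -1.\<close>

lemma inj_on_if_scalars_zero:
  assumes "subspace W" "finite K"
    and indep: "\<And>c k. (\<Sum>k\<in>K. scale (c k) (e k)) \<in> W \<Longrightarrow> k \<in> K \<Longrightarrow> c k = 0"
  shows "inj_on e K"
proof (rule inj_onI, rule ccontr)
  fix k l assume kl: "k \<in> K" "l \<in> K" "e k = e l" "k \<noteq> l"
  have "(\<Sum>i\<in>K. scale ((if i = k then 1 else 0) - (if i = l then 1 else 0)) (e i)) = e k - e l"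
    using kl assms(2) by (simp add: scale_left_diff_distrib sum_subtractf if_distrib[of "\<lambda>c. scale c _"] cong: if_cong)
  then have "(if k = k then 1 else 0) - (if k = l then 1 else 0 :: 'a) = 0"
    using kl assms(1) by (intro indep[of "\<lambda>i. (if i = k then 1 else 0) - (if i = l then 1 else 0)"])
      (simp_all add: subspace_0)
  then show False using kl by simp
qed

lemma independent_image_if_scalars_zero:
  assumes "finite K" and indep: "\<And>c k. (\<Sum>k\<in>K. scale (c k) (e k)) = 0 \<Longrightarrow> k \<in> K \<Longrightarrow> c k = 0"
  shows "inj_on e K" "independent (e ` K)"
proof -
  show inj: "inj_on e K"
    by (rule inj_on_if_scalars_zero[of "{0}"]) (use assms in auto)
  show "independent (e ` K)"
  proof (rule independent_if_scalars_zero)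
    fix f x assume "(\<Sum>x\<in>e ` K. scale (f x) x) = 0" "x \<in> e ` K"
    then show "f x = 0" using indep[of "\<lambda>k. f (e k)"] by (auto simp: sum.reindex[OF inj])
  qed (use assms in simp)
qed

lemma card_le_dim_diff:
  assumes "subspace W" "W \<subseteq> V" "V \<subseteq> span F" "finite F" "finite K" "e ` K \<subseteq> V"
    and indep: "\<And>c k. (\<Sum>k\<in>K. scale (c k) (e k)) \<in> W \<Longrightarrow> k \<in> K \<Longrightarrow> c k = 0"
  shows "card K \<le> dim V - dim W"
proof -
  obtain A where A: "A \<subseteq> W" "independent A" "W \<subseteq> span A" "finite A" "card A = dim W"
    using finite_basis[of W F] assms by (metis subset_trans)
  have inj: "inj_on e K"
    using assms(1,5) indep by (rule inj_on_if_scalars_zero)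
  have notW: "e k \<notin> W" if "k \<in> K" for k
  proof
    assume "e k \<in> W"
    moreover have "(\<Sum>i\<in>K. scale (if i = k then 1 else 0) (e i)) = e k"
      using that assms(5) by (simp add: if_distrib[of "\<lambda>c. scale c _"] cong: if_cong)
    ultimately have "(if k = k then 1 else 0 :: 'a) = 0"
      using that by (intro indep[of "\<lambda>i. if i = k then 1 else 0"]) simp_all
    then show False by simp
  qed
  have "independent (A \<union> e ` K)"
  proof (rule independent_if_scalars_zero)
    show "finite (A \<union> e ` K)" using A assms by simp
    fix f x assume f: "(\<Sum>x\<in>A \<union> e ` K. scale (f x) x) = 0" and x: "x \<in> A \<union> e ` K"
    have dis: "A \<inter> e ` K = {}" using notW A(1) by blast
    have eq: "(\<Sum>x\<in>A. scale (f x) x) + (\<Sum>k\<in>K. scale (f (e k)) (e k)) = 0"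
      using f A(4) assms(5) dis by (simp add: sum.union_disjoint sum.reindex[OF inj])
    have "(\<Sum>x\<in>A. scale (f x) x) \<in> W"
      using A(1) assms(1) by (auto intro!: subspace_sum subspace_scale)
    then have "- (\<Sum>x\<in>A. scale (f x) x) \<in> W" using assms(1) by (rule subspace_neg[rotated])
    moreover have "- (\<Sum>x\<in>A. scale (f x) x) = (\<Sum>k\<in>K. scale (f (e k)) (e k))"
      using eq by (simp add: neg_eq_iff_add_eq_0)
    ultimately have K0: "f (e k) = 0" if "k \<in> K" for k
      using indep[of "\<lambda>k. f (e k)"] that by simp
    then have "(\<Sum>x\<in>A. scale (f x) x) = 0" using eq by simp
    then have "f a = 0" if "a \<in> A" for a
      using independentD[OF A(2,4) subset_refl] that by blast
    then show "f x = 0" using x K0 by auto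
  qed
  then have "card (A \<union> e ` K) \<le> dim V"
    using card_independent_le_dim[OF assms(3,4), of "A \<union> e ` K"] A(1) assms(2,6) by blast
  moreover have "card (A \<union> e ` K) = dim W + card K"
    using A notW assms(5) by (subst card_Un_disjoint) (auto simp: card_image[OF inj])
  ultimately show ?thesis by simp
qed

lemma finite_support_span:
  assumes "x \<in> span T"
  shows "\<exists>S. finite S \<and> S \<subseteq> T \<and> x \<in> span S"
proof -
  obtain S r where S: "finite S" "S \<subseteq> T" "x = (\<Sum>a\<in>S. scale (r a) a)"
    using assms unfolding span_explicit by blast
  have "x \<in> span S" unfolding S(3) by (intro span_sum span_scale span_base)
  with S show ?thesis by blast
qed

text \<open>Writing an element of \<open>V\<close> modulo \<open>J\<close> by \<open>S\<close> may
  use elements of \<open>J\<close> outside \<open>V\<close>, and \<open>J\<close> may have infinite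
  dimension. Only finitely many such elements, collected in \<open>U\<close>, occur for a complement
  \<open>C\<close>, so the count takes place in the span of \<open>U\<close> and \<open>S\<close>.
  There \<open>C\<close> stays independent modulo \<open>J\<close>, since its combinations lie in
  \<open>V\<close>.\<close>

lemma dim_diff_inter_le_card:
  assumes J: "subspace J" and V: "subspace V" "V \<subseteq> span F" "finite F"
    and S: "finite S" "V \<subseteq> span (J \<union> S)"
  shows "dim V - dim (V \<inter> J) \<le> card S"
proof -
  have VJ: "subspace (V \<inter> J)" using V J by (intro subspace_inter)
  obtain C where C: "C \<subseteq> V" "finite C" "card C = dim V - dim (V \<inter> J)"
    and indep: "\<And>c x. (\<Sum>x\<in>C. scale (c x) x) \<in> V \<inter> J \<Longrightarrow> x \<in> C \<Longrightarrow> c x = 0"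
    using complement_exists[OF VJ _ V(2,3)] by (metis inf_le1)
  have "\<forall>x\<in>C. \<exists>T. finite T \<and> T \<subseteq> J \<union> S \<and> x \<in> span T"
    using C(1) S(2) finite_support_span by (meson subsetD)
  then obtain T where T: "\<And>x. x \<in> C \<Longrightarrow> finite (T x) \<and> T x \<subseteq> J \<union> S \<and> x \<in> span (T x)" by metis
  define U where "U = (\<Union>x\<in>C. T x \<inter> J)"
  have U: "finite U" "U \<subseteq> J" unfolding U_def using T C(2) by auto
  let ?X = "span (U \<union> S)"
  have CX: "C \<subseteq> ?X"
  proof
    fix x assume x: "x \<in> C"
    then have "T x \<subseteq> U \<union> S" using T unfolding U_def by blast
    then show "x \<in> ?X" using T[OF x] span_mono by blast
  qed
  have comb: "(\<Sum>x\<in>C. scale (c x) x) \<in> V" for c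
    using C(1) V(1) by (auto intro!: subspace_sum subspace_scale)
  have "card C \<le> dim ?X - dim (?X \<inter> J)"
  proof (rule card_le_dim_diff[where e = id and F = "U \<union> S"])
    show "subspace (?X \<inter> J)" using J by (intro subspace_inter subspace_span)
    show "c k = 0" if "(\<Sum>k\<in>C. scale (c k) (id k)) \<in> ?X \<inter> J" "k \<in> C" for c k
      using indep[of c k] that comb[of c] by simp
  qed (use U S C CX in auto)
  also have "\<dots> \<le> card S"
  proof (rule dim_diff_le_card[where F = "U \<union> S"])
    have "U \<union> S \<subseteq> (?X \<inter> J) \<union> S" using U(2) by (auto intro: span_base)
    then show "?X \<subseteq> span (?X \<inter> J \<union> S)" by (rule span_mono)
  qed (use U S in auto)
  finally show ?thesis using C(3) by simp
qed

end

section \<open>Monomials in the Weyl algebra\<close>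

text \<open>Monomials in a possibly noncommutative monoid. The fold is the expected product only
  when the factors commute, which is what \<open>commuting\<close> provides.\<close>

definition mprod :: "('a \<Rightarrow> 'r::monoid_mult) \<Rightarrow> 'a multiset \<Rightarrow> 'r" where
  "mprod z = fold_mset (\<lambda>i P. z i * P) 1"

definition commuting :: "('a \<Rightarrow> 'r::monoid_mult) \<Rightarrow> bool" where
  "commuting z \<longleftrightarrow> (\<forall>i j. z i * z j = z j * z i)"

lemma mprod_empty [simp]: "mprod z {#} = 1"
  by (simp add: mprod_def)

lemma mprod_add:
  assumes "commuting z"
  shows "mprod z (add_mset i M) = z i * mprod z M"
proof -
  interpret comp_fun_commute "\<lambda>i P. z i * P"
    using assms by unfold_locales (simp add: fun_eq_iff commuting_def mult.assoc[symmetric])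
  show ?thesis by (simp add: mprod_def)
qed

lemma mprod_commute:
  assumes "commuting z" "\<And>i. i \<in># M \<Longrightarrow> y * z i = z i * y"
  shows "y * mprod z M = mprod z M * y"
  using assms(2)
proof (induction M)
  case (add i M)
  have "y * mprod z (add_mset i M) = y * z i * mprod z M"
    by (simp add: mprod_add[OF assms(1)] mult.assoc)
  also have "\<dots> = z i * (y * mprod z M)" using add.prems by (simp add: mult.assoc)
  also have "\<dots> = z i * mprod z M * y" using add by (simp add: mult.assoc)
  finally show ?case by (simp add: mprod_add[OF assms(1)])
qed simp

lemma commuting_weyl_var: "commuting weyl_var"
  and commuting_weyl_der: "commuting weyl_der"
  by (simp_all add: commuting_def weyl_relations)

lemma weyl_const_of_nat: "weyl_const (of_nat n) = of_nat n"
  by (induction n) (simp_all add: weyl_const_simps)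

lemma weyl_const_eq_0_iff [simp]: "weyl_const c = 0 \<longleftrightarrow> c = 0"
proof
  assume "weyl_const c = (0 :: 'a weyl)"
  then have "weyl_const (inverse c * c) = (0 :: 'a weyl)" by (simp add: weyl_const_simps)
  then show "c = 0" by (cases "c = 0") (auto simp: weyl_const_simps)
qed (simp add: weyl_const_simps)

lemma weyl_scale_mult_left: "weyl_scale c P * Q = weyl_scale c (P * Q)"
  by (simp add: weyl_scale_def mult.assoc)

lemma weyl_scale_mult_right: "P * weyl_scale c Q = weyl_scale c (P * Q)"
  by (metis weyl_scale_def mult.assoc weyl_const_central)

lemma mult_of_nat_left_commute: "x * (of_nat n * y) = of_nat n * (x * y)" for x y :: "'r::ring_1"
  by (metis mult_of_nat_commute mult.assoc)

text \<open>The Leibniz rule for a monomial, in a form that depends only on the commutators with its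
  factors. It thus applies to derivatives moving past variables and, up to sign, to variables moving
  past derivatives.\<close>

lemma der_mprod_commutator:
  fixes z :: "'a \<Rightarrow> 'r::ring_1"
  assumes z: "commuting z" and ad: "\<And>j. D * z j = z j * D + (if j = i then 1 else 0)"
  shows "D * mprod z M = mprod z M * D + of_nat (count M i) * mprod z (M - {#i#})"
proof (induction M)
  case (add j M)
  have "D * mprod z (add_mset j M) = (D * z j) * mprod z M"
    by (simp add: mprod_add[OF z] mult.assoc)
  also have "\<dots> = z j * (D * mprod z M) + (if j = i then mprod z M else 0)"
    by (simp add: ad algebra_simps)
  also have "\<dots> = mprod z (add_mset j M) * D + (of_nat (count M i) * (z j * mprod z (M - {#i#}))
      + (if j = i then mprod z M else 0))"
    unfolding add.IH by (simp add: mprod_add[OF z] distrib_left mult.assoc mult_of_nat_left_commute)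
  also have "of_nat (count M i) * (z j * mprod z (M - {#i#})) + (if j = i then mprod z M else 0)
      = of_nat (count (add_mset j M) i) * mprod z (add_mset j M - {#i#})"
  proof (cases "i \<in># M")
    case True
    then have "z j * mprod z (M - {#i#}) = mprod z (add_mset j M - {#i#})"
      by (simp add: mprod_add[OF z, symmetric] diff_union_swap2)
    then show ?thesis by (auto simp: algebra_simps)
  next
    case False
    then show ?thesis by (auto simp: not_in_iff)
  qed
  finally show ?case .
qed simp

definition gen :: "'v + 'v \<Rightarrow> 'v::finite weyl" where
  "gen = case_sum weyl_var weyl_der"

text \<open>Sending the other kind of generator to 1 lets one multiset, with \<open>Inl\<close> for
  variables and \<open>Inr\<close> for derivatives, index a normally ordered monomial without being
  split.\<close>

definition xpart :: "('v + 'v) multiset \<Rightarrow> 'v::finite weyl" where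
  "xpart = mprod (case_sum weyl_var (\<lambda>_. 1))"

definition dpart :: "('v + 'v) multiset \<Rightarrow> 'v::finite weyl" where
  "dpart = mprod (case_sum (\<lambda>_. 1) weyl_der)"

definition wmon :: "('v + 'v) multiset \<Rightarrow> 'v::finite weyl" where
  "wmon M = xpart M * dpart M"

lemma commuting_parts:
  "commuting (case_sum weyl_var (\<lambda>_. 1))" "commuting (case_sum (\<lambda>_. 1) weyl_der)"
  using commuting_weyl_var commuting_weyl_der by (auto simp: commuting_def split: sum.splits)

lemma parts_add [simp]:
  "xpart (add_mset (Inl i) M) = weyl_var i * xpart M" "xpart (add_mset (Inr i) M) = xpart M"
  "dpart (add_mset (Inr i) M) = weyl_der i * dpart M" "dpart (add_mset (Inl i) M) = dpart M"
  by (simp_all add: xpart_def dpart_def mprod_add[OF commuting_parts(1)] mprod_add[OF commuting_parts(2)])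

lemma parts_empty [simp]: "xpart {#} = 1" "dpart {#} = 1"
  by (simp_all add: xpart_def dpart_def)

lemma parts_remove: "xpart (M - {#Inr i#}) = xpart M" "dpart (M - {#Inl i#}) = dpart M"
  by (cases "Inr i \<in># M", metis insert_DiffM parts_add(2), simp add: diff_single_trivial)
    (cases "Inl i \<in># M", metis insert_DiffM parts_add(4), simp add: diff_single_trivial)

lemma der_xpart:
  "weyl_der i * xpart M = xpart M * weyl_der i + of_nat (count M (Inl i)) * xpart (M - {#Inl i#})"
  unfolding xpart_def
  by (rule der_mprod_commutator[OF commuting_parts(1)]) (auto simp: weyl_relations split: sum.splits)

lemma dpart_var:
  "dpart M * weyl_var i = weyl_var i * dpart M + of_nat (count M (Inr i)) * dpart (M - {#Inr i#})"
proof -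
  \<comment> \<open>The Weyl relations are invariant under exchanging variables and derivatives with
    a sign, so \<open>- weyl_var i\<close> acts on the derivatives like a derivation.\<close>
  have "- weyl_var i * dpart M = dpart M * - weyl_var i + of_nat (count M (Inr i)) * dpart (M - {#Inr i#})"
    unfolding dpart_def
    by (rule der_mprod_commutator[OF commuting_parts(2)]) (auto simp: weyl_relations split: sum.splits)
  then show ?thesis by (simp add: algebra_simps)
qed

lemma var_wmon: "weyl_var i * wmon M = wmon (add_mset (Inl i) M)"
  by (simp add: wmon_def mult.assoc)

lemma der_wmon:
  "weyl_der i * wmon M = wmon (add_mset (Inr i) M) + of_nat (count M (Inl i)) * wmon (M - {#Inl i#})"
proof -
  have "weyl_der i * wmon M = (weyl_der i * xpart M) * dpart M" by (simp add: wmon_def mult.assoc)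
  then show ?thesis by (simp add: der_xpart wmon_def distrib_right mult.assoc parts_remove)
qed

lemma wmon_der: "wmon M * weyl_der i = wmon (add_mset (Inr i) M)"
proof -
  have "dpart M * weyl_der i = weyl_der i * dpart M"
    unfolding dpart_def
    by (rule mprod_commute[OF commuting_parts(2), symmetric]) (auto simp: weyl_relations split: sum.splits)
  then show ?thesis by (simp add: wmon_def mult.assoc)
qed

lemma wmon_var:
  "wmon M * weyl_var i = wmon (add_mset (Inl i) M) + of_nat (count M (Inr i)) * wmon (M - {#Inr i#})"
proof -
  have x: "xpart M * weyl_var i = weyl_var i * xpart M"
    unfolding xpart_def
    by (rule mprod_commute[OF commuting_parts(1), symmetric]) (auto simp: weyl_relations split: sum.splits)
  have "wmon M * weyl_var i = xpart M * (dpart M * weyl_var i)" by (simp add: wmon_def mult.assoc)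
  also have "\<dots> = (xpart M * weyl_var i) * dpart M + of_nat (count M (Inr i)) * (xpart M * dpart (M - {#Inr i#}))"
    unfolding dpart_var by (simp add: distrib_left mult.assoc mult_of_nat_left_commute)
  finally show ?thesis by (simp add: x wmon_def parts_remove mult.assoc)
qed

text \<open>On normally ordered monomials this commutator is the formal partial derivative by the
  generator \<open>z\<close>.\<close>

definition lower :: "'v + 'v \<Rightarrow> 'v::finite weyl \<Rightarrow> 'v weyl" where
  "lower z P = (case z of Inl i \<Rightarrow> weyl_der i * P - P * weyl_der i | Inr i \<Rightarrow> P * weyl_var i - weyl_var i * P)"

lemma lower_wmon: "lower z (wmon M) = of_nat (count M z) * wmon (M - {#z#})"
  by (cases z) (simp_all add: lower_def der_wmon wmon_der var_wmon wmon_var)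

lemma lower_scale: "lower z (weyl_scale c P) = weyl_scale c (lower z P)"
  by (simp add: lower_def weyl_scale_mult_left weyl_scale_mult_right weyl.scale_right_diff_distrib split: sum.splits)

lemma lower_add: "lower z (P + Q) = lower z P + lower z Q"
  by (simp add: lower_def algebra_simps split: sum.splits)

lemma lower_0: "lower z 0 = 0"
  by (simp add: lower_def split: sum.splits)

lemma lower_sum: "lower z (sum h A) = (\<Sum>a\<in>A. lower z (h a))"
  by (induction A rule: infinite_finite_induct) (simp_all add: lower_0 lower_add)

text \<open>Applying \<open>lower z\<close> to a relation gives one of smaller degree, whose
  coefficients are those of the monomials containing \<open>z\<close> times positive integers. By
  induction these vanish for every \<open>z\<close>, which leaves only the constant term.\<close>

lemma wmon_scalars_zero:
  assumes "finite B" "(\<Sum>M\<in>B. weyl_scale (c M) (wmon M)) = 0" "M \<in> B"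
  shows "c M = 0"
proof -
  have "\<forall>M\<in>B. c M = 0" if "finite B" "\<forall>M\<in>B. size M \<le> k" "(\<Sum>M\<in>B. weyl_scale (c M) (wmon M)) = 0"
    for B :: "('a + 'a) multiset set" and c k
    using that
  proof (induction k arbitrary: B c)
    case 0
    then have "B \<subseteq> {{#}}" by auto
    then consider "B = {}" | "B = {{#}}" by blast
    then show ?case using 0(3) by cases (simp_all add: wmon_def weyl_scale_def)
  next
    case (Suc k)
    have pos: "c M = 0" if M: "M \<in> B" "z \<in># M" for M z
    proof -
      let ?B = "{M\<in>B. z \<in># M}" and ?r = "\<lambda>M. M - {#z#}"
      \<comment> \<open>The factor is the multiplicity of \<open>z\<close> before lowering,
        expressed through the lowered monomial so that the sum can be reindexed.\<close>
      let ?c = "\<lambda>N. c (add_mset z N) * of_nat (Suc (count N z))"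
      have inj: "inj_on ?r ?B" by (auto simp: inj_on_def) (metis insert_DiffM)
      have "0 = lower z (\<Sum>M\<in>B. weyl_scale (c M) (wmon M))" using Suc.prems(3) by (simp add: lower_0)
      also have "\<dots> = (\<Sum>M\<in>B. weyl_scale (c M * of_nat (count M z)) (wmon (M - {#z#})))"
        by (simp add: lower_sum lower_scale lower_wmon weyl_const_of_nat[symmetric] flip: weyl_scale_def)
      also have "\<dots> = (\<Sum>M\<in>?B. weyl_scale (c M * of_nat (count M z)) (wmon (M - {#z#})))"
        using Suc.prems(1) by (intro sum.mono_neutral_right) (auto simp: not_in_iff)
      also have "\<dots> = (\<Sum>M\<in>?B. weyl_scale (?c (?r M)) (wmon (?r M)))"
        by (intro sum.cong refl) (auto simp del: of_nat_Suc)
      also have "\<dots> = (\<Sum>N\<in>?r ` ?B. weyl_scale (?c N) (wmon N))"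
        by (simp add: sum.reindex[OF inj])
      finally have "\<forall>N\<in>?r ` ?B. ?c N = 0"
        using Suc.prems(1,2) by (intro Suc.IH) (auto simp: size_Diff_singleton)
      then have "?c (?r M) = 0" using M by blast
      then show ?thesis using M(2) by (simp add: count_eq_zero_iff del: of_nat_Suc)
    qed
    show ?case
    proof
      fix M assume M: "M \<in> B"
      show "c M = 0"
      proof (cases "M = {#}")
        case True
        have "(\<Sum>N\<in>B. weyl_scale (c N) (wmon N)) = (\<Sum>N\<in>{M}. weyl_scale (c N) (wmon N))"
        proof (rule sum.mono_neutral_right)
          show "\<forall>N\<in>B - {M}. weyl_scale (c N) (wmon N) = 0"
            using pos True by (metis Diff_iff insertI1 multiset_nonemptyE weyl.scale_zero_left)
        qed (use M Suc.prems in auto)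
        then show ?thesis using Suc.prems(3) True by (simp add: wmon_def weyl_scale_def)
      next
        case False
        then show ?thesis using pos[OF M] by (meson multiset_nonemptyE)
      qed
    qed
  qed
  from this[OF assms(1) _ assms(2), of "Max (size ` B)"] show ?thesis
    using assms(1,3) by auto
qed

lemma wmon_independent:
  assumes "finite B"
  shows "inj_on wmon B" "weyl.independent (wmon ` B)"
  by (rule weyl.independent_image_if_scalars_zero[OF assms]; use wmon_scalars_zero[OF assms] in blast)+

lemma wmon_lists:
  "wmon (mset (map Inl is) + mset (map Inr js)) = prod_list (map weyl_var is) * prod_list (map weyl_der js)"
proof -
  have "xpart (mset (map Inl is) + mset (map Inr js)) = prod_list (map weyl_var is)"
    by (induction "is") (simp, induction js, simp_all)
  moreover have "dpart (mset (map Inl is) + mset (map Inr js)) = prod_list (map weyl_der js)"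
    by (induction js) (simp, induction "is", simp_all)
  ultimately show ?thesis by (simp add: wmon_def)
qed

lemma mset_sum_lists: "\<exists>is js. M = mset (map Inl is) + mset (map Inr js)"
proof (induction M)
  case (add z M)
  then obtain "is" js where "M = mset (map Inl is) + mset (map Inr js)" by blast
  moreover have "add_mset (Inl i) (mset (map Inl is) + mset (map Inr js)) =
      mset (map Inl (i # is)) + mset (map Inr js)" for i
    by simp
  moreover have "add_mset (Inr j) (mset (map Inl is) + mset (map Inr js)) =
      mset (map Inl is) + mset (map Inr (j # js))" for j
    by simp
  ultimately show ?case by (cases z) blast+
qed (intro exI[of _ "[]"], simp)

abbreviation mons :: "nat \<Rightarrow> ('v + 'v) multiset set" where
  "mons k \<equiv> {M. size M \<le> k}"

lemma finite_mons: "finite (mons k :: ('v::finite + 'v) multiset set)"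
  using finite_multisets_le[of "UNIV :: ('v + 'v) set" k] by simp

lemma bernstein_eq: "bernstein k = weyl.span (wmon ` mons k :: 'v::finite weyl set)"
proof -
  have "{prod_list (map weyl_var is) * prod_list (map weyl_der js) | is js. length is + length js \<le> k}
    = (wmon ` mons k :: 'v weyl set)" (is "?A = ?B")
  proof
    show "?A \<subseteq> ?B"
    proof
      fix P assume "P \<in> ?A"
      then obtain "is" js where "length is + length js \<le> k"
        "P = wmon (mset (map Inl is) + mset (map Inr js))" unfolding wmon_lists by blast
      then show "P \<in> ?B" by (intro image_eqI) auto
    qed
    show "?B \<subseteq> ?A"
    proof
      fix P assume "P \<in> ?B"
      then obtain M where M: "size M \<le> k" "P = wmon M" by blast
      obtain "is" js where "M = mset (map Inl is) + mset (map Inr js)" using mset_sum_lists by blast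
      then have "length is + length js \<le> k"
        "P = prod_list (map weyl_var is) * prod_list (map weyl_der js)"
        using M wmon_lists[of "is" js] by simp_all
      then show "P \<in> ?A" by blast
    qed
  qed
  then show ?thesis by (simp only: bernstein_def)
qed

lemma bernstein_mono: "k \<le> l \<Longrightarrow> bernstein k \<subseteq> bernstein l"
  unfolding bernstein_eq by (intro weyl.span_mono image_mono) auto

lemma subspace_bernstein: "weyl.subspace (bernstein k)"
  unfolding bernstein_eq by (rule weyl.subspace_span)

text \<open>A filtration in which each left multiplication by a generator costs at most
  \<open>a\<close> steps absorbs the Bernstein filtration at \<open>a\<close> times its speed. Both
  the normal forms and the preimages under \<open>phi\<close> have cost 2.\<close>

lemma bernstein_induct:
  fixes V :: "nat \<Rightarrow> 'v::finite weyl set"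
  assumes sub: "\<And>m. weyl.subspace (V m)" and mono: "\<And>m. V m \<subseteq> V (Suc m)" and one: "1 \<in> V 0"
    and step: "\<And>z m P. P \<in> V m \<Longrightarrow> gen z * P \<in> V (m + a)"
  shows "bernstein k \<subseteq> V (a * k)"
proof -
  have word: "prod_list (map gen zs) \<in> V (a * length zs)" for zs
  proof (induction zs)
    case (Cons z zs)
    then show ?case using step[OF Cons, of z] by (simp add: add.commute)
  qed (simp add: one)
  have up: "V m \<subseteq> V n" if "m \<le> n" for m n
    using that mono by (rule lift_Suc_mono_le[rotated])
  show ?thesis
    unfolding bernstein_def
  proof (rule weyl.span_minimal[OF _ sub], clarify)
    fix "is" js :: "'v list" assume "length is + length js \<le> k"
    then have "V (a * length (map Inl is @ map Inr js)) \<subseteq> V (a * k)" by (intro up) simp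
    then show "prod_list (map weyl_var is) * prod_list (map weyl_der js) \<in> V (a * k)"
      using word[of "map Inl is @ map Inr js"] by (auto simp: gen_def comp_def)
  qed
qed

text \<open>Restoring the normal order costs a single correction term. Its degree is smaller than
  that of \<open>add_mset z M\<close>, so it affects neither filtration steps nor leading monomials.
  For a variable there is no correction and \<open>c\<close> is 0.\<close>

lemma gen_wmon:
  "\<exists>c N. size N \<le> size M \<and> gen z * wmon M = wmon (add_mset z M) + weyl_scale c (wmon N)"
proof (cases z)
  case (Inl i)
  then show ?thesis by (intro exI[of _ 0] exI[of _ M]) (simp add: gen_def var_wmon)
next
  case (Inr i)
  then show ?thesis
    by (intro exI[of _ "of_nat (count M (Inl i))"] exI[of _ "M - {#Inl i#}"])
      (simp add: gen_def der_wmon weyl_scale_def weyl_const_of_nat size_Diff_singleton_if)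
qed

lemma gen_bernstein: "P \<in> bernstein k \<Longrightarrow> gen z * P \<in> bernstein (Suc k)"
  unfolding bernstein_eq
proof (induction rule: weyl.span_induct_alt)
  case (step c x y)
  then obtain M where M: "size M \<le> k" "x = wmon M" by auto
  obtain c' N where N: "size N \<le> size M" "gen z * wmon M = wmon (add_mset z M) + weyl_scale c' (wmon N)"
    using gen_wmon by blast
  have "gen z * (weyl_scale c x + y) = weyl_scale c (wmon (add_mset z M) + weyl_scale c' (wmon N)) + gen z * y"
    by (simp add: distrib_left weyl_scale_mult_right M N)
  also have "\<dots> \<in> weyl.span (wmon ` mons (Suc k))"
    by (rule weyl.span_add[OF weyl.span_scale[OF weyl.span_add[OF weyl.span_base
      weyl.span_scale[OF weyl.span_base]]] step(2)]) (use M N in auto)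
  finally show ?case .
qed (simp add: weyl.span_zero)

lemma one_bernstein: "1 \<in> bernstein k"
proof -
  have "wmon {#} \<in> bernstein k" unfolding bernstein_eq by (intro weyl.span_base imageI) simp
  then show ?thesis by (simp add: wmon_def)
qed

section \<open>Leading monomials and the Hilbert function\<close>

lemma subspace_left_ideal: "left_ideal J \<Longrightarrow> weyl.subspace J"
  unfolding weyl.subspace_def left_ideal_def weyl_scale_def by blast

text \<open>The generators carry no order from which a monomial order could be built. Distinct
  primes supply one: products of primes are compatible with the addition of multisets, and injective
  by unique factorization.\<close>

definition prime_code :: "'a::finite \<Rightarrow> nat" where
  "prime_code = (SOME f. inj f \<and> range f \<subseteq> {p. prime p})"

lemma prime_code: "inj (prime_code :: 'a::finite \<Rightarrow> nat)" "prime (prime_code (z :: 'a))"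
proof -
  obtain f :: "'a \<Rightarrow> nat" where "inj f" "range f \<subseteq> {p. prime p}"
    using infinite_arbitrarily_large[OF primes_infinite, of "CARD('a)"]
      finite_same_card_bij[of "UNIV :: 'a set"] unfolding bij_betw_def by (metis finite)
  then have "\<exists>f :: 'a \<Rightarrow> nat. inj f \<and> range f \<subseteq> {p. prime p}" by blast
  from someI_ex[OF this] show "inj (prime_code :: 'a \<Rightarrow> nat)" "prime (prime_code z)"
    by (fold prime_code_def) (auto simp: image_subset_iff)
qed

definition prime_prod :: "'a::finite multiset \<Rightarrow> nat" where
  "prime_prod M = prod_mset (image_mset prime_code M)"

lemma prime_prod_pos: "prime_prod M > 0"
  unfolding prime_prod_def using prime_code(2) prime_gt_0_nat
  by (metis (no_types, lifting) gr0I image_mset_is_empty_iff prod_mset_zero_iff imageE set_image_mset less_irrefl)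

lemma inj_prime_prod: "inj prime_prod"
proof
  fix M N :: "'a multiset" assume "prime_prod M = prime_prod N"
  then have "prime_factorization (prod_mset (image_mset prime_code M)) =
      prime_factorization (prod_mset (image_mset prime_code N))" by (simp add: prime_prod_def)
  then have "image_mset prime_code M = image_mset (prime_code :: 'a \<Rightarrow> nat) N"
    by (subst (asm) (1 2) prime_factorization_prod_mset_primes) (auto simp: prime_code)
  then show "M = N" using prime_code(1) by (metis multiset.inj_map injD)
qed

text \<open>Since \<open>prime_prod M \<ge> 1\<close>, this real number encodes the degree-first order whose ties
  are broken by \<open>prime_prod\<close>; both are compatible with adding multisets.\<close>

definition mon_key :: "'a::finite multiset \<Rightarrow> real" where
  "mon_key M = real (size M) - 1 / real (prime_prod M)"

text \<open>The key of \<open>M\<close> lies between \<open>size M - 1\<close>, included, and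
  \<open>size M\<close>, excluded, so keys of different degrees cannot interleave.\<close>

lemma mon_key_less_iff:
  fixes M N :: "'a::finite multiset"
  shows "mon_key N < mon_key M \<longleftrightarrow> size N < size M \<or> size N = size M \<and> prime_prod N < prime_prod M"
proof -
  have *: "mon_key N < mon_key M" if "size N < size M" for M N :: "'a multiset"
  proof -
    have "mon_key N < real (size N)" using prime_prod_pos[of N] by (simp add: mon_key_def)
    also have "\<dots> \<le> real (size M) - 1" using that by linarith
    also have "\<dots> \<le> mon_key M" using prime_prod_pos[of M] by (simp add: mon_key_def)
    finally show ?thesis .
  qed
  show ?thesis
  proof (cases "size N = size M")
    case True
    then show ?thesis using prime_prod_pos[of M] prime_prod_pos[of N]
      by (simp add: mon_key_def field_simps)
  next
    case False
    then show ?thesis using *[of N M] *[of M N] by linarith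
  qed
qed

lemma mon_key_less_imp_size_le:
  fixes M N :: "'a::finite multiset"
  shows "mon_key N < mon_key M \<Longrightarrow> size N \<le> size M"
  using mon_key_less_iff[of N M] by linarith

lemma inj_mon_key: "inj mon_key"
proof
  fix M N :: "'a multiset" assume "mon_key M = mon_key N"
  then have "\<not> mon_key M < mon_key N" "\<not> mon_key N < mon_key M" by simp_all
  then have "prime_prod M = prime_prod N" unfolding mon_key_less_iff by linarith
  then show "M = N" by (rule injD[OF inj_prime_prod])
qed

lemma mon_key_add_mset:
  fixes M N :: "'a::finite multiset"
  shows "mon_key N < mon_key M \<Longrightarrow> mon_key (add_mset z N) < mon_key (add_mset z M)"
  using prime_code(2)[of z] prime_gt_0_nat by (auto simp: mon_key_less_iff prime_prod_def)

definition below :: "('v + 'v) multiset \<Rightarrow> 'v::finite weyl set" where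
  "below M = weyl.span (wmon ` {N. mon_key N < mon_key M})"

definition leading :: "'v::finite weyl set \<Rightarrow> ('v + 'v) multiset set" where
  "leading J = {M. \<exists>P\<in>J. P - wmon M \<in> below M}"

lemma gen_below: "P \<in> below M \<Longrightarrow> gen z * P \<in> below (add_mset z M)"
  unfolding below_def
proof (induction rule: weyl.span_induct_alt)
  case (step c x y)
  then obtain K where K: "mon_key K < mon_key M" "x = wmon K" by auto
  obtain c' N where N: "size N \<le> size K" "gen z * wmon K = wmon (add_mset z K) + weyl_scale c' (wmon N)"
    using gen_wmon by blast
  have "size K \<le> size M" using K(1) by (auto simp: mon_key_less_iff)
  then have less: "mon_key (add_mset z K) < mon_key (add_mset z M)" "mon_key N < mon_key (add_mset z M)"
    using N(1) mon_key_add_mset[OF K(1)] by (auto simp: mon_key_less_iff)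
  have "gen z * (weyl_scale c x + y) = weyl_scale c (wmon (add_mset z K) + weyl_scale c' (wmon N)) + gen z * y"
    by (simp add: distrib_left weyl_scale_mult_right K N)
  also have "\<dots> \<in> weyl.span (wmon ` {N. mon_key N < mon_key (add_mset z M)})"
    by (rule weyl.span_add[OF weyl.span_scale[OF weyl.span_add[OF weyl.span_base
      weyl.span_scale[OF weyl.span_base]]] step(2)]) (use less in auto)
  finally show ?case .
qed (simp add: weyl.span_zero)

text \<open>Left multiplication by a generator stays in \<open>J\<close> and multiplies the leading
  monomial, since the commutator correction has smaller degree.\<close>

lemma upset_leading:
  assumes J: "left_ideal J"
  shows "upset (leading J)"
proof -
  have step: "add_mset z M \<in> leading J" if M: "M \<in> leading J" for z M
  proof -
    obtain P where P: "P \<in> J" "P - wmon M \<in> below M" using M by (auto simp: leading_def)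
    obtain c N where N: "size N \<le> size M" "gen z * wmon M = wmon (add_mset z M) + weyl_scale c (wmon N)"
      using gen_wmon by blast
    have "gen z * P - wmon (add_mset z M) = gen z * (P - wmon M) + weyl_scale c (wmon N)"
      by (simp add: right_diff_distrib N)
    also have "\<dots> \<in> below (add_mset z M)"
      unfolding below_def
      by (intro weyl.span_add[OF gen_below[OF P(2), unfolded below_def] weyl.span_scale[OF weyl.span_base]])
        (use N(1) in \<open>auto simp: mon_key_less_iff\<close>)
    finally show ?thesis using P(1) J by (auto simp: leading_def left_ideal_def)
  qed
  have "M + N \<in> leading J" if "M \<in> leading J" for M N
    by (induction N) (use step that in auto)
  then show ?thesis by (simp add: upset_def)
qed

lemma dim_bernstein: "weyl.dim (bernstein k :: 'v::finite weyl set) = card (mons k :: ('v + 'v) multiset set)"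
  unfolding bernstein_eq
  by (simp add: weyl.dim_eq_card_independent wmon_independent finite_mons card_image)

text \<open>As the order compares degrees first, everything below a monomial of degree at most
  \<open>k\<close> also has degree at most \<open>k\<close>. An element of \<open>J\<close> with
  such a leading monomial therefore already lies in \<open>bernstein k\<close>, and leading
  monomials may be taken in \<open>J\<close> as a whole.\<close>

lemma dim_bernstein_inter:
  fixes J :: "'v::finite weyl set"
  assumes J: "left_ideal J"
  shows "weyl.dim (bernstein k \<inter> J) = card {M \<in> mons k. M \<in> leading J}"
proof -
  have low: "{N \<in> mons k. mon_key N < mon_key M} = {N :: ('v + 'v) multiset. mon_key N < mon_key M}" if "M \<in> mons k" for M :: "('v + 'v) multiset"
    using that mon_key_less_imp_size_le[of _ M] by fastforce
  have eq: "weyl.span (wmon ` {N \<in> mons k. mon_key N < mon_key M}) = below M" if "M \<in> mons k" for M :: "('v + 'v) multiset"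
    unfolding below_def low[OF that] by (rule refl)
  have sub: "P \<in> bernstein k" if "M \<in> mons k" "P - wmon M \<in> below M" for M and P :: "'v weyl"
  proof -
    have "P - wmon M \<in> bernstein k"
      using that(2) unfolding eq[OF that(1), symmetric] bernstein_eq
      by (rule subsetD[OF weyl.span_mono, rotated]) blast
    moreover have "wmon M \<in> bernstein k" unfolding bernstein_eq using that by (intro weyl.span_base imageI)
    ultimately have "P - wmon M + wmon M \<in> bernstein k"
      using weyl.subspace_add[OF subspace_bernstein] by blast
    then show ?thesis by simp
  qed
  have "weyl.dim (bernstein k \<inter> J) = card {M \<in> mons k. \<exists>P\<in>bernstein k \<inter> J. P - wmon M \<in>
      weyl.span (wmon ` {N \<in> mons k. mon_key N < mon_key M})}"
    using inj_on_subset[OF inj_mon_key] weyl.subspace_inter[OF subspace_bernstein subspace_left_ideal[OF J]]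
    by (intro weyl.dim_eq_card_leading finite_mons wmon_independent) (auto simp: bernstein_eq)
  also have "{M \<in> mons k. \<exists>P\<in>bernstein k \<inter> J. P - wmon M \<in>
      weyl.span (wmon ` {N \<in> mons k. mon_key N < mon_key M})} = {M \<in> mons k. M \<in> leading J}"
  proof (rule Collect_cong[OF conj_cong[OF refl]])
    fix M :: "('v + 'v) multiset" assume M: "M \<in> mons k"
    show "(\<exists>P\<in>bernstein k \<inter> J. P - wmon M \<in>
      weyl.span (wmon ` {N \<in> mons k. mon_key N < mon_key M})) \<longleftrightarrow> M \<in> leading J"
      unfolding eq[OF M] leading_def using sub[OF M] by blast
  qed
  finally show ?thesis .
qed

lemma hilbert_function_eq:
  assumes "left_ideal J"
  shows "hilbert_function J k = count_outside UNIV (leading J) k"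
proof -
  have "{M \<in> mons k. M \<in> leading J} \<subseteq> mons k" by blast
  moreover have "mons k - {M \<in> mons k. M \<in> leading J} = {M. set_mset M \<subseteq> UNIV \<and> size M \<le> k \<and> M \<notin> leading J}"
    by blast
  ultimately show ?thesis
    unfolding hilbert_function_def dim_bernstein dim_bernstein_inter[OF assms] count_outside_def
    using card_Diff_subset[of "{M \<in> mons k. M \<in> leading J}" "mons k"]
      finite_subset[OF _ finite_mons, of "{M \<in> mons k. M \<in> leading J}"] by simp
qed

lemma eventually_poly_hilbert_function: "left_ideal J \<Longrightarrow> eventually_poly (hilbert_function J)"
  using eventually_poly_count_outside[OF finite upset_leading, of J]
  by (simp add: eventually_poly_def hilbert_function_eq)

text \<open>The quotient of \<open>F k\<close> by \<open>k ^ degree p\<close> tends to the leading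
  coefficient. This is nonnegative as a limit of nonnegative numbers and nonzero as a leading
  coefficient, so both bounds follow, with one natural constant for the two.\<close>

lemma poly_growth:
  fixes p :: "rat poly"
  assumes F: "\<forall>\<^sub>F k in sequentially. of_nat (F k) = poly p (of_nat k)" and p: "p \<noteq> 0"
  shows "\<exists>C. \<forall>\<^sub>F k in sequentially. F k \<le> C * k ^ degree p \<and> k ^ degree p \<le> C * F k"
proof -
  define e where "e = degree p"
  define a where "a i = (of_rat (coeff p i) :: real)" for i
  have "(\<lambda>k. a i * real k ^ i / real k ^ e) \<longlonglongrightarrow> (if i = e then a e else 0)" if "i \<le> e" for i
  proof (cases "i = e")
    case True
    have "\<forall>\<^sub>F k in sequentially. a i * real k ^ i / real k ^ e = a e"
      using eventually_gt_at_top[of 0] by eventually_elim (simp add: True)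
    then show ?thesis using True by (simp add: tendsto_eventually)
  next
    case False
    have "(\<lambda>k. a i * inverse (real k) ^ (e - i)) \<longlonglongrightarrow> a i * 0 ^ (e - i)"
      by (intro tendsto_intros lim_inverse_n)
    moreover have "\<forall>\<^sub>F k in sequentially. a i * inverse (real k) ^ (e - i) = a i * real k ^ i / real k ^ e"
      using eventually_gt_at_top[of 0]
    proof eventually_elim
      case (elim k)
      have "real k ^ e = real k ^ i * real k ^ (e - i)" using that by (simp flip: power_add)
      then show ?case using elim by (simp add: field_simps)
    qed
    ultimately show ?thesis using False that by (simp add: tendsto_cong power_0_left)
  qed
  then have "(\<lambda>k. \<Sum>i\<le>e. a i * real k ^ i / real k ^ e) \<longlonglongrightarrow> (\<Sum>i\<le>e. if i = e then a e else 0)"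
    by (intro tendsto_sum) auto
  moreover have "\<forall>\<^sub>F k in sequentially. (\<Sum>i\<le>e. a i * real k ^ i / real k ^ e) = real (F k) / real k ^ e"
    using F
  proof eventually_elim
    case (elim k)
    have "real (F k) = of_rat (of_nat (F k))" by simp
    also have "\<dots> = (\<Sum>i\<le>e. a i * real k ^ i)"
      unfolding elim poly_altdef e_def a_def by (simp add: of_rat_sum of_rat_mult of_rat_power)
    finally show ?case by (simp add: sum_divide_distrib)
  qed
  ultimately have lim: "(\<lambda>k. real (F k) / real k ^ e) \<longlonglongrightarrow> a e"
    by (simp add: tendsto_cong)
  have "a e \<ge> 0" by (rule tendsto_lowerbound[OF lim]) auto
  moreover have "a e \<noteq> 0" using p by (simp add: a_def e_def)
  ultimately have pos: "a e > 0" by simp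
  obtain C :: nat where C: "real C \<ge> 2 * a e" "real C \<ge> 2 / a e"
    by (meson real_arch_simple max.bounded_iff order_trans)
  have "\<forall>\<^sub>F k in sequentially. real (F k) / real k ^ e < 2 * a e"
    "\<forall>\<^sub>F k in sequentially. a e / 2 < real (F k) / real k ^ e"
    using pos by (intro order_tendstoD[OF lim]; simp)+
  then have "\<forall>\<^sub>F k in sequentially. F k \<le> C * k ^ e \<and> k ^ e \<le> C * F k"
    using eventually_gt_at_top[of 0]
  proof eventually_elim
    case (elim k)
    have k: "real k ^ e > 0" using elim by simp
    have "real (F k) \<le> 2 * a e * real k ^ e" using elim(1) k by (simp add: field_simps)
    also have "\<dots> \<le> real C * real k ^ e" using C k by (intro mult_right_mono) auto
    finally have 1: "F k \<le> C * k ^ e" by (metis of_nat_le_iff of_nat_mult of_nat_power)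
    have "real k ^ e \<le> 2 / a e * real (F k)" using elim(2) k pos by (simp add: field_simps)
    also have "\<dots> \<le> real C * real (F k)" using C by (intro mult_right_mono) auto
    finally have 2: "k ^ e \<le> C * F k" by (metis of_nat_le_iff of_nat_mult of_nat_power)
    show ?case using 1 2 by simp
  qed
  then show ?thesis unfolding e_def by blast
qed

lemma power_le_imp_exponent_le:
  assumes "\<forall>\<^sub>F k in sequentially. k ^ e \<le> C * k ^ n"
  shows "e \<le> (n::nat)"
proof (rule ccontr)
  assume "\<not> e \<le> n"
  obtain k where k: "k ^ e \<le> C * k ^ n" "k > C"
    using eventually_happens'[OF _ eventually_conj[OF assms eventually_gt_at_top[of C]]] by auto
  have "C * k ^ n < k * k ^ n" using k by simp
  also have "\<dots> = k ^ Suc n" by simp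
  also have "\<dots> \<le> k ^ e" using \<open>\<not> e \<le> n\<close> k by (intro power_increasing) auto
  finally show False using k by simp
qed

text \<open>The lower bound is only required along multiples of \<open>b\<close>, because Hilbert
  functions are compared at rescaled arguments; the resulting factor \<open>b ^ degree p\<close>
  disappears in the constant.\<close>

lemma degree_eq_of_growth:
  fixes p :: "rat poly"
  assumes F: "\<forall>\<^sub>F k in sequentially. of_nat (F k) = poly p (of_nat k)"
    and upper: "\<forall>\<^sub>F k in sequentially. F k \<le> A * k ^ n"
    and lower: "\<forall>\<^sub>F m in sequentially. m ^ n \<le> B * F (b * m)" and b: "b > 0"
  shows "degree p = n"
proof -
  have bm: "filterlim (\<lambda>m. b * m) sequentially sequentially"
    using b by (intro filterlim_subseq strict_monoI) simp
  have "p \<noteq> 0"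
  proof
    assume "p = 0"
    then have "\<forall>\<^sub>F k in sequentially. F k = 0" using F by (simp add: eventually_mono)
    then have "\<forall>\<^sub>F m in sequentially. F (b * m) = 0" by (rule eventually_compose_filterlim[OF _ bm])
    then have "\<forall>\<^sub>F m in sequentially. False"
      using lower eventually_gt_at_top[of 0] by eventually_elim simp
    then show False by simp
  qed
  then obtain C where C: "\<forall>\<^sub>F k in sequentially. F k \<le> C * k ^ degree p \<and> k ^ degree p \<le> C * F k"
    using poly_growth[OF F] by blast
  show ?thesis
  proof (rule antisym)
    have "\<forall>\<^sub>F k in sequentially. k ^ degree p \<le> (C * A) * k ^ n"
      using C upper
    proof eventually_elim
      case (elim k)
      have "k ^ degree p \<le> C * F k" using elim by simp
      also have "\<dots> \<le> C * (A * k ^ n)" using elim by (intro mult_left_mono) auto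
      finally show ?case by (simp add: mult.assoc)
    qed
    then show "degree p \<le> n" by (rule power_le_imp_exponent_le)
    have "\<forall>\<^sub>F m in sequentially. F (b * m) \<le> C * (b * m) ^ degree p"
      using eventually_compose_filterlim[OF C bm] by (rule eventually_mono) simp
    then have "\<forall>\<^sub>F m in sequentially. m ^ n \<le> (B * C * b ^ degree p) * m ^ degree p"
      using lower
    proof eventually_elim
      case (elim m)
      have "m ^ n \<le> B * F (b * m)" using elim by simp
      also have "\<dots> \<le> B * (C * (b * m) ^ degree p)" using elim by (intro mult_left_mono) auto
      finally show ?case by (simp add: power_mult_distrib mult.assoc)
    qed
    then show "n \<le> degree p" by (rule power_le_imp_exponent_le)
  qed
qed

section \<open>Normal forms modulo the heat operators\<close>

lemma left_ideal_hull: "left_ideal (left_ideal hull S)"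
proof (rule hull_in)
  show "left_ideal (\<Inter> T)" if "\<forall>I\<in>T. left_ideal I" for T :: "'a set set"
    using that unfolding left_ideal_def by blast
qed

lemma left_ideal_uminus: "left_ideal J \<Longrightarrow> a \<in> J \<Longrightarrow> - a \<in> J" for a :: "'r::ring_1"
  unfolding left_ideal_def by (metis mult_minus1)

lemma left_ideal_diff: "left_ideal J \<Longrightarrow> a \<in> J \<Longrightarrow> b \<in> J \<Longrightarrow> a - b \<in> J" for a :: "'r::ring_1"
  using left_ideal_uminus[of J b] unfolding left_ideal_def by (metis diff_conv_add_uminus)

lemma phi_simps:
  "phi 0 = 0" "phi 1 = 1" "phi (- P) = - phi P" "phi (P - Q) = phi P - phi Q"
  "phi (weyl_scale c P) = weyl_scale c (phi P)" "phi (P ^ n) = phi P ^ n"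
  "phi (sum h A) = (\<Sum>a\<in>A. phi (h a))" "phi 2 = 2"
proof -
  show 0: "phi 0 = 0" and 1: "phi 1 = 1"
    using phi_morphism(1)[of 0] phi_morphism(1)[of 1] by (simp_all add: weyl_const_simps(1,2))
  show m: "phi (- P) = - phi P" for P
    unfolding eq_neg_iff_add_eq_0 by (simp add: 0 flip: phi_morphism(2))
  show "phi (P - Q) = phi P - phi Q"
    by (simp only: diff_conv_add_uminus phi_morphism(2) m)
  show "phi (weyl_scale c P) = weyl_scale c (phi P)"
    by (simp add: weyl_scale_def phi_morphism)
  show "phi (P ^ n) = phi P ^ n" by (induction n) (simp_all add: 1 phi_morphism)
  show "phi (sum h A) = (\<Sum>a\<in>A. phi (h a))"
    by (induction A rule: infinite_finite_induct) (simp_all add: 0 phi_morphism)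
  show "phi 2 = 2" by (simp only: one_add_one[symmetric] phi_morphism(2) 1)
qed

text \<open>The derivative of \<open>hfun\<close> by the coordinate \<open>u\<close> of
  \<open>x\<close>, as an element of D_t. Off the diagonal the factor 2 comes from the two equal
  matrix entries.\<close>

lift_definition heat_symbol :: "'d::finite uprod \<Rightarrow> 'd weyl" is
  "\<lambda>(i, j). if i = j then weyl_var i ^ 2 else 2 * weyl_var i * weyl_var j"
  by (auto simp: mult.assoc weyl_relations)

lemma heat_symbol_Upair:
  "heat_symbol (Upair i j) = (if i = j then weyl_var i ^ 2 else 2 * weyl_var i * weyl_var j)"
  by transfer simp

definition heat :: "'d::finite uprod \<Rightarrow> 'd xy weyl" where
  "heat u = weyl_der (Inl u) - phi (heat_symbol u)"

lemma heat_ops_eq: "(heat_ops :: 'd::finite xy weyl set) = range heat"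
proof -
  have "heat (Upair i j) = (if i = j then weyl_der (xvar i i) - weyl_der (yvar i) ^ 2
      else weyl_der (xvar i j) - 2 * weyl_der (yvar i) * weyl_der (yvar j))" for i j :: 'd
    by (simp add: heat_def heat_symbol_Upair phi_simps phi_morphism)
  then have "{weyl_der (xvar i j) - 2 * weyl_der (yvar i) * weyl_der (yvar j) | i j. i \<noteq> j} =
      {heat (Upair i j) | i j :: 'd. i \<noteq> j}"
    "{weyl_der (xvar i i) - weyl_der (yvar i) ^ 2 | i. True} = {heat (Upair i i) | i :: 'd. True}"
    by (metis (no_types, lifting))+
  then have "heat_ops = {heat (Upair i j) | i j :: 'd. i \<noteq> j} \<union> {heat (Upair i i) | i :: 'd. True}"
    by (simp add: heat_ops_def)
  also have "\<dots> = {heat (Upair i j) | i j :: 'd. True}" by blast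
  also have "\<dots> = range heat" by (auto simp: image_iff) (metis uprod_exhaust)
  finally show ?thesis .
qed

text \<open>Half the derivative of \<open>heat_symbol u\<close> by the \<open>k\<close>-th variable,
  written as a sum over \<open>l\<close> so that it matches the sum in
  \<open>phi (weyl_der k)\<close>.\<close>

definition heat_deriv :: "'d::finite uprod \<Rightarrow> 'd \<Rightarrow> 'd weyl" where
  "heat_deriv u k = (\<Sum>l\<in>UNIV. if u = Upair k l then weyl_var l else 0)"

lemma heat_deriv_Upair:
  "heat_deriv (Upair i j) k = (if i = j then if k = i then weyl_var i else 0
     else (if k = i then weyl_var j else 0) + (if k = j then weyl_var i else 0))"
proof -
  have "(Upair i j = Upair k l) = (if k = i then l = j else k = j \<and> l = i)" for l :: 'a
    by (auto)
  then show ?thesis by (auto simp: heat_deriv_def)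
qed

lemma der_heat_symbol:
  "weyl_der k * heat_symbol u = heat_symbol u * weyl_der k + 2 * heat_deriv u k"
proof (cases u)
  case (Upair i j)
  have d: "weyl_der k * (weyl_var i * weyl_var j) = weyl_var i * weyl_var j * weyl_der k
      + ((if k = j then weyl_var i else 0) + (if k = i then weyl_var j else 0))" for i j
  proof -
    have "weyl_der k * (weyl_var i * weyl_var j) = (weyl_der k * weyl_var i) * weyl_var j"
      by (simp only: mult.assoc)
    also have "\<dots> = weyl_var i * (weyl_der k * weyl_var j) + (if k = i then weyl_var j else 0)"
      by (simp add: weyl_relations(3) distrib_right mult.assoc)
    also have "\<dots> = weyl_var i * weyl_var j * weyl_der k
      + ((if k = j then weyl_var i else 0) + (if k = i then weyl_var j else 0))"
      by (simp add: weyl_relations(3) distrib_left mult.assoc)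
    finally show ?thesis .
  qed
  show ?thesis
  proof (cases "i = j")
    case True
    then show ?thesis using d[of i i]
      by (simp add: Upair heat_symbol_Upair heat_deriv_Upair power2_eq_square mult_2)
  next
    case False
    have "weyl_der k * (2 * weyl_var i * weyl_var j) = 2 * (weyl_der k * (weyl_var i * weyl_var j))"
      by (simp add: mult_2 distrib_left distrib_right)
    then show ?thesis using False
      by (simp add: Upair heat_symbol_Upair heat_deriv_Upair d distrib_left mult.assoc add.commute)
  qed
qed

lemma heat_symbol_mult_commute: "heat_symbol u * heat_symbol v = heat_symbol v * heat_symbol u"
  and heat_symbol_var_commute: "heat_symbol u * weyl_var i = weyl_var i * heat_symbol u"
proof -
  have var: "heat_symbol u * weyl_var i = weyl_var i * heat_symbol u" for u and i :: 'a
  proof (cases u)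
    case (Upair a b)
    have v: "weyl_var a * weyl_var b * weyl_var i = weyl_var i * (weyl_var a * weyl_var b)"
    proof -
      have "weyl_var a * weyl_var b * weyl_var i = weyl_var a * (weyl_var i * weyl_var b)"
        by (simp only: mult.assoc weyl_relations(1)[of b i])
      also have "\<dots> = weyl_var i * (weyl_var a * weyl_var b)"
        by (simp only: mult.assoc[symmetric] weyl_relations(1)[of a i])
      finally show ?thesis .
    qed
    have "heat_symbol u = weyl_var a * weyl_var b \<or>
        heat_symbol u = weyl_var a * weyl_var b + weyl_var a * weyl_var b"
      by (simp add: Upair heat_symbol_Upair power2_eq_square mult_2 distrib_right)
    then show ?thesis by (elim disjE) (simp_all add: distrib_left distrib_right v)
  qed
  then show "heat_symbol u * weyl_var i = weyl_var i * heat_symbol u" .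
  show "heat_symbol u * heat_symbol v = heat_symbol v * heat_symbol u"
  proof (cases v)
    case (Upair a b)
    have v: "heat_symbol u * (weyl_var a * weyl_var b) = weyl_var a * weyl_var b * heat_symbol u"
      by (metis var mult.assoc)
    have "heat_symbol v = weyl_var a * weyl_var b \<or>
        heat_symbol v = weyl_var a * weyl_var b + weyl_var a * weyl_var b"
      by (simp add: Upair heat_symbol_Upair power2_eq_square mult_2 distrib_right)
    then show ?thesis by (elim disjE) (simp_all add: distrib_left distrib_right v)
  qed
qed

text \<open>Only \<open>weyl_der k\<close> needs an argument. The commutators of
  \<open>weyl_der (Inl u)\<close> and of \<open>phi (heat_symbol u)\<close> with its image are both
  \<open>- 2 * phi (heat_deriv u k)\<close>, so they cancel in \<open>heat u\<close>.\<close>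

lemma heat_phi_commute: "heat u * phi Q = phi Q * heat u"
proof -
  have var: "heat u * phi (weyl_var i) = phi (weyl_var i) * heat u" for i
  proof -
    have "heat_symbol u * weyl_var i = weyl_var i * heat_symbol u" by (rule heat_symbol_var_commute)
    then have "phi (heat_symbol u) * phi (weyl_var i) = phi (weyl_var i) * phi (heat_symbol u)"
      by (metis phi_morphism(3))
    then show ?thesis
      by (simp add: heat_def left_diff_distrib right_diff_distrib phi_morphism(4) weyl_relations(2))
  qed
  have der: "heat u * phi (weyl_der k) = phi (weyl_der k) * heat u" for k
  proof -
    have x: "weyl_der (Inl u) * (weyl_var (xvar k l) * weyl_der (yvar l)) =
        weyl_var (xvar k l) * weyl_der (yvar l) * weyl_der (Inl u)
        + (if u = Upair k l then weyl_der (yvar l) else 0)" for l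
    proof -
      have "weyl_der (Inl u) * (weyl_var (xvar k l) * weyl_der (yvar l)) =
          (weyl_der (Inl u) * weyl_var (xvar k l)) * weyl_der (yvar l)" by (simp only: mult.assoc)
      then show ?thesis
        by (simp add: weyl_relations(3) distrib_right mult.assoc weyl_relations(2)[of "Inl u"])
    qed
    have "phi (heat_deriv u k) = (\<Sum>l\<in>UNIV. if u = Upair k l then weyl_der (yvar l) else 0)"
      unfolding heat_deriv_def phi_simps(7) by (intro sum.cong) (auto simp: phi_morphism phi_simps)
    then have "weyl_der (Inl u) * (\<Sum>l\<in>UNIV. weyl_var (xvar k l) * weyl_der (yvar l)) =
        (\<Sum>l\<in>UNIV. weyl_var (xvar k l) * weyl_der (yvar l)) * weyl_der (Inl u) + phi (heat_deriv u k)"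
      by (simp add: sum_distrib_left sum_distrib_right x sum.distrib)
    then have 1: "weyl_der (Inl u) * phi (weyl_der k) = phi (weyl_der k) * weyl_der (Inl u) - 2 * phi (heat_deriv u k)"
      by (simp add: phi_morphism(5) right_diff_distrib left_diff_distrib weyl_relations(3) mult_2 distrib_left distrib_right)
    have "phi (weyl_der k * heat_symbol u) = phi (heat_symbol u * weyl_der k + 2 * heat_deriv u k)"
      by (simp only: der_heat_symbol)
    then have 2: "phi (weyl_der k) * phi (heat_symbol u) = phi (heat_symbol u) * phi (weyl_der k) + 2 * phi (heat_deriv u k)"
      by (simp only: phi_morphism(2,3) phi_simps)
    show ?thesis by (simp add: heat_def left_diff_distrib right_diff_distrib 1 2)
  qed
  have "heat u * phi_expr a = phi_expr a * heat u" for a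
  proof (induction a)
    case (WConst c)
    show ?case by (simp add: weyl_const_central)
  next
    case (WMul a b)
    then show ?case by simp (metis mult.assoc)
  qed (use var der in \<open>auto simp: phi_morphism(4,5) distrib_left distrib_right\<close>)
  then show ?thesis by (induction Q rule: weyl.abs_induct) (simp add: phi.abs_eq)
qed

section \<open>Reduction to combinations of \<open>xmon B * phi Q\<close> modulo the ideal\<close>

definition xmon :: "'d uprod multiset \<Rightarrow> 'd::finite xy weyl" where
  "xmon = mprod (\<lambda>u. weyl_var (Inl u))"

lemma xmon_simps [simp]:
  fixes u :: "'d::finite uprod"
  shows "xmon {#} = (1 :: 'd xy weyl)" "xmon (add_mset u A) = weyl_var (Inl u) * xmon A"
proof -
  have "commuting (\<lambda>u. weyl_var (Inl u) :: 'd xy weyl)" by (simp add: commuting_def weyl_relations)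
  then show "xmon {#} = (1 :: 'd xy weyl)" "xmon (add_mset u A) = weyl_var (Inl u) * xmon A"
    by (simp_all add: xmon_def mprod_add)
qed

lemma xmon_commute:
  assumes "\<And>u. y * weyl_var (Inl u) = weyl_var (Inl u) * y"
  shows "y * xmon A = xmon A * y"
  unfolding xmon_def by (rule mprod_commute) (use assms in \<open>auto simp: commuting_def weyl_relations\<close>)

lemma der_xmon:
  "weyl_der (Inl u) * xmon A = xmon A * weyl_der (Inl u) + of_nat (count A u) * xmon (A - {#u#})"
  unfolding xmon_def
  by (rule der_mprod_commutator) (auto simp: commuting_def weyl_relations)

definition phi_ideal :: "'d::finite weyl set \<Rightarrow> 'd xy weyl set" where
  "phi_ideal A = left_ideal hull (phi ` A \<union> heat_ops)"

lemma left_ideal_phi_ideal: "left_ideal (phi_ideal A)"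
  unfolding phi_ideal_def by (rule left_ideal_hull)

lemma phi_ideal_heat: "heat u \<in> phi_ideal A"
  unfolding phi_ideal_def heat_ops_eq by (rule hull_inc) blast

lemma phi_ideal_phi:
  assumes "Q \<in> left_ideal hull A"
  shows "phi Q \<in> phi_ideal A"
proof -
  note J = left_ideal_phi_ideal[of A, unfolded left_ideal_def]
  have "left_ideal {Q. phi Q \<in> phi_ideal A}"
    unfolding left_ideal_def using J by (auto simp: phi_simps phi_morphism)
  moreover have "A \<subseteq> {Q. phi Q \<in> phi_ideal A}"
    unfolding phi_ideal_def by (auto intro: hull_inc)
  ultimately have "left_ideal hull A \<subseteq> {Q. phi Q \<in> phi_ideal A}" by (rule hull_minimal[rotated])
  then show ?thesis using assms by blast
qed

text \<open>Having the ideal among the spanning elements turns reduction modulo the ideal into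
  membership. The two factors are bounded separately by \<open>m\<close>.\<close>

definition normal_forms :: "'d::finite weyl set \<Rightarrow> nat \<Rightarrow> 'd xy weyl set" where
  "normal_forms A m = weyl.span (phi_ideal A \<union> {xmon B * phi Q | B Q. size B \<le> m \<and> Q \<in> bernstein m})"

text \<open>Each generator is expressed by \<open>x\<close>, heat operators and the image of
  \<open>phi\<close>. The increase by 2 is caused by an \<open>x\<close>-derivative, which
  multiplies \<open>Q\<close> by the quadratic \<open>heat_symbol u\<close>.\<close>

lemma gen_normal_forms:
  assumes "P \<in> normal_forms A m"
  shows "gen z * P \<in> normal_forms A (m + 2)"
proof -
  let ?G = "\<lambda>m. phi_ideal A \<union> {xmon B * phi Q | B Q. size B \<le> m \<and> Q \<in> bernstein m}"
  note J = left_ideal_phi_ideal[of A]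
  have nf: "xmon B * phi Q \<in> normal_forms A m'" if "size B \<le> m'" "Q \<in> bernstein m'" for B Q m'
    unfolding normal_forms_def using that by (intro weyl.span_base) blast
  have sub: "weyl.subspace (normal_forms A m')" for m' by (simp add: normal_forms_def)
  have base: "gen z * P \<in> normal_forms A (m + 2)" if "P \<in> ?G m" for P
    using that
  proof
    assume "P \<in> phi_ideal A"
    then have "gen z * P \<in> phi_ideal A" using J unfolding left_ideal_def by blast
    then show ?thesis unfolding normal_forms_def by (intro weyl.span_base) blast
  next
    assume "P \<in> {xmon B * phi Q | B Q. size B \<le> m \<and> Q \<in> bernstein m}"
    then obtain B Q where P: "P = xmon B * phi Q" "size B \<le> m" "Q \<in> bernstein m" by blast
    have Q2: "Q \<in> bernstein (m + 2)" using P(3) bernstein_mono[of m "m + 2"] by auto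
    have gQ: "gen z' * Q \<in> bernstein (m + 2)" for z'
      using gen_bernstein[OF P(3), of z'] bernstein_mono[of "Suc m" "m + 2"] by auto
    have vQ: "weyl_var i * Q \<in> bernstein (m + 2)" for i using gQ[of "Inl i"] by (simp add: gen_def)
    have dQ: "weyl_der i * Q \<in> bernstein (m + 2)" for i using gQ[of "Inr i"] by (simp add: gen_def)
    have ycomm: "weyl_var (yvar i) * xmon B = xmon B * weyl_var (yvar i)"
      "weyl_der (yvar i) * xmon B = xmon B * weyl_der (yvar i)" for i
      by (rule xmon_commute; simp add: weyl_relations)+
    show ?thesis
    proof (cases z)
      case (Inl v)
      show ?thesis
      proof (cases v)
        case v: (Inl u)
        have "gen z * P = xmon (add_mset u B) * phi Q" by (simp add: Inl v gen_def P mult.assoc)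
        then show ?thesis using nf[of "add_mset u B" "m + 2" Q] P(2) Q2 by simp
      next
        case v: (Inr i)
        \<comment> \<open>The defining formula of \<open>phi (weyl_der i)\<close>, solved for the
          variable \<open>y_i\<close>.\<close>
        have y: "weyl_var (yvar i) = - phi (weyl_der i) - 2 * (\<Sum>k\<in>UNIV. weyl_var (xvar i k) * phi (weyl_var k))"
          by (simp add: phi_morphism)
        have "gen z * P = xmon B * (weyl_var (yvar i) * phi Q)"
          by (simp add: Inl v gen_def P ycomm flip: mult.assoc)
        also have "\<dots> = - (xmon B * phi (weyl_der i * Q))
            - 2 * (\<Sum>k\<in>UNIV. xmon B * weyl_var (xvar i k) * phi (weyl_var k * Q))"
          unfolding y by (simp add: left_diff_distrib right_diff_distrib phi_morphism(3) mult.assoc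
              sum_distrib_left sum_distrib_right mult_2 distrib_left distrib_right)
        also have "\<dots> = - (xmon B * phi (weyl_der i * Q))
            - weyl_scale 2 (\<Sum>k\<in>UNIV. xmon (add_mset (Upair i k) B) * phi (weyl_var k * Q))"
        proof -
          have "xmon B * weyl_var (xvar i k) = xmon (add_mset (Upair i k) B)" for k
            using xmon_commute[of "weyl_var (xvar i k)" B] by (simp add: weyl_relations)
          moreover have "weyl_const 2 = (2 :: 'a xy weyl)" using weyl_const_of_nat[of 2] by simp
          ultimately show ?thesis by (simp add: weyl_scale_def)
        qed
        also have "\<dots> \<in> normal_forms A (m + 2)"
          using P(2) vQ dQ
          by (intro weyl.subspace_diff[OF sub] weyl.subspace_neg[OF sub] weyl.subspace_scale[OF sub]
              weyl.subspace_sum[OF sub] nf) auto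
        finally show ?thesis .
      qed
    next
      case (Inr v)
      show ?thesis
      proof (cases v)
        case v: (Inr i)
        have "gen z * P = xmon B * phi (weyl_var i * Q)"
          by (simp add: Inr v gen_def P phi_morphism ycomm flip: mult.assoc)
        then show ?thesis using nf[of B "m + 2"] P(2) vQ by simp
      next
        case v: (Inl u)
        have hQ: "heat_symbol u * Q \<in> bernstein (m + 2)"
        proof (cases u)
          case (Upair i j)
          have "gen (Inl i) * (gen (Inl j) * Q) \<in> bernstein (Suc (Suc m))"
            by (intro gen_bernstein P(3))
          then have vv: "weyl_var i * (weyl_var j * Q) \<in> bernstein (m + 2)" by (simp add: gen_def)
          then show ?thesis
            using weyl.subspace_add[OF subspace_bernstein vv vv]
            by (auto simp: Upair heat_symbol_Upair power2_eq_square mult.assoc mult_2 distrib_right)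
        qed
        have "gen z * P = (weyl_der (Inl u) * xmon B) * phi Q" by (simp add: Inr v gen_def P mult.assoc)
        also have "\<dots> = xmon B * (weyl_der (Inl u) * phi Q)
            + weyl_scale (of_nat (count B u)) (xmon (B - {#u#}) * phi Q)"
          by (simp add: der_xmon distrib_right mult.assoc weyl_scale_def weyl_const_of_nat)
        also have "weyl_der (Inl u) = heat u + phi (heat_symbol u)" by (simp add: heat_def)
        \<comment> \<open>Since it commutes with the image of \<open>phi\<close>, the heat operator
          can be moved to the right end, where the left ideal absorbs it.\<close>
        also have "xmon B * ((heat u + phi (heat_symbol u)) * phi Q)
            = xmon B * phi Q * heat u + xmon B * phi (heat_symbol u * Q)"
          by (simp add: distrib_left distrib_right heat_phi_commute phi_morphism mult.assoc)
        also have "xmon B * phi Q * heat u + xmon B * phi (heat_symbol u * Q)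
            + weyl_scale (of_nat (count B u)) (xmon (B - {#u#}) * phi Q) \<in> normal_forms A (m + 2)"
        proof (intro weyl.subspace_add[OF sub] weyl.subspace_scale[OF sub] nf)
          have "xmon B * phi Q * heat u \<in> phi_ideal A"
            using J phi_ideal_heat unfolding left_ideal_def by blast
          then show "xmon B * phi Q * heat u \<in> normal_forms A (m + 2)"
            unfolding normal_forms_def by (intro weyl.span_base) blast
        qed (use P(2) hQ Q2 in \<open>auto intro: le_trans[OF size_Diff1_le]\<close>)
        finally show ?thesis .
      qed
    qed
  qed
  show ?thesis
    using assms unfolding normal_forms_def[of A m]
  proof (induction rule: weyl.span_induct_alt)
    case base
    show ?case using sub by (simp add: weyl.subspace_0)
  next
    case (step c x y)
    have "gen z * (weyl_scale c x + y) = weyl_scale c (gen z * x) + gen z * y"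
      by (simp add: distrib_left weyl_scale_mult_right)
    then show ?case
      using weyl.subspace_add[OF sub weyl.subspace_scale[OF sub base[OF step(1)]] step(2)] by simp
  qed
qed

lemma bernstein_normal_forms: "bernstein k \<subseteq> normal_forms A (2 * k)"
proof (rule bernstein_induct)
  show "weyl.subspace (normal_forms A m)" for m by (simp add: normal_forms_def)
  show "normal_forms A m \<subseteq> normal_forms A (Suc m)" for m
    unfolding normal_forms_def using bernstein_mono[of m "Suc m"]
    by (intro weyl.span_mono Un_mono) (auto intro: le_SucI)
  have "xmon {#} * phi 1 \<in> normal_forms A 0"
    unfolding normal_forms_def using one_bernstein[of 0]
    by (intro weyl.span_base UnI2 CollectI exI[of _ "{#}"] exI[of _ 1]) simp
  then show "1 \<in> normal_forms A 0" by (simp add: phi_simps)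
qed (rule gen_normal_forms)

section \<open>Power series with coefficients in the Weyl algebra\<close>

text \<open>The value at \<open>B\<close> is the coefficient of the monomial \<open>B\<close> in
  \<open>x\<close>, without division by factorials.\<close>

type_synonym 'd xseries = "'d uprod multiset \<Rightarrow> 'd weyl"

definition xshift :: "'d uprod \<Rightarrow> 'd xseries \<Rightarrow> 'd::finite xseries" where
  "xshift u s = (\<lambda>B. if u \<in># B then s (B - {#u#}) else 0)"

definition xderiv :: "'d uprod \<Rightarrow> 'd xseries \<Rightarrow> 'd::finite xseries" where
  "xderiv u s = (\<lambda>B. of_nat (Suc (count B u)) * s (add_mset u B))"

definition lmult :: "'d weyl \<Rightarrow> 'd xseries \<Rightarrow> 'd::finite xseries" where
  "lmult q s = (\<lambda>B. q * s B)"

text \<open>The action of \<open>y_i\<close> is forced: it is \<open>phi (weyl_der i)\<close> solved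
  for \<open>y_i\<close>, with the image of \<open>phi\<close> acting by left
  multiplication.\<close>

definition yop :: "'d \<Rightarrow> 'd xseries \<Rightarrow> 'd::finite xseries" where
  "yop i s = (\<lambda>B. - (weyl_der i * s B) - 2 * (\<Sum>k\<in>UNIV. xshift (Upair i k) (lmult (weyl_var k) s) B))"

text \<open>The extra summand makes \<open>heat u\<close> act as the plain derivative
  \<open>xderiv u\<close>, which annihilates constant series.\<close>

definition xderiv_heat :: "'d uprod \<Rightarrow> 'd xseries \<Rightarrow> 'd::finite xseries" where
  "xderiv_heat u s = (\<lambda>B. xderiv u s B + heat_symbol u * s B)"

primrec series_act :: "'d::finite xy wexpr \<Rightarrow> 'd xseries \<Rightarrow> 'd xseries" where
  "series_act (WConst c) s = lmult (weyl_const c) s"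
| "series_act (WVar v) s = (case v of Inl u \<Rightarrow> xshift u s | Inr i \<Rightarrow> yop i s)"
| "series_act (WDer v) s = (case v of Inl u \<Rightarrow> xderiv_heat u s | Inr i \<Rightarrow> lmult (weyl_var i) s)"
| "series_act (WAdd a b) s = (\<lambda>B. series_act a s B + series_act b s B)"
| "series_act (WMul a b) s = series_act a (series_act b s)"

lemma xshift_add: "xshift u (\<lambda>B. s B + t B) = (\<lambda>B. xshift u s B + xshift u t B)"
  by (auto simp: xshift_def)

lemma xshift_sum: "xshift u (\<lambda>B. \<Sum>k\<in>K. s k B) = (\<lambda>B. \<Sum>k\<in>K. xshift u (s k) B)"
  by (auto simp: xshift_def)

lemma xshift_uminus: "xshift u (\<lambda>B. - s B) = (\<lambda>B. - xshift u s B)"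
  by (auto simp: xshift_def)

lemma xshift_diff: "xshift u (\<lambda>B. s B - t B) = (\<lambda>B. xshift u s B - xshift u t B)"
  by (auto simp: xshift_def)

lemma xshift_two: "xshift u (\<lambda>B. 2 * s B) = (\<lambda>B. 2 * xshift u s B)"
  by (auto simp: xshift_def)

lemma xshift_lmult: "xshift u (lmult q s) = lmult q (xshift u s)"
  by (auto simp: xshift_def lmult_def)

lemma xshift_commute: "xshift u (xshift v s) = xshift v (xshift u s)"
proof
  fix B
  have "v \<in># B - {#u#} \<longleftrightarrow> u \<in># B - {#v#}" if "u \<in># B" "v \<in># B"
    by (cases "u = v") (use that in \<open>auto simp: in_diff_count\<close>)
  moreover have "B - {#u#} - {#v#} = B - {#v#} - {#u#}" by (simp add: multiset_eq_iff)
  ultimately show "xshift u (xshift v s) B = xshift v (xshift u s) B"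
    by (auto simp: xshift_def dest: in_diffD)
qed

lemma xderiv_commute: "xderiv u (xderiv v s) = xderiv v (xderiv u s)"
proof (cases "u = v")
  case False
  have "of_nat m * (of_nat n * P) = of_nat n * (of_nat m * P)" for m n and P :: "'a weyl"
    by (rule mult_of_nat_left_commute)
  then show ?thesis using False by (simp add: xderiv_def add_mset_commute del: of_nat_Suc)
qed simp

lemma xderiv_lmult: "xderiv u (lmult q s) = lmult q (xderiv u s)"
  by (simp add: xderiv_def lmult_def mult_of_nat_left_commute del: of_nat_Suc)

lemma xderiv_xshift:
  "xderiv u (xshift v s) = (\<lambda>B. xshift v (xderiv u s) B + (if u = v then s B else 0))"
proof
  fix B
  show "xderiv u (xshift v s) B = xshift v (xderiv u s) B + (if u = v then s B else 0)"
  proof (cases "v \<in># B")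
    case True
    then obtain C where "B = add_mset v C" by (metis insert_DiffM)
    then show ?thesis by (auto simp: xderiv_def xshift_def distrib_right add_mset_commute[of u v])
  next
    case False
    moreover from this have "count B v = 0" by (simp add: not_in_iff)
    ultimately show ?thesis by (auto simp: xderiv_def xshift_def)
  qed
qed

lemma xderiv_add: "xderiv u (\<lambda>B. s B + t B) = (\<lambda>B. xderiv u s B + xderiv u t B)"
  by (simp add: xderiv_def distrib_left del: of_nat_Suc)

lemma xderiv_uminus: "xderiv u (\<lambda>B. - s B) = (\<lambda>B. - xderiv u s B)"
  by (simp add: xderiv_def del: of_nat_Suc)

lemma xderiv_diff: "xderiv u (\<lambda>B. s B - t B) = (\<lambda>B. xderiv u s B - xderiv u t B)"
  by (simp add: xderiv_def right_diff_distrib del: of_nat_Suc)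

lemma xderiv_two: "xderiv u (\<lambda>B. 2 * s B) = (\<lambda>B. 2 * xderiv u s B)"
  by (simp add: xderiv_def mult_2 distrib_left del: of_nat_Suc)

lemma xderiv_sum: "xderiv u (\<lambda>B. \<Sum>k\<in>K. s k B) = (\<lambda>B. \<Sum>k\<in>K. xderiv u (s k) B)"
  by (simp add: xderiv_def sum_distrib_left del: of_nat_Suc)

lemma lmult_lmult: "lmult p (lmult q s) = lmult (p * q) s"
  by (simp add: lmult_def mult.assoc)

lemma yop_alt:
  "yop i s = (\<lambda>B. - lmult (weyl_der i) s B - 2 * (\<Sum>k\<in>UNIV. lmult (weyl_var k) (xshift (Upair i k) s) B))"
  by (simp add: yop_def lmult_def xshift_lmult[unfolded lmult_def])

lemma two_commute: "x * (2 * y) = 2 * (x * y)" for x y :: "'r::ring_1"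
  by (simp add: mult_2 distrib_left)

lemma lmult_yop: "lmult q (yop i s) =
    (\<lambda>B. - (q * (weyl_der i * s B)) - 2 * (\<Sum>k\<in>UNIV. q * (weyl_var k * xshift (Upair i k) s B)))"
  by (simp add: yop_alt lmult_def right_diff_distrib sum_distrib_left two_commute)

lemma xshift_yop: "xshift u (yop i s) = yop i (xshift u s)"
proof -
  have "xshift u (yop i s) = (\<lambda>B. - lmult (weyl_der i) (xshift u s) B
      - 2 * (\<Sum>k\<in>UNIV. lmult (weyl_var k) (xshift u (xshift (Upair i k) s)) B))"
    by (simp only: yop_alt xshift_diff xshift_uminus xshift_two xshift_sum xshift_lmult)
  also have "\<dots> = yop i (xshift u s)"
    by (simp only: yop_alt xshift_commute[of u])
  finally show ?thesis .
qed

text \<open>The coefficients \<open>weyl_der i\<close> and \<open>weyl_var k\<close> fail to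
  commute, and this produces the cross term \<open>xshift (Upair i j) s\<close>. It is symmetric in
  \<open>i\<close> and \<open>j\<close> because the matrix \<open>x\<close> is.\<close>

lemma yop_commute: "yop i (yop j s) = yop j (yop i s)"
proof
  fix B
  let ?T = "\<lambda>i s B. \<Sum>k\<in>UNIV. weyl_var k * xshift (Upair i k) s B"
  have exp: "yop i (yop j s) B = weyl_der i * (weyl_der j * s B) + 2 * (weyl_der i * ?T j s B)
      + 2 * (\<Sum>k\<in>UNIV. weyl_var k * (weyl_der j * xshift (Upair i k) s B))
      + 4 * (\<Sum>k\<in>UNIV. \<Sum>l\<in>UNIV. weyl_var k * (weyl_var l * xshift (Upair j l) (xshift (Upair i k) s) B))" for i j
  proof -
    have "yop i (yop j s) B = - (weyl_der i * yop j s B)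
        - 2 * (\<Sum>k\<in>UNIV. weyl_var k * yop j (xshift (Upair i k) s) B)"
      by (simp add: yop_alt[of i] lmult_def xshift_yop)
    also have "\<dots> = weyl_der i * (weyl_der j * s B) + 2 * (weyl_der i * ?T j s B)
      + 2 * (\<Sum>k\<in>UNIV. weyl_var k * (weyl_der j * xshift (Upair i k) s B))
      + 2 * (2 * (\<Sum>k\<in>UNIV. weyl_var k * ?T j (xshift (Upair i k) s) B))"
      by (simp add: yop_alt[of j] lmult_def right_diff_distrib two_commute[of "weyl_var _"]
          two_commute[of "weyl_der _"] sum_subtractf sum_negf sum_distrib_left[of 2, symmetric])
    also have "2 * (2 * P) = 4 * P" for P :: "'a weyl" by (simp flip: mult.assoc)
    finally show ?thesis by (simp add: sum_distrib_left)
  qed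
  have dT: "weyl_der i * ?T j s B = (\<Sum>k\<in>UNIV. weyl_var k * (weyl_der i * xshift (Upair j k) s B))
      + xshift (Upair i j) s B" for i j
  proof -
    have "weyl_der i * (weyl_var k * xshift (Upair j k) s B) =
        weyl_var k * (weyl_der i * xshift (Upair j k) s B) + (if k = i then xshift (Upair j k) s B else 0)" for k
    proof -
      have "weyl_der i * (weyl_var k * xshift (Upair j k) s B) = (weyl_der i * weyl_var k) * xshift (Upair j k) s B"
        by (simp only: mult.assoc)
      then show ?thesis by (auto simp: weyl_relations(3) distrib_right mult.assoc)
    qed
    then have "weyl_der i * ?T j s B = (\<Sum>k\<in>UNIV. weyl_var k * (weyl_der i * xshift (Upair j k) s B))
      + xshift (Upair j i) s B" by (simp add: sum_distrib_left sum.distrib)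
    moreover have "Upair j i = Upair i j" by simp
    ultimately show ?thesis by (simp only:)
  qed
  have dd: "weyl_der i * (weyl_der j * s B) = weyl_der j * (weyl_der i * s B)"
    by (simp add: weyl_relations(2)[of i j] flip: mult.assoc)
  have vv: "(\<Sum>k\<in>UNIV. \<Sum>l\<in>UNIV. weyl_var k * (weyl_var l * xshift (Upair j l) (xshift (Upair i k) s) B)) =
     (\<Sum>k\<in>UNIV. \<Sum>l\<in>UNIV. weyl_var k * (weyl_var l * xshift (Upair i l) (xshift (Upair j k) s) B))"
  proof (subst sum.swap, intro sum.cong refl)
    fix k l :: 'a
    have "weyl_var l * (weyl_var k * P) = weyl_var k * (weyl_var l * P)" for P
      by (simp add: weyl_relations(1)[of l k] flip: mult.assoc)
    then show "weyl_var l * (weyl_var k * xshift (Upair j k) (xshift (Upair i l) s) B) =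
      weyl_var k * (weyl_var l * xshift (Upair i l) (xshift (Upair j k) s) B)"
      by (simp add: xshift_commute[of "Upair j k"])
  qed
  have sym: "Upair j i = Upair i j" by simp
  show "yop i (yop j s) B = yop j (yop i s) B"
    unfolding exp[of i j] exp[of j i] dT[of i j] dT[of j i] dd vv sym by (simp add: distrib_left)
qed

lemma xderiv_heat_xshift:
  "xderiv_heat u (xshift v s) = (\<lambda>B. xshift v (xderiv_heat u s) B + (if u = v then s B else 0))"
  using xshift_lmult[of v "heat_symbol u" s]
  by (auto simp: xderiv_heat_def xshift_add xderiv_xshift lmult_def fun_eq_iff)

lemma xderiv_heat_commute: "xderiv_heat u (xderiv_heat v s) = xderiv_heat v (xderiv_heat u s)"
proof -
  have "xderiv_heat u (xderiv_heat v s) = (\<lambda>B. xderiv u (xderiv v s) B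
     + heat_symbol v * xderiv u s B + heat_symbol u * xderiv v s B + heat_symbol u * heat_symbol v * s B)" for u v
    using xderiv_lmult[of u "heat_symbol v" s]
    by (simp add: xderiv_heat_def xderiv_add lmult_def fun_eq_iff distrib_left mult.assoc)
  note exp = this
  show ?thesis
    unfolding exp[of u v] exp[of v u] xderiv_commute[of u v] heat_symbol_mult_commute[of u v]
    by (simp only: ac_simps)
qed

text \<open>The cancellation of \<open>heat_phi_commute\<close> on the level of series:
  differentiating the \<open>x\<close>-factors of \<open>yop\<close> gives \<open>heat_deriv\<close>
  with the coefficient -2, which is also what moving \<open>heat_symbol u\<close> past
  \<open>weyl_der i\<close> leaves.\<close>

lemma xderiv_heat_yop: "xderiv_heat u (yop i s) = yop i (xderiv_heat u s)"
proof
  fix B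
  let ?S = "\<lambda>f. \<Sum>k\<in>UNIV. weyl_var k * f k"
  have hd: "?S (\<lambda>k. if u = Upair i k then s B else 0) = heat_deriv u i * s B"
    unfolding heat_deriv_def sum_distrib_right by (intro sum.cong) auto
  have "xderiv u (yop i s) = (\<lambda>B. - lmult (weyl_der i) (xderiv u s) B
      - 2 * (\<Sum>k\<in>UNIV. lmult (weyl_var k) (xderiv u (xshift (Upair i k) s)) B))"
    by (simp only: yop_alt xderiv_diff xderiv_uminus xderiv_two xderiv_sum xderiv_lmult)
  then have "xderiv u (yop i s) B = - (weyl_der i * xderiv u s B)
      - 2 * ?S (\<lambda>k. xshift (Upair i k) (xderiv u s) B) - 2 * (heat_deriv u i * s B)"
    unfolding hd[symmetric] by (simp add: xderiv_xshift lmult_def distrib_left sum.distrib)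
  moreover have "heat_symbol u * yop i s B = - (heat_symbol u * weyl_der i * s B)
      - 2 * ?S (\<lambda>k. xshift (Upair i k) (lmult (heat_symbol u) s) B)"
  proof -
    have "heat_symbol u * yop i s B = - (heat_symbol u * (weyl_der i * s B))
        - 2 * (\<Sum>k\<in>UNIV. heat_symbol u * (weyl_var k * xshift (Upair i k) s B))"
      using fun_cong[OF lmult_yop[of "heat_symbol u" i s], of B] by (simp add: lmult_def)
    moreover have "heat_symbol u * (weyl_var k * P) = weyl_var k * (heat_symbol u * P)" for k P
      by (simp add: heat_symbol_var_commute flip: mult.assoc)
    ultimately show ?thesis by (simp add: mult.assoc xshift_lmult) (simp add: lmult_def)
  qed
  moreover have "yop i (xderiv_heat u s) B = - (weyl_der i * xderiv u s B) - weyl_der i * heat_symbol u * s B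
      - 2 * ?S (\<lambda>k. xshift (Upair i k) (xderiv u s) B)
      - 2 * ?S (\<lambda>k. xshift (Upair i k) (lmult (heat_symbol u) s) B)"
  proof -
    have "xderiv_heat u s = (\<lambda>B. xderiv u s B + lmult (heat_symbol u) s B)"
      by (simp add: xderiv_heat_def lmult_def)
    then show ?thesis
      by (simp add: yop_alt xshift_add lmult_def[of "weyl_var _"] lmult_def[of "weyl_der _"]
          distrib_left sum.distrib mult.assoc) (simp add: lmult_def)
  qed
  ultimately show "xderiv_heat u (yop i s) B = yop i (xderiv_heat u s) B"
    by (simp add: xderiv_heat_def der_heat_symbol distrib_right mult.assoc)
qed

lemma var_yop:
  "lmult (weyl_var i) (yop j s) = (\<lambda>B. yop j (lmult (weyl_var i) s) B + (if i = j then s B else 0))"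
proof
  fix B
  have "weyl_var i * (weyl_var k * P) = weyl_var k * (weyl_var i * P)" for k and P :: "'a weyl"
    by (simp add: weyl_relations(1)[of i k] flip: mult.assoc)
  moreover have "weyl_der j * (weyl_var i * s B) = weyl_var i * (weyl_der j * s B) + (if i = j then s B else 0)"
  proof -
    have "weyl_der j * (weyl_var i * s B) = (weyl_der j * weyl_var i) * s B" by (simp only: mult.assoc)
    then show ?thesis by (auto simp: weyl_relations(3) distrib_right mult.assoc)
  qed
  ultimately show "lmult (weyl_var i) (yop j s) B = yop j (lmult (weyl_var i) s) B + (if i = j then s B else 0)"
    unfolding lmult_yop by (cases "i = j") (simp_all add: yop_alt xshift_lmult, simp_all add: lmult_def)
qed

lemma series_act_add:
  "series_act a (\<lambda>B. s B + t B) = (\<lambda>B. series_act a s B + series_act a t B)"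
proof (induction a arbitrary: s t)
  case (WVar v)
  have "yop i (\<lambda>B. s B + t B) = (\<lambda>B. yop i s B + yop i t B)" for i
    by (simp add: yop_alt lmult_def xshift_add distrib_left sum.distrib algebra_simps)
  then show ?case by (simp add: xshift_add split: sum.splits)
next
  case (WDer v)
  then show ?case
    by (auto simp: xderiv_heat_def xderiv_add lmult_def distrib_left fun_eq_iff ac_simps split: sum.splits)
qed (simp_all add: lmult_def distrib_left ac_simps)

lemma series_act_const:
  "series_act a (lmult (weyl_const c) s) = lmult (weyl_const c) (series_act a s)"
proof (induction a arbitrary: s)
  case (WVar v)
  have cc: "q * (weyl_const c * P) = weyl_const c * (q * P)" for q P :: "'a weyl"
    by (metis weyl_const_central mult.assoc)
  have "yop i (lmult (weyl_const c) s) = lmult (weyl_const c) (yop i s)" for i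
    unfolding lmult_yop by (simp add: yop_alt xshift_lmult) (simp add: lmult_def cc)
  then show ?case by (simp add: xshift_lmult split: sum.splits)
next
  case (WDer v)
  have cc: "q * (weyl_const c * P) = weyl_const c * (q * P)" for q P :: "'a weyl"
    by (metis weyl_const_central mult.assoc)
  show ?case
    by (simp add: xderiv_heat_def xderiv_lmult split: sum.splits) (simp add: lmult_def cc distrib_left)
next
  case (WConst c')
  then show ?case by (simp add: lmult_lmult weyl_const_central[of c' "weyl_const c"])
qed (simp_all add: lmult_def distrib_left)

lemma series_act_weq: "weq a b \<Longrightarrow> series_act a = series_act b"
proof (induction rule: weq.induct)
  case (weq_distrib_left a b c)
  show ?case by (simp add: fun_eq_iff series_act_add)
next
  case (weq_const_central c a)
  show ?case by (simp add: fun_eq_iff series_act_const)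
next
  case (weq_add_uminus a)
  have "weyl_const (- 1) = (- 1 :: 'a weyl)"
    unfolding eq_neg_iff_add_eq_0 by (simp flip: weyl_const_simps(2,3) add: weyl_const_simps(1))
  then show ?case by (simp add: fun_eq_iff lmult_def weyl_const_simps(1))
next
  case (weq_mul a b c e)
  then show ?case by (intro ext) simp
next
  case (weq_const_mul c e)
  show ?case by (simp add: fun_eq_iff lmult_def weyl_const_simps(4) mult.assoc)
next
  case (weq_const_add c e)
  show ?case by (simp add: fun_eq_iff lmult_def weyl_const_simps(3) distrib_right)
next
  case (weq_var_commute i j)
  show ?case
    by (intro ext, cases i; cases j) (simp_all add: xshift_commute yop_commute xshift_yop)
next
  case (weq_der_commute i j)
  have "xderiv_heat u (lmult (weyl_var k) s) = lmult (weyl_var k) (xderiv_heat u s)" for u k and s :: "'a xseries"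
  proof -
    have "heat_symbol u * (weyl_var k * P) = weyl_var k * (heat_symbol u * P)" for P
      by (simp add: heat_symbol_var_commute flip: mult.assoc)
    then show ?thesis by (simp add: xderiv_heat_def xderiv_lmult) (simp add: lmult_def distrib_left)
  qed
  then show ?case
    by (intro ext, cases i; cases j) (simp_all add: xderiv_heat_commute lmult_lmult weyl_relations(1))
next
  case (weq_der_var i j)
  show ?case
    by (intro ext, cases i; cases j) (simp_all add: xderiv_heat_xshift xderiv_heat_yop var_yop
      xshift_lmult, simp_all add: lmult_def weyl_const_simps)
next
  case (weq_add_commute a b)
  show ?case by (intro ext) (simp add: add.commute)
next
  case (weq_add_assoc a b c)
  show ?case by (intro ext) (simp add: add.assoc)
next
  case (weq_sym a b)
  then show ?case by simp
next
  case (weq_trans a b c)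
  then show ?case by simp
next
  case (weq_add a b c e)
  then show ?case by (intro ext) simp
next
  case (weq_mul_assoc a b c)
  show ?case by (intro ext) simp
qed (simp_all add: fun_eq_iff lmult_def weyl_const_simps)

section \<open>Growth of the Hilbert function\<close>

lift_definition weyl_series :: "'d::finite xy weyl \<Rightarrow> 'd xseries \<Rightarrow> 'd xseries" is series_act
  by (rule series_act_weq)

lemma weyl_series_simps:
  "weyl_series (P + Q) s = (\<lambda>B. weyl_series P s B + weyl_series Q s B)"
  "weyl_series (P * Q) s = weyl_series P (weyl_series Q s)"
  "weyl_series (weyl_const c) s = lmult (weyl_const c) s"
  "weyl_series (weyl_var (Inl u)) s = xshift u s"
  "weyl_series (weyl_var (Inr i)) s = yop i s"
  "weyl_series (weyl_der (Inl u)) s = xderiv_heat u s"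
  "weyl_series (weyl_der (Inr i)) s = lmult (weyl_var i) s"
  by (transfer; simp)+

lemma weyl_series_additive:
  "weyl_series 0 s = (\<lambda>B. 0)"
  "weyl_series 1 s = s"
  "weyl_series (- P) s = (\<lambda>B. - weyl_series P s B)"
  "weyl_series (P - Q) s = (\<lambda>B. weyl_series P s B - weyl_series Q s B)"
  "weyl_series (weyl_scale c P) s = (\<lambda>B. weyl_scale c (weyl_series P s B))"
  "weyl_series (sum h K) s = (\<lambda>B. \<Sum>k\<in>K. weyl_series (h k) s B)"
proof -
  show 0: "weyl_series 0 s = (\<lambda>B. 0)"
    using weyl_series_simps(3)[of 0 s] by (simp add: weyl_const_simps lmult_def)
  show "weyl_series 1 s = s"
    using weyl_series_simps(3)[of 1 s] by (simp add: weyl_const_simps lmult_def)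
  show m: "weyl_series (- P) s = (\<lambda>B. - weyl_series P s B)" for P
    using weyl_series_simps(1)[of "- P" P s] by (simp add: 0 fun_eq_iff eq_neg_iff_add_eq_0)
  show "weyl_series (P - Q) s = (\<lambda>B. weyl_series P s B - weyl_series Q s B)"
    using weyl_series_simps(1)[of P "- Q" s] by (simp add: m)
  show "weyl_series (weyl_scale c P) s = (\<lambda>B. weyl_scale c (weyl_series P s B))"
    by (simp add: weyl_scale_def weyl_series_simps lmult_def)
  show "weyl_series (sum h K) s = (\<lambda>B. \<Sum>k\<in>K. weyl_series (h k) s B)"
    by (induction K rule: infinite_finite_induct) (simp_all add: 0 weyl_series_simps)
qed

lemma weyl_series_phi: "weyl_series (phi Q) s = lmult Q s"
proof -
  have der: "weyl_series (phi (weyl_der i)) s = lmult (weyl_der i) s" for i s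
    by (simp add: phi_morphism(5) weyl_series_additive weyl_series_simps mult_2 yop_def lmult_def
        xshift_lmult[unfolded lmult_def] sum.distrib)
  have "weyl_series (phi_expr a) s = lmult (abs_weyl a) s" for a s
  proof (induction a arbitrary: s)
    case (WDer i)
    have "phi_expr (WDer i) = phi (weyl_der i)" by (simp add: phi_morphism)
    then have "weyl_series (phi_expr (WDer i)) s = lmult (weyl_der i) s" by (simp only: der)
    then show ?case by (simp only: weyl_der.abs_eq)
  qed (simp_all add: weyl_series_simps lmult_lmult weyl_const.abs_eq[symmetric] weyl_var.abs_eq[symmetric]
      plus_weyl.abs_eq[symmetric] times_weyl.abs_eq[symmetric], simp add: lmult_def distrib_right)
  then show ?thesis by (induction Q rule: weyl.abs_induct) (simp add: phi.abs_eq)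
qed

definition single :: "'d uprod multiset \<Rightarrow> 'd weyl \<Rightarrow> 'd::finite xseries" where
  "single A Q = (\<lambda>B. if B = A then Q else 0)"

lemma single_apply: "single A Q B = (if B = A then Q else 0)"
  by (simp add: single_def)

lemma weyl_series_xmon: "weyl_series (xmon A) (single {#} Q) = single A Q"
proof (induction A)
  case (add u A)
  have "xshift u (single A Q) = single (add_mset u A) Q"
    by (auto simp: xshift_def single_def fun_eq_iff)
  then show ?case by (simp add: weyl_series_simps add)
qed (simp add: weyl_series_additive)

lemma weyl_series_normal_form: "weyl_series (xmon A * phi Q) (single {#} 1) = single A Q"
proof -
  have "lmult Q (single {#} 1) = single {#} Q" by (auto simp: lmult_def single_def)
  then show ?thesis by (simp add: weyl_series_simps weyl_series_phi weyl_series_xmon)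
qed

lemma weyl_series_heat: "weyl_series (heat u) (single {#} 1) = (\<lambda>B. 0)"
  by (auto simp: heat_def weyl_series_additive weyl_series_simps weyl_series_phi xderiv_heat_def
      xderiv_def lmult_def single_def)

text \<open>All operators act on coefficients by left multiplication and integral combinations, so
  the series with coefficients in a left ideal form a submodule.\<close>

lemma weyl_series_ideal:
  assumes I: "left_ideal I" and s: "\<And>B. s B \<in> I"
  shows "weyl_series P s B \<in> I"
proof -
  have mult: "q * a \<in> I" and add: "a + b \<in> I" if "a \<in> I" "b \<in> I" for q a b
    using I that unfolding left_ideal_def by blast+
  have zero: "0 \<in> I" using I unfolding left_ideal_def by blast
  have sum: "sum h K \<in> I" if "\<And>k. h k \<in> I" for h :: "'a \<Rightarrow> 'a weyl" and K
    by (induction K rule: infinite_finite_induct) (use that s add zero in auto)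
  have "series_act a s B \<in> I" for a
    using s
  proof (induction a arbitrary: s B)
    case (WVar v)
    have x: "xshift u s B \<in> I" if "\<And>B. s B \<in> I" for u B s
      using that zero by (simp add: xshift_def)
    have "yop i s B \<in> I" for i
      unfolding yop_def using WVar
      by (intro left_ideal_diff[OF I] left_ideal_uminus[OF I] mult sum x) (auto simp: lmult_def intro: mult)
    then show ?case using x WVar by (auto split: sum.splits)
  next
    case (WDer v)
    then show ?case
      by (auto simp: xderiv_heat_def xderiv_def lmult_def simp del: of_nat_Suc intro!: add mult split: sum.splits)
  qed (auto simp: lmult_def intro: mult add)
  then show ?thesis by (transfer fixing: I s B) blast
qed

lemma phi_ideal_series:
  assumes "P \<in> phi_ideal A"
  shows "weyl_series P (single {#} 1) B \<in> left_ideal hull A"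
proof -
  let ?I = "left_ideal hull A"
  let ?J = "{P. \<forall>B. weyl_series P (single {#} 1) B \<in> ?I}"
  have I: "left_ideal ?I" by (rule left_ideal_hull)
  have "left_ideal ?J"
    unfolding left_ideal_def[of ?J]
    using I weyl_series_ideal[OF I] unfolding left_ideal_def[of ?I]
    by (auto simp: weyl_series_additive weyl_series_simps)
  moreover have "phi ` A \<union> heat_ops \<subseteq> ?J"
  proof -
    have "0 \<in> ?I" using I unfolding left_ideal_def by blast
    then show ?thesis
      using hull_subset[of A left_ideal]
      by (auto simp: heat_ops_eq weyl_series_heat weyl_series_phi) (auto simp: lmult_def single_def)
  qed
  ultimately have "phi_ideal A \<subseteq> ?J" unfolding phi_ideal_def by (rule hull_minimal[rotated])
  then show ?thesis using assms by blast
qed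

text \<open>The doubling comes from the products of an \<open>x\<close>-variable and a
  \<open>y\<close>-derivative in \<open>phi (weyl_der i)\<close>. With a monomial of degree up to
  \<open>k\<close> in \<open>x\<close> in front, the degree becomes at most
  \<open>3 * k\<close>.\<close>

lemma phi_bernstein: "phi ` bernstein k \<subseteq> (bernstein (2 * k) :: 'd::finite xy weyl set)"
proof -
  have "bernstein k \<subseteq> {Q :: 'd weyl. phi Q \<in> bernstein (2 * k)}"
  proof (rule bernstein_induct[where V = "\<lambda>m. {Q. phi Q \<in> bernstein m}"])
    show "weyl.subspace {Q. phi Q \<in> bernstein m}" for m
      using subspace_bernstein[of m] unfolding weyl.subspace_def
      by (auto simp: phi_simps phi_morphism)
    show "{Q. phi Q \<in> bernstein m} \<subseteq> {Q. phi Q \<in> bernstein (Suc m)}" for m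
      using bernstein_mono[of m "Suc m"] by auto
    show "1 \<in> {Q. phi Q \<in> bernstein 0}" by (simp add: phi_simps one_bernstein)
    fix z m and P :: "'d weyl" assume "P \<in> {Q. phi Q \<in> bernstein m}"
    then have P: "phi P \<in> bernstein m" by simp
    have g1: "gen w * phi P \<in> bernstein (m + 2)" for w
      using gen_bernstein[OF P] bernstein_mono[of "Suc m" "m + 2"] by auto
    have g2: "gen w * (gen w' * phi P) \<in> bernstein (m + 2)" for w w'
      using gen_bernstein[OF gen_bernstein[OF P]] by simp
    note sub = subspace_bernstein[of "m + 2"]
    show "gen z * P \<in> {Q. phi Q \<in> bernstein (m + 2)}"
    proof (cases z)
      case (Inl i)
      then show ?thesis using g1[of "Inr (yvar i)"] by (simp add: gen_def phi_morphism)
    next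
      case (Inr i)
      have "phi (gen z * P) = - (gen (Inl (yvar i)) * phi P)
          - weyl_scale 2 (\<Sum>k\<in>UNIV. gen (Inl (xvar i k)) * (gen (Inr (yvar k)) * phi P))"
        using weyl_const_of_nat[of 2, where 'a = "'d xy"]
        by (simp add: Inr gen_def phi_morphism weyl_scale_def left_diff_distrib sum_distrib_right mult.assoc)
      also have "\<dots> \<in> bernstein (m + 2)"
        by (intro weyl.subspace_diff[OF sub] weyl.subspace_neg[OF sub] weyl.subspace_scale[OF sub]
            weyl.subspace_sum[OF sub] g1 g2)
      finally show ?thesis by simp
    qed
  qed
  then show ?thesis by blast
qed

lemma xmon_bernstein: "P \<in> bernstein m \<Longrightarrow> xmon A * P \<in> bernstein (size A + m)"
proof (induction A)
  case (add u A)
  have "gen (Inl (Inl u)) * (xmon A * P) \<in> bernstein (Suc (size A + m))"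
    using add by (intro gen_bernstein)
  then show ?case by (simp add: gen_def mult.assoc)
qed simp

lemma bernstein_complement:
  fixes I :: "'v::finite weyl set"
  assumes "left_ideal I"
  shows "\<exists>C. C \<subseteq> bernstein k \<and> finite C \<and> card C = hilbert_function I k \<and>
    bernstein k \<subseteq> weyl.span (bernstein k \<inter> I \<union> C) \<and>
    (\<forall>c. (\<Sum>x\<in>C. weyl_scale (c x) x) \<in> bernstein k \<inter> I \<longrightarrow> (\<forall>x\<in>C. c x = 0))"
proof -
  have sub: "weyl.subspace (bernstein k \<inter> I)"
    by (intro weyl.subspace_inter subspace_bernstein subspace_left_ideal assms)
  have span: "bernstein k \<subseteq> weyl.span (wmon ` mons k :: 'v weyl set)" by (simp add: bernstein_eq)
  have fin: "finite (wmon ` mons k :: 'v weyl set)" by (simp add: finite_mons)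
  show ?thesis
    unfolding hilbert_function_def
    by (rule weyl.complement_exists[OF sub inf_le1 span fin]) blast
qed

text \<open>The products \<open>xmon B * phi r\<close>, with \<open>r\<close> in a basis of the
  \<open>k\<close>-th step of D_t modulo I, lie in \<open>bernstein (3 * k)\<close>; they are shown
  to be independent modulo J.\<close>

lemma hilbert_function_lower:
  fixes A :: "'d::finite weyl set"
  shows "card {B :: 'd uprod multiset. size B \<le> k} * hilbert_function (left_ideal hull A) k
    \<le> hilbert_function (phi_ideal A) (3 * k)"
proof -
  let ?I = "left_ideal hull A" and ?J = "phi_ideal A" and ?X = "{B :: 'd uprod multiset. size B \<le> k}"
  from bernstein_complement[OF left_ideal_hull[of A], of k] obtain C
    where C: "C \<subseteq> bernstein k" "finite C" "card C = hilbert_function ?I k"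
      "\<forall>c. (\<Sum>x\<in>C. weyl_scale (c x) x) \<in> bernstein k \<inter> ?I \<longrightarrow> (\<forall>x\<in>C. c x = 0)"
    by (elim exE conjE)
  have X: "finite ?X" using finite_multisets_le[of "UNIV :: 'd uprod set" k] by simp
  let ?e = "\<lambda>(B, r). xmon B * phi r"
  have "card (?X \<times> C) \<le> weyl.dim (bernstein (3 * k) :: 'd xy weyl set) - weyl.dim (bernstein (3 * k) \<inter> ?J)"
  proof (rule weyl.card_le_dim_diff[where e = ?e and F = "wmon ` mons (3 * k)"])
    show "weyl.subspace (bernstein (3 * k) \<inter> ?J)"
      by (intro weyl.subspace_inter subspace_bernstein subspace_left_ideal left_ideal_phi_ideal)
    show "finite (?X \<times> C)" using X C(2) by simp
    show "?e ` (?X \<times> C) \<subseteq> bernstein (3 * k)"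
    proof clarify
      fix B r assume B: "size (B :: 'd uprod multiset) \<le> k" and r: "r \<in> C"
      have "phi r \<in> bernstein (2 * k)" using phi_bernstein r C(1) by blast
      then have "xmon B * phi r \<in> bernstein (size B + 2 * k)" by (rule xmon_bernstein)
      then show "xmon B * phi r \<in> bernstein (3 * k)"
        using bernstein_mono[of "size B + 2 * k" "3 * k"] B by auto
    qed
    fix c K assume "(\<Sum>K\<in>?X \<times> C. weyl_scale (c K) (?e K)) \<in> bernstein (3 * k) \<inter> ?J" and K: "K \<in> ?X \<times> C"
    then have sumJ: "(\<Sum>K\<in>?X \<times> C. weyl_scale (c K) (?e K)) \<in> ?J" by simp
    obtain B r where Br: "K = (B, r)" "B \<in> ?X" "r \<in> C" using K by blast
    \<comment> \<open>The coefficient at \<open>B\<close> of the image of the constant series 1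
      keeps only the summands with this \<open>B\<close>, which leaves a relation between the
      elements of \<open>C\<close> modulo I.\<close>
    have "weyl_series (\<Sum>K\<in>?X \<times> C. weyl_scale (c K) (?e K)) (single {#} 1) B
        = (\<Sum>(B', r)\<in>?X \<times> C. if B' = B then weyl_scale (c (B, r)) r else 0)"
      unfolding weyl_series_additive
      by (intro sum.cong) (auto simp: weyl_series_normal_form single_apply)
    also have "\<dots> = (\<Sum>B'\<in>?X. if B' = B then \<Sum>r\<in>C. weyl_scale (c (B, r)) r else 0)"
      unfolding sum.cartesian_product[symmetric] by (intro sum.cong) auto
    also have "\<dots> = (\<Sum>r\<in>C. weyl_scale (c (B, r)) r)"
      using X Br(2) by simp
    finally have "(\<Sum>r\<in>C. weyl_scale (c (B, r)) r) \<in> ?I"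
      using phi_ideal_series[OF sumJ, of B] by simp
    moreover have "(\<Sum>r\<in>C. weyl_scale (c (B, r)) r) \<in> bernstein k"
      using C(1) by (intro weyl.subspace_sum weyl.subspace_scale subspace_bernstein) auto
    ultimately show "c K = 0" using C(4)[rule_format, of "\<lambda>r. c (B, r)"] Br by simp
  qed (auto simp: bernstein_eq finite_mons)
  then show ?thesis by (simp add: card_cartesian_product C(3) hilbert_function_def)
qed

text \<open>After reduction to normal forms of index \<open>2 * k\<close>, the factor
  \<open>Q\<close> is reduced modulo I to the span of \<open>C\<close>; the part in I is sent by
  \<open>phi\<close> into J. Hence the products of \<open>x\<close>-monomials and \<open>phi\<close>
  \<open>C\<close> span modulo J.\<close>

lemma hilbert_function_upper:
  fixes A :: "'d::finite weyl set"
  shows "hilbert_function (phi_ideal A) k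
    \<le> card {B :: 'd uprod multiset. size B \<le> 2 * k} * hilbert_function (left_ideal hull A) (2 * k)"
proof -
  let ?I = "left_ideal hull A" and ?J = "phi_ideal A" and ?X = "{B :: 'd uprod multiset. size B \<le> 2 * k}"
  from bernstein_complement[OF left_ideal_hull[of A], of "2 * k"] obtain C
    where C: "C \<subseteq> bernstein (2 * k)" "finite C" "card C = hilbert_function ?I (2 * k)"
      "bernstein (2 * k) \<subseteq> weyl.span (bernstein (2 * k) \<inter> ?I \<union> C)"
    by (elim exE conjE)
  have X: "finite ?X" using finite_multisets_le[of "UNIV :: 'd uprod set" "2 * k"] by simp
  define S where "S = (\<lambda>(B, r). xmon B * phi r) ` (?X \<times> C)"
  have S: "finite S" "card S \<le> card ?X * card C"
    using X C(2) card_image_le[of "?X \<times> C" "\<lambda>(B, r). xmon B * phi r"]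
    by (simp_all add: S_def card_cartesian_product)
  have red: "xmon B * phi Q \<in> weyl.span (?J \<union> S)" if B: "B \<in> ?X" and Q: "Q \<in> bernstein (2 * k)" for B Q
  proof -
    have "Q \<in> weyl.span (bernstein (2 * k) \<inter> ?I \<union> C)" using Q C(4) by blast
    then show ?thesis
    proof (induction rule: weyl.span_induct_alt)
      case base
      show ?case by (simp add: phi_simps weyl.span_zero)
    next
      case (step c x y)
      have "xmon B * phi x \<in> weyl.span (?J \<union> S)"
        using step(1)
      proof
        assume "x \<in> bernstein (2 * k) \<inter> ?I"
        then have "phi x \<in> ?J" using phi_ideal_phi by blast
        then have "xmon B * phi x \<in> ?J" using left_ideal_phi_ideal[of A] unfolding left_ideal_def by blast
        then show ?thesis by (intro weyl.span_base) blast
      next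
        assume "x \<in> C"
        then have "xmon B * phi x \<in> S" unfolding S_def using B by (intro image_eqI[of _ _ "(B, x)"]) auto
        then show ?thesis by (intro weyl.span_base) blast
      qed
      then have "weyl_scale c (xmon B * phi x) + xmon B * phi y \<in> weyl.span (?J \<union> S)"
        using step(2) by (intro weyl.span_add weyl.span_scale)
      then show ?case by (simp add: phi_morphism phi_simps distrib_left weyl_scale_mult_right)
    qed
  qed
  have "bernstein k \<subseteq> normal_forms A (2 * k)" by (rule bernstein_normal_forms)
  also have "\<dots> \<subseteq> weyl.span (?J \<union> S)"
    unfolding normal_forms_def
    by (rule weyl.span_minimal) (use red weyl.span_superset[of "?J \<union> S"] in auto)
  finally have sub: "bernstein k \<subseteq> weyl.span (?J \<union> S)" .
  have "hilbert_function ?J k \<le> card S"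
    unfolding hilbert_function_def
    by (rule weyl.dim_diff_inter_le_card[OF subspace_left_ideal[OF left_ideal_phi_ideal] subspace_bernstein _ _ S(1) sub,
          of "wmon ` mons k"]) (simp_all add: bernstein_eq finite_mons)
  then show ?thesis using S(2) C(3) by simp
qed

lemma holonomic_phi_ideal:
  fixes A :: "'d::finite weyl set"
  assumes hol: "holonomic_ideal (left_ideal hull A)"
  shows "holonomic_ideal (phi_ideal A)"
proof (cases "left_ideal hull A = UNIV")
  \<comment> \<open>The zero module is a clause of its own in \<open>holonomic_ideal\<close>. It is
    inherited, since \<open>phi 1 = 1\<close> then lies in J.\<close>
  case True
  then have "phi 1 \<in> phi_ideal A" by (intro phi_ideal_phi) simp
  then have "P * 1 \<in> phi_ideal A" for P
    using left_ideal_phi_ideal[of A] unfolding left_ideal_def by (metis phi_simps(2))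
  then have "phi_ideal A = UNIV" by auto
  then show ?thesis unfolding holonomic_ideal_def using left_ideal_phi_ideal by blast
next
  case False
  let ?d = "CARD('d)" and ?N = "CARD('d uprod)"
  let ?HI = "hilbert_function (left_ideal hull A)" and ?HJ = "hilbert_function (phi_ideal A)"
  obtain p :: "rat poly" where p: "degree p = ?d"
    "\<forall>\<^sub>F k in sequentially. of_nat (?HI k) = poly p (of_nat k)"
    using hol False unfolding holonomic_ideal_def by blast
  have "p \<noteq> 0" using p(1) by auto
  then obtain C where C: "\<forall>\<^sub>F k in sequentially. ?HI k \<le> C * k ^ ?d \<and> k ^ ?d \<le> C * ?HI k"
    using poly_growth[OF p(2)] p(1) by auto
  have subseq: "filterlim (\<lambda>m. b * m) sequentially sequentially" if "b > 0" for b :: nat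
    using that by (intro filterlim_subseq strict_monoI) simp
  obtain q :: "rat poly" where q: "\<forall>\<^sub>F k in sequentially. of_nat (?HJ k) = poly q (of_nat k)"
    using eventually_poly_hilbert_function[OF left_ideal_phi_ideal] unfolding eventually_poly_def by blast
  \<comment> \<open>In the upper bound the base 3 comes from \<open>2 * k + 1 \<le> 3 * k\<close>
    and the base 2 from evaluating the Hilbert function of I at \<open>2 * k\<close>. In the lower
    bound the argument is multiplied by \<open>?N\<close> so that a box of exponents up to
    \<open>m\<close> fits, and by 3 for \<open>hilbert_function_lower\<close>. The exponent is the
    number of all variables in D_xy.\<close>
  have "degree q = ?N + ?d"
  proof (rule degree_eq_of_growth[OF q])
    show "\<forall>\<^sub>F k in sequentially. ?HJ k \<le> (3 ^ ?N * C * 2 ^ ?d) * k ^ (?N + ?d)"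
      using eventually_compose_filterlim[OF C subseq[of 2, simplified]] eventually_ge_at_top[of 1]
    proof eventually_elim
      case (elim k)
      have "?HJ k \<le> card {B :: 'd uprod multiset. size B \<le> 2 * k} * ?HI (2 * k)"
        by (rule hilbert_function_upper)
      also have "\<dots> \<le> (2 * k + 1) ^ ?N * (C * (2 * k) ^ ?d)"
        using elim by (intro mult_mono card_multisets_le_upper) auto
      also have "\<dots> \<le> (3 * k) ^ ?N * (C * (2 * k) ^ ?d)"
        using elim by (intro mult_right_mono power_mono) auto
      finally show ?case by (simp add: power_mult_distrib power_add mult_ac)
    qed
    show "\<forall>\<^sub>F m in sequentially. m ^ (?N + ?d) \<le> C * ?HJ ((3 * ?N) * m)"
      using eventually_compose_filterlim[OF C subseq[of ?N]]
    proof (rule eventually_mono)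
      fix m assume m: "?HI (?N * m) \<le> C * (?N * m) ^ ?d \<and> (?N * m) ^ ?d \<le> C * ?HI (?N * m)"
      have "m ^ (?N + ?d) = m ^ ?N * m ^ ?d" by (simp add: power_add)
      also have "\<dots> \<le> (m + 1) ^ ?N * (?N * m) ^ ?d"
        by (intro mult_mono power_mono) auto
      also have "\<dots> \<le> card {B :: 'd uprod multiset. size B \<le> ?N * m} * (C * ?HI (?N * m))"
        using m by (intro mult_mono card_multisets_le_lower) auto
      also have "\<dots> = C * (card {B :: 'd uprod multiset. size B \<le> ?N * m} * ?HI (?N * m))" by simp
      also have "\<dots> \<le> C * ?HJ (3 * (?N * m))"
        by (intro mult_left_mono hilbert_function_lower) simp
      finally show "m ^ (?N + ?d) \<le> C * ?HJ ((3 * ?N) * m)" by (simp add: mult.assoc)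
    qed simp
  qed simp
  then show ?thesis
    unfolding holonomic_ideal_def using left_ideal_phi_ideal q by auto
qed

section \<open>Perturbations of the Gaussian kernel\<close>

lemma hfun_eq:
  "hfun p t = (\<Sum>i\<in>UNIV. \<Sum>j\<in>UNIV. p $ xvar i j * t $ i * t $ j) + (\<Sum>i\<in>UNIV. p $ yvar i * t $ i)"
  by (simp add: hfun_def xmat_def yvec_def)

lemma linear_hfun: "linear (\<lambda>p. hfun p t)"
  by (rule linearI) (simp_all add: hfun_eq distrib_right sum.distrib sum_distrib_left distrib_left mult_ac)

lemma hfun_simps: "hfun 0 t = 0" "hfun (p + q) t = hfun p t + hfun q t"
  using linear_0[OF linear_hfun] linear_add[OF linear_hfun] by auto

text \<open>As \<open>hfun\<close> is linear in \<open>p\<close>, this is the factor by which the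
  derivative in the coordinate \<open>v\<close> multiplies the kernel.\<close>

definition symbol :: "'d xy \<Rightarrow> real^'d::finite \<Rightarrow> real" where
  "symbol v t = hfun (axis v 1) t"

lemma hfun_expand: "hfun h t = (\<Sum>v\<in>UNIV. h $ v * symbol v t)"
proof -
  have "h = (\<Sum>v\<in>UNIV. (h $ v) *\<^sub>R axis v 1)"
    by (simp add: vec_eq_iff axis_def if_distrib[of "\<lambda>x. _ * x"] cong: if_cong)
  then have "hfun h t = (\<Sum>v\<in>UNIV. hfun ((h $ v) *\<^sub>R axis v 1) t)"
    using linear_sum[OF linear_hfun, of "\<lambda>v. (h $ v) *\<^sub>R axis v 1" UNIV t] by simp
  then show ?thesis by (simp add: linear_cmul[OF linear_hfun] symbol_def)
qed

lemma symbol_y: "symbol (yvar k) t = t $ k"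
  by (simp add: symbol_def hfun_eq axis_def if_distrib[of "\<lambda>x. x * _"] cong: if_cong)

lemma symbol_x: "symbol (xvar i j) t = (if i = j then 1 else 2) * (t $ i * t $ j)"
proof -
  have eq: "(axis (xvar i j) 1 :: real^('a xy)) $ xvar k l =
      (if k = i then if l = j then 1 else 0 else 0) + (if i = j then 0 else if k = j then if l = i then 1 else 0 else 0)" for k l
    by (auto simp: axis_def)
  have outer: "(\<Sum>l\<in>UNIV. if b then f l else 0) = (if b then sum f UNIV else 0)" for b and f :: "'a \<Rightarrow> real"
    by simp
  show ?thesis
    unfolding symbol_def hfun_eq eq
    by (simp add: axis_def distrib_right sum.distrib outer if_distrib[of "\<lambda>x. x * _"] cong: if_cong)
qed

lemma symbol_cases:
  obtains (y) k where "v = yvar k" "\<And>t. symbol v t = t $ k"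
  | (x) i j c where "v = xvar i j" "0 \<le> c" "c \<le> 2" "\<And>t. symbol v t = c * (t $ i * t $ j)"
proof (cases v)
  case (Inl u)
  then show ?thesis
  proof (cases u)
    case (Upair i j)
    show ?thesis
      by (rule x[of i j "if i = j then 1 else 2"]) (use Inl Upair in \<open>simp_all add: symbol_x\<close>)
  qed
next
  case (Inr k)
  then show ?thesis using y symbol_y by blast
qed

lemma abs_symbol_le: "\<bar>symbol v t\<bar> \<le> 2 * (1 + norm t)\<^sup>2"
proof (cases v rule: symbol_cases)
  case (y k)
  have "\<bar>t $ k\<bar> \<le> norm t" by (rule component_le_norm_cart)
  also have "\<dots> \<le> 2 * (1 + norm t)\<^sup>2" by (simp add: power2_eq_square algebra_simps)
  finally show ?thesis unfolding y(2) .
next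
  case (x i j c)
  have "\<bar>t $ i\<bar> * \<bar>t $ j\<bar> \<le> norm t * norm t" by (intro mult_mono component_le_norm_cart) auto
  then have "c * (\<bar>t $ i\<bar> * \<bar>t $ j\<bar>) \<le> 2 * (norm t * norm t)"
    by (rule mult_mono[OF x(3)]) auto
  also have "\<dots> \<le> 2 * (1 + norm t)\<^sup>2" by (simp add: power2_eq_square algebra_simps)
  finally show ?thesis unfolding x(4) using x(2) by (simp add: abs_mult)
qed

lemma abs_hfun_le: "\<bar>hfun (h :: real^('d::finite xy)) t\<bar> \<le> 2 * CARD('d xy) * norm h * (1 + norm t)\<^sup>2"
proof -
  have "\<bar>hfun h t\<bar> \<le> (\<Sum>v\<in>UNIV. \<bar>h $ v\<bar> * \<bar>symbol v t\<bar>)"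
    unfolding hfun_expand abs_mult[symmetric] by (rule sum_abs)
  also have "\<dots> \<le> (\<Sum>v\<in>(UNIV :: 'd xy set). norm h * (2 * (1 + norm t)\<^sup>2))"
    by (intro sum_mono mult_mono component_le_norm_cart abs_symbol_le) auto
  finally show ?thesis by (simp only: sum_constant mult_ac of_nat_mult of_nat_numeral)
qed

lemma quadratic_form: "t \<bullet> (xmat p *v t) = (\<Sum>i\<in>UNIV. \<Sum>j\<in>UNIV. p $ xvar i j * t $ i * t $ j)"
  by (simp add: inner_vec_def matrix_vector_mult_def xmat_def sum_distrib_left mult_ac)

lemma hfun_quadratic: "hfun p t = t \<bullet> (xmat p *v t) + yvec p \<bullet> t"
  unfolding hfun_eq quadratic_form by (simp add: inner_vec_def yvec_def)

text \<open>The form attains a positive minimum on the compact unit sphere; homogeneity of degree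
  two carries it to all \<open>t\<close>.\<close>

lemma Omega_coercive:
  assumes "p \<in> Omega"
  shows "\<exists>c>0. \<forall>t. c * (norm t)\<^sup>2 \<le> - (t \<bullet> (xmat p *v t))"
proof -
  let ?q = "\<lambda>t. - (t \<bullet> (xmat p *v t))"
  have neg: "- xmat p *v t = - (xmat p *v t)" for t
    by (simp add: vec_eq_iff matrix_vector_mult_def sum_negf)
  have pos: "?q t > 0" if "t \<noteq> 0" for t
    using assms that by (simp add: Omega_def neg)
  have "continuous_on (sphere 0 1) ?q"
    by (intro continuous_intros linear_continuous_on_compose[OF _ matrix_vector_mul_linear] )
  moreover have "axis undefined 1 \<in> sphere (0 :: real^'a) 1" by simp
  ultimately obtain u where u: "u \<in> sphere 0 1" "\<And>t. t \<in> sphere 0 1 \<Longrightarrow> ?q u \<le> ?q t"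
    using continuous_attains_inf[OF compact_sphere, of 0 1 ?q] by blast
  have "?q u * (norm t)\<^sup>2 \<le> ?q t" for t
  proof (cases "t = 0")
    case False
    let ?s = "(1 / norm t) *\<^sub>R t"
    have "?q u \<le> ?q ?s" using False by (intro u(2)) simp
    also have "\<dots> = ?q t / (norm t)\<^sup>2"
      by (simp add: matrix_vector_mult_scaleR power2_eq_square)
    finally show ?thesis using False by (simp add: field_simps)
  qed simp
  moreover have "?q u > 0" using u(1) by (intro pos) auto
  ultimately show ?thesis by blast
qed

lemma open_Omega: "open (Omega :: (real^('d::finite xy)) set)"
proof (rule openI)
  fix p :: "real^('d xy)" assume "p \<in> Omega"
  then obtain c where c: "c > 0" "\<And>t. c * (norm t)\<^sup>2 \<le> - (t \<bullet> (xmat p *v t))"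
    using Omega_coercive by blast
  \<comment> \<open>The number of matrix entries. Each entry changes the quadratic form at
    \<open>t\<close> by at most \<open>norm (q - p) * (norm t)\<^sup>2\<close>, so a ball of radius
    \<open>c / ?K\<close> keeps it negative.\<close>
  let ?K = "real CARD('d) * real CARD('d)"
  have "q \<in> Omega" if q: "q \<in> ball p (c / ?K)" for q
  proof -
    have neg: "- xmat q *v t = - (xmat q *v t)" for t
      by (simp add: vec_eq_iff matrix_vector_mult_def sum_negf)
    have K: "?K > 0" by simp
    have "0 < - (t \<bullet> (xmat q *v t))" if t: "t \<noteq> 0" for t
    proof -
      have "t \<bullet> (xmat q *v t) - t \<bullet> (xmat p *v t) = (\<Sum>i\<in>UNIV. \<Sum>j\<in>UNIV. (q - p) $ xvar i j * t $ i * t $ j)"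
        by (simp add: quadratic_form sum_subtractf left_diff_distrib)
      also have "\<dots> \<le> (\<Sum>i\<in>(UNIV :: 'd set). \<Sum>j\<in>(UNIV :: 'd set). norm (q - p) * norm t * norm t)"
      proof (intro sum_mono)
        fix i j :: 'd
        have "(q - p) $ xvar i j * t $ i * t $ j \<le> \<bar>(q - p) $ xvar i j\<bar> * \<bar>t $ i\<bar> * \<bar>t $ j\<bar>"
          by (metis abs_ge_self abs_mult)
        also have "\<dots> \<le> norm (q - p) * norm t * norm t"
          by (intro mult_mono component_le_norm_cart) auto
        finally show "(q - p) $ xvar i j * t $ i * t $ j \<le> norm (q - p) * norm t * norm t" .
      qed
      also have "\<dots> = (?K * norm (q - p)) * (norm t)\<^sup>2" by (simp add: power2_eq_square)
      also have "\<dots> < c * (norm t)\<^sup>2"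
        using q t K by (intro mult_strict_right_mono) (simp_all add: dist_norm norm_minus_commute field_simps)
      finally show ?thesis using c(2)[of t] by simp
    qed
    then show ?thesis by (simp add: Omega_def neg)
  qed
  then show "\<exists>e>0. ball p e \<subseteq> Omega" using c(1) by (intro exI[of _ "c / ?K"]) auto
qed

definition hfun_grad :: "'d \<Rightarrow> real^('d xy) \<Rightarrow> real^'d::finite \<Rightarrow> real" where
  "hfun_grad i p t = p $ yvar i + 2 * (\<Sum>k\<in>UNIV. p $ xvar i k * t $ k)"

lemma hfun_has_derivative:
  "(hfun p has_derivative (\<lambda>d. \<Sum>i\<in>UNIV. d $ i * hfun_grad i p t)) (at t)"
proof -
  have d1: "((\<lambda>t. \<Sum>i\<in>UNIV. \<Sum>j\<in>UNIV. p $ xvar i j * t $ i * t $ j) has_derivative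
      (\<lambda>d. \<Sum>i\<in>UNIV. \<Sum>j\<in>UNIV. p $ xvar i j * d $ i * t $ j + p $ xvar i j * t $ i * d $ j)) (at t)"
    by (auto intro!: derivative_eq_intros bounded_linear_imp_has_derivative bounded_linear_vec_nth simp: algebra_simps)
  have "((\<lambda>t. hfun p t) has_derivative
      (\<lambda>d. (\<Sum>i\<in>UNIV. \<Sum>j\<in>UNIV. p $ xvar i j * d $ i * t $ j + p $ xvar i j * t $ i * d $ j) + (\<Sum>i\<in>UNIV. p $ yvar i * d $ i))) (at t)"
    unfolding hfun_eq by (intro has_derivative_add d1 has_derivative_sum has_derivative_mult_right
      bounded_linear_imp_has_derivative bounded_linear_vec_nth)
  moreover have "(\<Sum>i\<in>UNIV. \<Sum>j\<in>UNIV. p $ xvar i j * d $ i * t $ j + p $ xvar i j * t $ i * d $ j)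
      + (\<Sum>i\<in>UNIV. p $ yvar i * d $ i) = (\<Sum>i\<in>UNIV. d $ i * hfun_grad i p t)" for d
  proof -
    have "(\<Sum>i\<in>UNIV. \<Sum>j\<in>UNIV. p $ xvar i j * t $ i * d $ j) = (\<Sum>i\<in>UNIV. \<Sum>j\<in>UNIV. p $ xvar j i * t $ j * d $ i)"
      by (rule sum.swap)
    moreover have "p $ xvar j i = p $ xvar i j" for i j
    proof -
      have "Upair j i = Upair i j" by simp
      then show ?thesis by (simp only:)
    qed
    ultimately have sym: "(\<Sum>i\<in>UNIV. \<Sum>j\<in>UNIV. p $ xvar i j * t $ i * d $ j) = (\<Sum>i\<in>UNIV. \<Sum>j\<in>UNIV. p $ xvar i j * d $ i * t $ j)"
      by (simp add: mult_ac)
    have "(\<Sum>i\<in>UNIV. d $ i * hfun_grad i p t) =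
        (\<Sum>i\<in>UNIV. p $ yvar i * d $ i) + 2 * (\<Sum>i\<in>UNIV. \<Sum>j\<in>UNIV. p $ xvar i j * d $ i * t $ j)"
      by (simp add: hfun_grad_def distrib_left sum.distrib sum_distrib_left mult_ac)
    then show ?thesis unfolding sum.distrib sym by simp
  qed
  ultimately show ?thesis by simp
qed

text \<open>\<open>exp_rest 2\<close> of \<open>hfun h t\<close> measures how far \<open>exp (hfun (p + h) t)\<close> is from its first order
  expansion at \<open>p\<close>.\<close>

definition exp_rest :: "nat \<Rightarrow> real \<Rightarrow> real" where
  "exp_rest r x = exp x - (\<Sum>n<r. x ^ n / fact n)"

lemma abs_exp_rest_le: "\<bar>exp_rest r x\<bar> \<le> \<bar>x\<bar> ^ r * exp \<bar>x\<bar>"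
proof -
  obtain s where s: "\<bar>s\<bar> \<le> \<bar>x\<bar>" "exp x = (\<Sum>m<r. x ^ m / fact m) + exp s / fact r * x ^ r"
    using Maclaurin_exp_le by blast
  have "\<bar>exp_rest r x\<bar> = exp s / fact r * \<bar>x\<bar> ^ r"
    by (simp add: exp_rest_def s(2) abs_mult power_abs)
  also have "\<dots> \<le> exp \<bar>x\<bar> / 1 * \<bar>x\<bar> ^ r"
    using s(1) fact_ge_1[of r, where 'a = real] by (intro mult_right_mono frac_le) auto
  finally show ?thesis by (simp add: mult.commute)
qed

text \<open>For \<open>r = 0\<close> the function is \<open>exp\<close>, its own derivative, which
  agrees with the truncated \<open>0 - 1 = 0\<close>.\<close>

lemma exp_rest_deriv: "(exp_rest r has_real_derivative exp_rest (r - 1) x) (at x)"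
proof (cases r)
  case (Suc m)
  have "((\<lambda>x. \<Sum>n<Suc m. x ^ n / fact n) has_real_derivative (\<Sum>n<m. x ^ n / fact n)) (at x)"
  proof (induction m)
    case (Suc m)
    have "((\<lambda>x. x ^ Suc m / fact (Suc m)) has_real_derivative x ^ m / fact m) (at x)"
      using DERIV_cdivide[OF DERIV_pow[of "Suc m" x UNIV], of "fact (Suc m)"]
      by (simp add: fact_Suc del: power_Suc of_nat_Suc)
    from DERIV_add[OF Suc this] show ?case by simp
  qed simp
  from DERIV_diff[OF DERIV_exp this] show ?thesis by (simp add: Suc exp_rest_def[abs_def])
qed (simp add: exp_rest_def[abs_def] DERIV_exp)

text \<open>The index \<open>n\<close> is an order of vanishing: for \<open>p\<close> in
  \<open>Omega\<close>, all Schwartz seminorms of \<open>w h\<close> are bounded by multiples of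
  \<open>norm h ^ n\<close> near \<open>h = 0\<close>. The class is generated so as to be closed
  under derivatives in \<open>t\<close> and multiplication by coordinates. Powers of
  \<open>h\<close> are included because differentiating \<open>exp_rest r (hfun h t)\<close> lowers
  \<open>r\<close> while producing a factor linear in \<open>h\<close>.\<close>

inductive perturbation :: "real^('d::finite xy) \<Rightarrow> nat \<Rightarrow> (real^('d xy) \<Rightarrow> real^'d \<Rightarrow> complex) \<Rightarrow> bool"
  for p where
  base: "perturbation p r (\<lambda>h t. of_real (exp (hfun p t) * exp_rest r (hfun h t)))"
| add: "perturbation p n w \<Longrightarrow> perturbation p n w' \<Longrightarrow> perturbation p n (\<lambda>h t. w h t + w' h t)"
| cmult: "perturbation p n w \<Longrightarrow> perturbation p n (\<lambda>h t. c * w h t)"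
| coord: "perturbation p n w \<Longrightarrow> perturbation p n (\<lambda>h t. of_real (t $ i) * w h t)"
| hcoord: "perturbation p n w \<Longrightarrow> perturbation p (Suc n) (\<lambda>h t. of_real (h $ v) * w h t)"
| weaken: "perturbation p (Suc n) w \<Longrightarrow> perturbation p n w"

lemma perturbation_sum:
  assumes "\<And>k. k \<in> K \<Longrightarrow> perturbation p n (w k)"
  shows "perturbation p n (\<lambda>h t. \<Sum>k\<in>K. w k h t)"
  using assms
proof (induction K rule: infinite_finite_induct)
  case (insert k K)
  then show ?case by (simp add: perturbation.add)
qed (use perturbation.cmult[OF perturbation.base, of p n 0] in simp_all)

lemma base_has_derivative:
  "((\<lambda>t. complex_of_real (exp (hfun p t) * exp_rest r (hfun h t))) has_derivative
    (\<lambda>d. of_real ((exp (hfun p t) * (\<Sum>i\<in>UNIV. d $ i * hfun_grad i p t)) * exp_rest r (hfun h t)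
      + exp (hfun p t) * (exp_rest (r - 1) (hfun h t) * (\<Sum>i\<in>UNIV. d $ i * hfun_grad i h t))))) (at t)"
proof -
  have e: "((\<lambda>t. exp (hfun p t)) has_derivative (\<lambda>d. exp (hfun p t) * (\<Sum>i\<in>UNIV. d $ i * hfun_grad i p t))) (at t)"
    using has_derivative_compose[OF hfun_has_derivative DERIV_exp[unfolded has_field_derivative_def]] .
  have r: "((\<lambda>t. exp_rest r (hfun h t)) has_derivative
      (\<lambda>d. exp_rest (r - 1) (hfun h t) * (\<Sum>i\<in>UNIV. d $ i * hfun_grad i h t))) (at t)"
    using has_derivative_compose[OF hfun_has_derivative exp_rest_deriv[unfolded has_field_derivative_def]] .
  from has_derivative_of_real[OF has_derivative_mult[OF e r]] show ?thesis
    by (simp add: add.commute)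
qed

lemma perturbation_differentiable: "perturbation p n w \<Longrightarrow> w h differentiable (at t)"
proof (induction rule: perturbation.induct)
  case (base r)
  then show ?case using base_has_derivative unfolding differentiable_def by blast
next
  case (cmult n w c)
  then show ?case by (intro differentiable_mult differentiable_const)
next
  case (coord n w i)
  from coord.IH show ?case by (rule coord_differentiable)
next
  case (hcoord n w v)
  then show ?case by (intro differentiable_mult differentiable_const)
qed auto

lemma perturbation_grad:
  assumes "perturbation p n w"
  shows "perturbation p n (\<lambda>h t. of_real (hfun_grad i q t) * w h t)"
    and "perturbation p (Suc n) (\<lambda>h t. of_real (hfun_grad i h t) * w h t)"
proof -
  have "perturbation p n (\<lambda>h t. of_real (q $ yvar i) * w h t
      + 2 * (\<Sum>k\<in>UNIV. of_real (q $ xvar i k) * (of_real (t $ k) * w h t)))"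
    by (intro perturbation.add perturbation.cmult perturbation_sum perturbation.coord assms)
  then show "perturbation p n (\<lambda>h t. of_real (hfun_grad i q t) * w h t)"
    by (simp add: hfun_grad_def distrib_right sum_distrib_right mult.assoc)
  have "perturbation p (Suc n) (\<lambda>h t. of_real (h $ yvar i) * w h t
      + 2 * (\<Sum>k\<in>UNIV. of_real (h $ xvar i k) * (of_real (t $ k) * w h t)))"
    by (intro perturbation.add perturbation.cmult perturbation_sum perturbation.hcoord perturbation.coord assms)
  then show "perturbation p (Suc n) (\<lambda>h t. of_real (hfun_grad i h t) * w h t)"
    by (simp add: hfun_grad_def distrib_right sum_distrib_right mult.assoc)
qed

lemma perturbation_partial: "perturbation p n w \<Longrightarrow> perturbation p n (\<lambda>h. partial i (w h))"
proof (induction rule: perturbation.induct)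
  case (base r)
  \<comment> \<open>For positive \<open>r\<close> the factor \<open>hfun_grad i h t\<close> restores
    the order lost in \<open>exp_rest (r - 1)\<close>. For \<open>r = 0\<close> nothing is lost, and
    the gained order is dropped by \<open>weaken\<close>.\<close>
  have "perturbation p r (\<lambda>h t. of_real (hfun_grad i h t) * of_real (exp (hfun p t) * exp_rest (r - 1) (hfun h t)))"
    using perturbation_grad(2)[OF perturbation.base[of p "r - 1"], of i]
    by (cases r) (auto intro: perturbation.weaken)
  from perturbation.add[OF perturbation_grad(1)[OF perturbation.base] this]
  have "perturbation p r (\<lambda>h t. of_real (hfun_grad i p t) * of_real (exp (hfun p t) * exp_rest r (hfun h t))
      + of_real (hfun_grad i h t) * of_real (exp (hfun p t) * exp_rest (r - 1) (hfun h t)))" .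
  moreover have "partial i (\<lambda>t. of_real (exp (hfun p t) * exp_rest r (hfun h t))) t =
     of_real (hfun_grad i p t) * of_real (exp (hfun p t) * exp_rest r (hfun h t))
      + of_real (hfun_grad i h t) * of_real (exp (hfun p t) * exp_rest (r - 1) (hfun h t))" for h t
  proof -
    have "(\<Sum>k\<in>UNIV. axis i 1 $ k * f k) = f i" for f :: "'a \<Rightarrow> real"
      by (simp add: axis_def if_distrib[of "\<lambda>x. x * _"] cong: if_cong)
    then show ?thesis unfolding partial_eqI[OF base_has_derivative] by (simp add: mult_ac)
  qed
  ultimately show ?case by (simp add: fun_eq_iff[symmetric])
next
  case (add n w w')
  have "partial i (\<lambda>t. w h t + w' h t) = (\<lambda>t. partial i (w h) t + partial i (w' h) t)" for h
    using partial_add[OF perturbation_differentiable[OF add.hyps(1)] perturbation_differentiable[OF add.hyps(2)]]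
    by auto
  then show ?case using perturbation.add[OF add.IH] by simp
next
  case (cmult n w c)
  have "partial i (\<lambda>t. c * w h t) = (\<lambda>t. c * partial i (w h) t)" for h
    using partial_cmult[OF perturbation_differentiable[OF cmult.hyps]] by auto
  then show ?case using perturbation.cmult[OF cmult.IH] by simp
next
  case (coord n w j)
  have "partial i (\<lambda>t. of_real (t $ j) * w h t) =
      (\<lambda>t. of_real (t $ j) * partial i (w h) t + (if i = j then 1 else 0) * w h t)" for h
    using partial_coord[OF perturbation_differentiable[OF coord.hyps]] by auto
  then show ?case
    using perturbation.add[OF perturbation.coord[OF coord.IH] perturbation.cmult[OF coord.hyps]] by simp
next
  case (hcoord n w v)
  have "partial i (\<lambda>t. of_real (h $ v) * w h t) = (\<lambda>t. of_real (h $ v) * partial i (w h) t)" for h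
    using partial_cmult[OF perturbation_differentiable[OF hcoord.hyps]] by auto
  then show ?case using perturbation.hcoord[OF hcoord.IH] by simp
next
  case (weaken n w)
  then show ?case by (blast intro: perturbation.weaken)
qed

lemma perturbation_iter_partial:
  "perturbation p n w \<Longrightarrow> perturbation p n (\<lambda>h. iter_partial js (w h))"
  by (induction js) (simp_all add: perturbation_partial)

text \<open>The last summand of the exponent is the allowance for \<open>hfun h t\<close>; with the
  factor 1/4 the quadratic term stays negative. The polynomial factor is absorbed by an exponential
  of \<open>1 + s\<close>.\<close>

lemma gauss_bound:
  fixes c :: real
  assumes "c > 0"
  shows "\<exists>B. \<forall>s\<ge>0. (1 + s) ^ M * exp (- c * s\<^sup>2 + b * s + c / 4 * (1 + s)\<^sup>2) \<le> B"
proof (intro exI allI impI)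
  fix s :: real assume s: "s \<ge> 0"
  \<comment> \<open>The maximum over all real \<open>s\<close> of the exponent including the
    additional \<open>1 + s\<close>, by completing the square with leading coefficient
    \<open>- 3 * c / 4\<close>.\<close>
  let ?e = "1 + c / 4 + (b + c / 2 + 1)\<^sup>2 / (3 * c)"
  have "(1 + s) ^ M / fact M \<le> exp (1 + s)"
  proof -
    obtain x where x: "exp (1 + s) = (\<Sum>m<Suc M. (1 + s) ^ m / fact m) + exp x / fact (Suc M) * (1 + s) ^ Suc M"
      using Maclaurin_exp_le[of "1 + s" "Suc M"] by blast
    have "(1 + s) ^ M / fact M \<le> (\<Sum>m<Suc M. (1 + s) ^ m / fact m)"
      using s by (intro member_le_sum[of M "{..<Suc M}" "\<lambda>m. (1 + s) ^ m / fact m"]) auto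
    moreover have "exp x / fact (Suc M) * (1 + s) ^ Suc M \<ge> 0" using s by simp
    ultimately show ?thesis using x by linarith
  qed
  then have "(1 + s) ^ M \<le> fact M * exp (1 + s)" by (simp add: field_simps)
  then have "(1 + s) ^ M * exp (- c * s\<^sup>2 + b * s + c / 4 * (1 + s)\<^sup>2) \<le>
      fact M * exp (1 + s) * exp (- c * s\<^sup>2 + b * s + c / 4 * (1 + s)\<^sup>2)"
    by (rule mult_right_mono) simp
  also have "\<dots> = fact M * exp ((1 + s) + (- c * s\<^sup>2 + b * s + c / 4 * (1 + s)\<^sup>2))"
    by (simp only: exp_add mult.assoc)
  also have "\<dots> \<le> fact M * exp ?e"
  proof -
    have "0 \<le> (3 * c / 2 * s - (b + c / 2 + 1))\<^sup>2 / (3 * c)" using assms by simp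
    also have "\<dots> = ?e - ((1 + s) + (- c * s\<^sup>2 + b * s + c / 4 * (1 + s)\<^sup>2))"
      using assms by (simp add: field_simps power2_eq_square)
    finally show ?thesis by simp
  qed
  finally show "(1 + s) ^ M * exp (- c * s\<^sup>2 + b * s + c / 4 * (1 + s)\<^sup>2) \<le> fact M * exp ?e" .
qed

text \<open>The radius depends on \<open>p\<close> alone, whereas \<open>C\<close> may depend on the
  perturbation and the weight. Thus one radius serves all derivatives and all seminorms at
  once.\<close>

lemma perturbation_bound:
  fixes p :: "real^('d::finite xy)"
  assumes p: "p \<in> Omega"
  shows "\<exists>\<delta>>0. \<forall>n w m. perturbation p n w \<longrightarrow>
    (\<exists>C. \<forall>h t. norm h \<le> \<delta> \<longrightarrow> (1 + norm t) ^ m * cmod (w h t) \<le> C * norm h ^ n)"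
proof -
  obtain c where c: "c > 0" "\<And>t. c * (norm t)\<^sup>2 \<le> - (t \<bullet> (xmat p *v t))"
    using Omega_coercive[OF p] by blast
  define K where "K = 2 * real CARD('d xy)"
  \<comment> \<open>Chosen such that \<open>norm h \<le> \<delta>\<close> bounds
    \<open>hfun h t\<close> by a quarter of the decay \<open>c\<close>, the allowance in
    \<open>gauss_bound\<close>.\<close>
  define \<delta> where "\<delta> = c / (4 * K)"
  have "real CARD('d xy) > 0" unfolding of_nat_0_less_iff by (rule zero_less_card_finite)
  then have K: "K > 0" unfolding K_def by linarith
  have \<delta>: "\<delta> > 0" using c(1) K by (simp add: \<delta>_def)
  have "\<exists>C. \<forall>h t. norm h \<le> \<delta> \<longrightarrow> (1 + norm t) ^ m * cmod (w h t) \<le> C * norm h ^ n"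
    if "perturbation p n w" for n w m
    using that
  proof (induction arbitrary: m rule: perturbation.induct)
    case (base r)
    obtain B where B: "\<And>s. s \<ge> 0 \<Longrightarrow>
        (1 + s) ^ (m + 2 * r) * exp (- c * s\<^sup>2 + norm (yvec p) * s + c / 4 * (1 + s)\<^sup>2) \<le> B"
      using gauss_bound[OF c(1)] by metis
    have "(1 + norm t) ^ m * cmod (of_real (exp (hfun p t) * exp_rest r (hfun h t))) \<le> (K ^ r * B) * norm h ^ r"
      if h: "norm h \<le> \<delta>" for h t
    proof -
      let ?s = "norm t"
      have "yvec p \<bullet> t \<le> norm (yvec p) * ?s" by (rule norm_cauchy_schwarz)
      then have 1: "hfun p t \<le> - c * ?s\<^sup>2 + norm (yvec p) * ?s"
        using c(2)[of t] by (simp add: hfun_quadratic)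
      have 2: "\<bar>hfun h t\<bar> \<le> K * norm h * (1 + ?s)\<^sup>2" using abs_hfun_le[of h t] by (simp add: K_def)
      also have "\<dots> \<le> K * \<delta> * (1 + ?s)\<^sup>2" using h K by (intro mult_right_mono mult_left_mono) auto
      finally have 3: "\<bar>hfun h t\<bar> \<le> c / 4 * (1 + ?s)\<^sup>2" using K by (simp add: \<delta>_def)
      have "cmod (of_real (exp (hfun p t) * exp_rest r (hfun h t))) = exp (hfun p t) * \<bar>exp_rest r (hfun h t)\<bar>"
        by (simp add: abs_mult norm_mult)
      also have "\<dots> \<le> exp (- c * ?s\<^sup>2 + norm (yvec p) * ?s) * ((K * norm h * (1 + ?s)\<^sup>2) ^ r * exp (c / 4 * (1 + ?s)\<^sup>2))"
      proof (rule mult_mono)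
        have "\<bar>exp_rest r (hfun h t)\<bar> \<le> \<bar>hfun h t\<bar> ^ r * exp \<bar>hfun h t\<bar>" by (rule abs_exp_rest_le)
        also have "\<dots> \<le> (K * norm h * (1 + ?s)\<^sup>2) ^ r * exp (c / 4 * (1 + ?s)\<^sup>2)"
          using 2 3 by (intro mult_mono power_mono) auto
        finally show "\<bar>exp_rest r (hfun h t)\<bar> \<le> (K * norm h * (1 + ?s)\<^sup>2) ^ r * exp (c / 4 * (1 + ?s)\<^sup>2)" .
      qed (use 1 in auto)
      also have "\<dots> = K ^ r * norm h ^ r * (1 + ?s) ^ (2 * r) *
          exp (- c * ?s\<^sup>2 + norm (yvec p) * ?s + c / 4 * (1 + ?s)\<^sup>2)"
      proof -
        have "((1 + ?s)\<^sup>2) ^ r = (1 + ?s) ^ (2 * r)" by (simp only: power_mult)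
        then show ?thesis by (simp only: power_mult_distrib exp_add mult_ac)
      qed
      finally have "(1 + ?s) ^ m * cmod (of_real (exp (hfun p t) * exp_rest r (hfun h t))) \<le>
         (1 + ?s) ^ m * (K ^ r * norm h ^ r * (1 + ?s) ^ (2 * r) *
          exp (- c * ?s\<^sup>2 + norm (yvec p) * ?s + c / 4 * (1 + ?s)\<^sup>2))"
        by (intro mult_left_mono) auto
      also have "\<dots> = K ^ r * norm h ^ r * ((1 + ?s) ^ (m + 2 * r) *
          exp (- c * ?s\<^sup>2 + norm (yvec p) * ?s + c / 4 * (1 + ?s)\<^sup>2))"
        by (simp add: power_add mult_ac)
      also have "\<dots> \<le> K ^ r * norm h ^ r * B" using K by (intro mult_left_mono B) auto
      finally show ?thesis by (simp add: mult_ac)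
    qed
    then show ?case by blast
  next
    case (add n w w')
    obtain C C' where C: "\<And>h t. norm h \<le> \<delta> \<Longrightarrow> (1 + norm t) ^ m * cmod (w h t) \<le> C * norm h ^ n"
      "\<And>h t. norm h \<le> \<delta> \<Longrightarrow> (1 + norm t) ^ m * cmod (w' h t) \<le> C' * norm h ^ n"
      using add.IH by metis
    have "(1 + norm t) ^ m * cmod (w h t + w' h t) \<le> (C + C') * norm h ^ n" if "norm h \<le> \<delta>" for h t
    proof -
      have "(1 + norm t) ^ m * cmod (w h t + w' h t) \<le> (1 + norm t) ^ m * (cmod (w h t) + cmod (w' h t))"
        by (intro mult_left_mono norm_triangle_ineq) auto
      then show ?thesis using C[OF that, of t] by (simp add: distrib_left distrib_right)
    qed
    then show ?case by blast
  next
    case (cmult n w a)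
    obtain C where C: "\<And>h t. norm h \<le> \<delta> \<Longrightarrow> (1 + norm t) ^ m * cmod (w h t) \<le> C * norm h ^ n"
      using cmult.IH by metis
    have "(1 + norm t) ^ m * cmod (a * w h t) \<le> (cmod a * C) * norm h ^ n" if "norm h \<le> \<delta>" for h t
      using mult_left_mono[OF C[OF that, of t], of "cmod a"] by (simp add: norm_mult mult_ac)
    then show ?case by blast
  next
    case (coord n w i)
    obtain C where C: "\<And>h t. norm h \<le> \<delta> \<Longrightarrow> (1 + norm t) ^ Suc m * cmod (w h t) \<le> C * norm h ^ n"
      using coord.IH by metis
    have "(1 + norm t) ^ m * cmod (of_real (t $ i) * w h t) \<le> C * norm h ^ n" if "norm h \<le> \<delta>" for h t
    proof -
      have "\<bar>t $ i\<bar> \<le> 1 + norm t" using component_le_norm_cart[of t i] by simp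
      then have "(1 + norm t) ^ m * (\<bar>t $ i\<bar> * cmod (w h t)) \<le> (1 + norm t) ^ m * ((1 + norm t) * cmod (w h t))"
        by (intro mult_left_mono mult_right_mono) auto
      then show ?thesis using C[OF that, of t] by (simp add: norm_mult mult_ac)
    qed
    then show ?case by blast
  next
    case (hcoord n w v)
    obtain C where C: "\<And>h t. norm h \<le> \<delta> \<Longrightarrow> (1 + norm t) ^ m * cmod (w h t) \<le> C * norm h ^ n"
      using hcoord.IH by metis
    have "(1 + norm t) ^ m * cmod (of_real (h $ v) * w h t) \<le> C * norm h ^ Suc n" if "norm h \<le> \<delta>" for h t
    proof -
      have "\<bar>h $ v\<bar> * ((1 + norm t) ^ m * cmod (w h t)) \<le> norm h * (C * norm h ^ n)"
        by (intro mult_mono component_le_norm_cart C that) auto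
      then show ?thesis by (simp add: norm_mult mult_ac)
    qed
    then show ?case by blast
  next
    case (weaken n w)
    obtain C where C: "\<And>h t. norm h \<le> \<delta> \<Longrightarrow> (1 + norm t) ^ m * cmod (w h t) \<le> C * norm h ^ Suc n"
      using weaken.IH by metis
    have "(1 + norm t) ^ m * cmod (w h t) \<le> (\<bar>C\<bar> * \<delta>) * norm h ^ n" if "norm h \<le> \<delta>" for h t
    proof -
      have "C * norm h ^ Suc n \<le> \<bar>C\<bar> * (\<delta> * norm h ^ n)"
        using that by (intro mult_mono) (auto intro!: mult_right_mono)
      then show ?thesis using C[OF that, of t] by (simp add: mult.assoc)
    qed
    then show ?case by blast
  qed
  then show ?thesis using \<delta> by blast
qed

section \<open>Differentiating the pairing\<close>

definition hkernel :: "real^('d::finite xy) \<Rightarrow> real^'d \<Rightarrow> complex" where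
  "hkernel p t = exp (complex_of_real (hfun p t))"

lemma perturbation_schwartz:
  assumes p: "p \<in> Omega"
  shows "\<exists>\<delta>>0. \<forall>n w h. perturbation p n w \<longrightarrow> norm h \<le> \<delta> \<longrightarrow> w h \<in> schwartz_space"
proof -
  obtain \<delta> where \<delta>: "\<delta> > 0" "\<And>n w m. perturbation p n w \<Longrightarrow>
      \<exists>C. \<forall>h t. norm h \<le> \<delta> \<longrightarrow> (1 + norm t) ^ m * cmod (w h t) \<le> C * norm h ^ n"
    using perturbation_bound[OF p] by metis
  have "w h \<in> schwartz_space" if w: "perturbation p n w" and h: "norm h \<le> \<delta>" for n w h
  proof (rule schwartz_space_coinduct[where Q = "\<lambda>u. \<exists>n w. perturbation p n w \<and> u = w h"])
    show "\<exists>n w'. perturbation p n w' \<and> w h = w' h" using w by blast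
    fix u assume "\<exists>n w. perturbation p n w \<and> u = w h"
    then obtain n w where u: "perturbation p n w" "u = w h" by blast
    show "u differentiable (at t)" for t using perturbation_differentiable[OF u(1)] u(2) by simp
    show "\<exists>B. \<forall>t. (1 + norm t) ^ k * cmod (u t) \<le> B" for k
      using \<delta>(2)[OF u(1), of k] h u(2) by metis
    show "\<exists>n w. perturbation p n w \<and> partial i u = w h" for i
      using perturbation_partial[OF u(1), of i] u(2) by blast
  qed
  then show ?thesis using \<delta>(1) by blast
qed

text \<open>The kernel is the basic perturbation with \<open>r = 0\<close> taken at
  \<open>h = 0\<close>, so its decay and its derivatives come from the general results.\<close>

lemma hkernel_eq: "hkernel p = (\<lambda>t. of_real (exp (hfun p t) * exp_rest 0 (hfun 0 t)))"
  by (simp add: hkernel_def exp_rest_def hfun_simps exp_of_real fun_eq_iff)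

lemma hkernel_schwartz: "p \<in> Omega \<Longrightarrow> hkernel p \<in> schwartz_space"
  unfolding hkernel_eq using perturbation_schwartz[of p] perturbation.base[of p 0] by fastforce

lemma hkernel_partial: "partial i (hkernel p) t = of_real (hfun_grad i p t) * hkernel p t"
proof -
  have "(\<Sum>k\<in>UNIV. axis i 1 $ k * f k) = f i" for f :: "'a \<Rightarrow> real"
    by (simp add: axis_def if_distrib[of "\<lambda>x. x * _"] cong: if_cong)
  note axis = this
  have "hfun_grad i 0 t = 0" by (simp add: hfun_grad_def)
  then show ?thesis
    unfolding hkernel_eq partial_eqI[OF base_has_derivative] axis by simp
qed

lemma schwartz_space_symbol:
  "u \<in> schwartz_space \<Longrightarrow> (\<lambda>t. of_real (symbol v t) * u t) \<in> schwartz_space"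
proof (cases v rule: symbol_cases)
  case (y k)
  assume "u \<in> schwartz_space"
  then show ?thesis unfolding y(2) by (rule schwartz_space_coord)
next
  case (x i j c)
  assume "u \<in> schwartz_space"
  then have "(\<lambda>t. of_real c * (of_real (t $ i) * (of_real (t $ j) * u t))) \<in> schwartz_space"
    by (intro schwartz_space_cmult schwartz_space_coord)
  then show ?thesis unfolding x(4) by (simp add: mult.assoc)
qed

lemma schwartz_space_sum:
  assumes "\<And>k. k \<in> K \<Longrightarrow> u k \<in> schwartz_space" "finite K" "K \<noteq> {}"
  shows "(\<lambda>t. \<Sum>k\<in>K. u k t) \<in> schwartz_space"
  using assms(2,3,1)
proof (induction K rule: finite_ne_induct)
  case (insert k K)
  then show ?case by (simp add: schwartz_space_add)
qed simp

lemma schwartz_linear_sum: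
  assumes "schwartz_linear T" "\<And>k. k \<in> K \<Longrightarrow> u k \<in> schwartz_space" "finite K" "K \<noteq> {}"
  shows "T (\<lambda>t. \<Sum>k\<in>K. u k t) = (\<Sum>k\<in>K. T (u k))"
  using assms(3,4,2)
proof (induction K rule: finite_ne_induct)
  case (insert k K)
  then show ?case
    using schwartz_linear_add[OF assms(1), of "u k" "\<lambda>t. \<Sum>k\<in>K. u k t"]
    by (simp add: schwartz_space_sum)
qed simp

lemma schwartz_linear_diff:
  assumes "schwartz_linear T" "u \<in> schwartz_space" "v \<in> schwartz_space"
  shows "T (\<lambda>t. u t - v t) = T u - T v"
  using schwartz_linear_add[OF assms(1,2) schwartz_space_cmult[OF assms(3), of "-1"]]
    schwartz_linear_cmult[OF assms(1,3), of "-1"] by simp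

text \<open>All that is used of the continuity of a tempered distribution; unlike continuity itself,
  this property is visibly preserved by the action of the Weyl algebra.\<close>

definition differentiates_kernel :: "((real^'d::finite \<Rightarrow> complex) \<Rightarrow> complex) \<Rightarrow> bool" where
  "differentiates_kernel T \<longleftrightarrow> schwartz_linear T \<and>
     (\<forall>p\<in>Omega. \<forall>w. perturbation p 2 w \<longrightarrow> ((\<lambda>h. T (w h) / of_real (norm h)) \<longlongrightarrow> 0) (at 0))"

lemma iter_partial_cmult:
  "u \<in> schwartz_space \<Longrightarrow> iter_partial js (\<lambda>x. c * u x) = (\<lambda>x. c * iter_partial js u x)"
proof (induction js)
  case (Cons j js)
  have "iter_partial js u \<in> schwartz_space"
    by (induction js) (simp_all add: Cons.prems schwartz_space_partial)
  then show ?case using Cons by (simp add: partial_cmult_schwartz)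
qed simp

text \<open>Continuity at the zero function is applied to \<open>w h\<close> divided by
  \<open>norm h\<close>. Order two leaves a bound linear in \<open>norm h\<close> for each seminorm,
  and continuity involves only finitely many of them.\<close>

lemma tempered_differentiates_kernel:
  fixes f :: "(real^'d::finite \<Rightarrow> complex) \<Rightarrow> complex"
  assumes f: "tempered_distribution f"
  shows "differentiates_kernel f"
  unfolding differentiates_kernel_def
proof (intro conjI ballI allI impI)
  show lin: "schwartz_linear f" using f by (rule tempered_distribution_linear)
  fix p :: "real^('d xy)" and w assume p: "p \<in> Omega" and w: "perturbation p 2 w"
  obtain \<delta>1 where \<delta>1: "\<delta>1 > 0" "\<And>n w m. perturbation p n w \<Longrightarrow>
      \<exists>C. \<forall>h t. norm h \<le> \<delta>1 \<longrightarrow> (1 + norm t) ^ m * cmod (w h t) \<le> C * norm h ^ n"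
    using perturbation_bound[OF p] by metis
  obtain \<delta>2 where \<delta>2: "\<delta>2 > 0" "\<And>h. norm h \<le> \<delta>2 \<Longrightarrow> w h \<in> schwartz_space"
    using perturbation_schwartz[OF p] w by metis
  have z: "(\<lambda>_ :: real^'d. 0) \<in> schwartz_space"
    using schwartz_space_cmult[OF hkernel_schwartz[OF p], of 0] by simp
  have f0: "f (\<lambda>_. 0) = 0"
    using schwartz_linear_cmult[OF lin hkernel_schwartz[OF p], of 0] by simp
  show "((\<lambda>h. f (w h) / of_real (norm h)) \<longlongrightarrow> 0) (at 0)"
  proof (rule tendstoI)
    fix e :: real assume e: "e > 0"
    note cont = f[unfolded tempered_distribution_def, THEN conjunct2, THEN conjunct2, rule_format, OF z e]
    from cont obtain d N where d: "d > 0"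
      and small_imp: "\<forall>v\<in>schwartz_space. (\<forall>k js. k \<le> N \<and> length js \<le> N \<longrightarrow>
        schwartz_seminorm k js (\<lambda>x. v x - 0) < d) \<longrightarrow> cmod (f v - f (\<lambda>_. 0)) < e"
      by (elim exE conjE)
    let ?KJ = "{..N} \<times> {js :: 'd list. set js \<subseteq> UNIV \<and> length js \<le> N}"
    let ?v = "\<lambda>h t. of_real (1 / norm h) * w h t"
    have fin: "finite ?KJ" using finite_lists_length_le[of "UNIV :: 'd set" N] by simp
    have small: "\<forall>\<^sub>F h in at 0. norm h \<le> \<delta>1 \<and> norm h \<le> \<delta>2 \<and> h \<noteq> 0"
      unfolding eventually_at using \<delta>1(1) \<delta>2(1) by (intro exI[of _ "min \<delta>1 \<delta>2"]) auto
    have "\<forall>\<^sub>F h in at 0. \<forall>(k, js)\<in>?KJ. schwartz_seminorm k js (?v h) < d"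
      unfolding case_prod_beta
    proof (rule eventually_ball_finite[OF fin], clarify)
      fix k js
      obtain C where C: "\<And>h t. norm h \<le> \<delta>1 \<Longrightarrow>
          (1 + norm t) ^ k * cmod (iter_partial js (w h) t) \<le> C * norm h ^ 2"
        using \<delta>1(2)[OF perturbation_iter_partial[OF w]] by metis
      have "((\<lambda>h. C * norm h) \<longlongrightarrow> C * norm (0 :: real^('d xy))) (at (0 :: real^('d xy)))"
        by (rule tendsto_mult[OF tendsto_const tendsto_norm[OF tendsto_ident_at]])
      then have "\<forall>\<^sub>F h in at (0 :: real^('d xy)). C * norm h < d"
        using d by (intro order_tendstoD(2)) auto
      then have "\<forall>\<^sub>F h in at 0. schwartz_seminorm k js (?v h) < d"
        using small
      proof eventually_elim
        case (elim h)
        have "(1 + norm t) ^ k * cmod (iter_partial js (?v h) t) \<le> C * norm h" for t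
        proof -
          have "(1 + norm t) ^ k * cmod (iter_partial js (?v h) t) =
              (1 + norm t) ^ k * cmod (iter_partial js (w h) t) / norm h"
            using elim \<delta>2(2) by (simp only: iter_partial_cmult norm_mult norm_of_real) simp
          also have "\<dots> \<le> C * norm h ^ 2 / norm h"
            using elim by (intro divide_right_mono C) auto
          also have "\<dots> = C * norm h" using elim by (simp add: power2_eq_square)
          finally show ?thesis .
        qed
        then have "schwartz_seminorm k js (?v h) \<le> C * norm h"
          unfolding schwartz_seminorm_def by (intro cSUP_least) auto
        then show ?case using elim by simp
      qed
      then show "\<forall>\<^sub>F h in at 0. schwartz_seminorm (fst (k, js)) (snd (k, js)) (?v h) < d" by simp
    qed
    then show "\<forall>\<^sub>F h in at 0. dist (f (w h) / of_real (norm h)) 0 < e"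
      using small
    proof eventually_elim
      case (elim h)
      have "w h \<in> schwartz_space" using elim \<delta>2 by simp
      then have v: "?v h \<in> schwartz_space" "f (?v h) = of_real (1 / norm h) * f (w h)"
        by (rule schwartz_space_cmult, rule schwartz_linear_cmult[OF lin])
      have "cmod (f (?v h) - f (\<lambda>_. 0)) < e"
        using elim by (intro small_imp[rule_format] v(1)) auto
      then show ?case unfolding v(2) f0 by (simp add: dist_norm norm_mult norm_divide)
    qed
  qed
qed

text \<open>The generators act on test functions by multiplication with a coordinate or by
  differentiation, and both keep perturbations of order two.\<close>

lemma differentiates_kernel_dact:
  "differentiates_kernel T \<Longrightarrow> differentiates_kernel (wexpr_dact a T)"
proof (induction a arbitrary: T)
  case (WConst c)
  have "((\<lambda>h. c * (T (w h) / of_real (norm h))) \<longlongrightarrow> c * 0) (at 0)"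
    if "p \<in> Omega" "perturbation p 2 w" for p w
    using WConst that unfolding differentiates_kernel_def by (intro tendsto_intros) blast
  then show ?case
    using WConst wexpr_dact_linear[of T "WConst c"] by (simp add: differentiates_kernel_def)
next
  case (WVar i)
  have "((\<lambda>h. T (\<lambda>t. of_real (t $ i) * w h t) / of_real (norm h)) \<longlongrightarrow> 0) (at 0)"
    if "p \<in> Omega" "perturbation p 2 w" for p w
    using WVar that perturbation.coord unfolding differentiates_kernel_def by blast
  then show ?case
    using WVar wexpr_dact_linear[of T "WVar i"] by (simp add: differentiates_kernel_def)
next
  case (WDer i)
  have "((\<lambda>h. - (T (partial i (w h)) / of_real (norm h))) \<longlongrightarrow> - 0) (at 0)"
    if "p \<in> Omega" "perturbation p 2 w" for p w
    using WDer that perturbation_partial unfolding differentiates_kernel_def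
    by (intro tendsto_minus) blast
  then show ?case
    using WDer wexpr_dact_linear[of T "WDer i"] by (simp add: differentiates_kernel_def)
next
  case (WAdd a b)
  have "((\<lambda>h. wexpr_dact a T (w h) / of_real (norm h) + wexpr_dact b T (w h) / of_real (norm h)) \<longlongrightarrow> 0 + 0) (at 0)"
    if "p \<in> Omega" "perturbation p 2 w" for p w
    using WAdd that unfolding differentiates_kernel_def by (intro tendsto_add) blast+
  then show ?case
    using WAdd.prems wexpr_dact_linear[of T "WAdd a b"] by (simp add: differentiates_kernel_def add_divide_distrib)
qed simp

definition symbol_mult :: "'d xy \<Rightarrow> ((real^'d::finite \<Rightarrow> complex) \<Rightarrow> complex) \<Rightarrow> (real^'d \<Rightarrow> complex) \<Rightarrow> complex" where
  "symbol_mult v T u = T (\<lambda>t. of_real (symbol v t) * u t)"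

lemma differentiates_kernel_symbol:
  fixes T :: "(real^'d::finite \<Rightarrow> complex) \<Rightarrow> complex"
  assumes T: "differentiates_kernel T"
  shows "differentiates_kernel (symbol_mult v T)"
  unfolding differentiates_kernel_def
proof (intro conjI ballI allI impI)
  have lin: "schwartz_linear T" using T by (simp add: differentiates_kernel_def)
  show "schwartz_linear (symbol_mult v T)"
    using schwartz_linear_add[OF lin schwartz_space_symbol schwartz_space_symbol]
      schwartz_linear_cmult[OF lin schwartz_space_symbol]
    by (simp add: schwartz_linear_def symbol_mult_def distrib_left mult.left_commute)
  fix p :: "real^('d xy)" and w assume p: "p \<in> Omega" and w: "perturbation p 2 w"
  have "perturbation p 2 (\<lambda>h t. of_real (symbol v t) * w h t)"
  proof (cases v rule: symbol_cases)
    case (y k)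
    show ?thesis unfolding y(2) by (rule perturbation.coord[OF w])
  next
    case (x i j c)
    have "perturbation p 2 (\<lambda>h t. of_real c * (of_real (t $ i) * (of_real (t $ j) * w h t)))"
      by (intro perturbation.cmult perturbation.coord w)
    then show ?thesis unfolding x(4) by (simp add: mult.assoc)
  qed
  then show "((\<lambda>h. symbol_mult v T (w h) / of_real (norm h)) \<longlongrightarrow> 0) (at 0)"
    using T p unfolding differentiates_kernel_def symbol_mult_def by blast
qed

definition pairing :: "((real^'d::finite \<Rightarrow> complex) \<Rightarrow> complex) \<Rightarrow> real^('d xy) \<Rightarrow> complex" where
  "pairing T p = T (hkernel p)"

text \<open>The remainder of the linear approximation is \<open>T\<close> applied to a perturbation
  of order two, namely the kernel times \<open>exp_rest 2 (hfun h t)\<close>.\<close>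

lemma pairing_has_derivative:
  fixes p :: "real^('d::finite xy)"
  assumes T: "differentiates_kernel T" and p: "p \<in> Omega"
  shows "(pairing T has_derivative (\<lambda>h. \<Sum>v\<in>UNIV. of_real (h $ v) * pairing (symbol_mult v T) p)) (at p)"
    (is "(_ has_derivative ?D) _")
  unfolding has_derivative_at
proof
  have lin: "schwartz_linear T" using T by (simp add: differentiates_kernel_def)
  show "bounded_linear ?D"
    by (intro bounded_linear_sum bounded_linear_mult_const
        bounded_linear_compose[OF bounded_linear_of_real bounded_linear_vec_nth])
  obtain \<delta> where \<delta>: "\<delta> > 0" "\<And>n w h. perturbation p n w \<Longrightarrow> norm h \<le> \<delta> \<Longrightarrow> w h \<in> schwartz_space"
    using perturbation_schwartz[OF p] by metis
  define w where "w h t = complex_of_real (exp (hfun p t) * exp_rest 2 (hfun h t))" for h t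
  have w: "perturbation p 2 w" unfolding w_def by (rule perturbation.base)
  \<comment> \<open>Linearity of \<open>T\<close> is available only on the Schwartz space, so
    \<open>h\<close> is kept small enough for the kernel at \<open>p + h\<close> to belong to
    it.\<close>
  have eq: "pairing T (p + h) - pairing T p - ?D h = T (w h)" if h: "norm h \<le> \<delta>" for h
  proof -
    have "(\<lambda>t. of_real (exp (hfun p t) * exp_rest 0 (hfun h t))) \<in> schwartz_space"
      using \<delta>(2)[OF perturbation.base h] .
    moreover have "hkernel (p + h) = (\<lambda>t. of_real (exp (hfun p t) * exp_rest 0 (hfun h t)))"
      by (simp add: hkernel_def exp_rest_def hfun_simps exp_of_real exp_add fun_eq_iff)
    ultimately have k: "hkernel (p + h) \<in> schwartz_space" by simp
    have s: "(\<lambda>t. of_real (symbol v t) * hkernel p t) \<in> schwartz_space" for v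
      by (intro schwartz_space_symbol hkernel_schwartz p)
    have D: "?D h = T (\<lambda>t. \<Sum>v\<in>UNIV. of_real (h $ v) * (of_real (symbol v t) * hkernel p t))"
      using schwartz_linear_sum[OF lin schwartz_space_cmult[OF s], of UNIV "\<lambda>v. of_real (h $ v)"]
        schwartz_linear_cmult[OF lin s]
      by (simp add: pairing_def symbol_mult_def)
    have D': "(\<lambda>t. \<Sum>v\<in>UNIV. of_real (h $ v) * (of_real (symbol v t) * hkernel p t)) \<in> schwartz_space"
      by (intro schwartz_space_sum schwartz_space_cmult s) auto
    have "w h t = hkernel (p + h) t - hkernel p t - (\<Sum>v\<in>UNIV. of_real (h $ v) * (of_real (symbol v t) * hkernel p t))" for t
    proof -
      have "(\<Sum>v\<in>UNIV. of_real (h $ v) * (of_real (symbol v t) * hkernel p t)) = of_real (hfun h t) * hkernel p t"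
        by (simp add: hfun_expand sum_distrib_right mult.assoc)
      moreover have rest: "exp_rest 2 x = exp x - 1 - x" for x
        by (simp add: exp_rest_def numeral_2_eq_2)
      ultimately show ?thesis
        unfolding w_def rest
        by (simp add: hkernel_def hfun_simps exp_add exp_of_real right_diff_distrib mult_ac)
    qed
    then have "w h = (\<lambda>t. hkernel (p + h) t - hkernel p t - (\<Sum>v\<in>UNIV. of_real (h $ v) * (of_real (symbol v t) * hkernel p t)))"
      by blast
    moreover have "(\<lambda>t. hkernel (p + h) t - hkernel p t) \<in> schwartz_space"
      using schwartz_space_add[OF k schwartz_space_cmult[OF hkernel_schwartz[OF p], of "-1"]] by simp
    ultimately show ?thesis
      using schwartz_linear_diff[OF lin _ D'] schwartz_linear_diff[OF lin k hkernel_schwartz[OF p]]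
      by (simp only: D pairing_def[of T])
  qed
  have "((\<lambda>h. norm (T (w h) / of_real (norm h))) \<longlongrightarrow> 0) (at 0)"
    using T p w unfolding differentiates_kernel_def by (intro tendsto_norm_zero) blast
  moreover have "\<forall>\<^sub>F h in at 0. norm h \<le> \<delta>"
    unfolding eventually_at using \<delta>(1) by (intro exI[of _ \<delta>]) auto
  then have "\<forall>\<^sub>F h in at 0. norm (T (w h) / of_real (norm h)) =
      norm (pairing T (p + h) - pairing T p - ?D h) / norm h"
    by eventually_elim (simp add: eq norm_divide)
  ultimately show "(\<lambda>h. norm (pairing T (p + h) - pairing T p - ?D h) / norm h) \<midarrow>0\<rightarrow> 0"
    by (rule Lim_transform_eventually)
qed

lemma pairing_partial:
  assumes "differentiates_kernel T" "p \<in> Omega"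
  shows "partial v (pairing T) p = pairing (symbol_mult v T) p"
proof -
  have d: "complex_of_real (axis v 1 $ v') * z = (if v' = v then z else 0)" for v' z by (simp add: axis_def)
  show ?thesis unfolding partial_eqI[OF pairing_has_derivative[OF assms]] d by simp
qed

text \<open>On \<open>Omega\<close> a partial derivative of a pairing is again a pairing, with a
  functional of the same kind, so coinduction applies.\<close>

lemma pairing_smooth:
  assumes "differentiates_kernel T"
  shows "smooth_on Omega (pairing T)"
proof (rule smooth_on_coinduct[where Q = "\<lambda>u. \<exists>T. differentiates_kernel T \<and> u = pairing T"])
  fix u i assume "\<exists>T. differentiates_kernel T \<and> u = pairing T"
  then obtain T where T: "differentiates_kernel T" "u = pairing T" by blast
  show "u differentiable (at p)" if "p \<in> Omega" for p
    using pairing_has_derivative[OF T(1) that] T(2) unfolding differentiable_def by blast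
  show "\<exists>v. (\<exists>T. differentiates_kernel T \<and> v = pairing T) \<and> (\<forall>p\<in>Omega. partial i u p = v p)"
    using differentiates_kernel_symbol[OF T(1)] pairing_partial[OF T(1)] T(2) by blast
qed (use assms open_Omega in auto)

section \<open>The Weyl algebra acting on pairings\<close>

lemma weyl_act_smooth: "open S \<Longrightarrow> smooth_on S u \<Longrightarrow> smooth_on S (weyl_act P u)"
  unfolding weyl_act_def by (rule wexpr_act_smooth)

lemma weyl_act_cong:
  "open S \<Longrightarrow> (\<And>x. x \<in> S \<Longrightarrow> u x = v x) \<Longrightarrow> x \<in> S \<Longrightarrow> weyl_act P u x = weyl_act P v x"
  unfolding weyl_act_def by (rule wexpr_act_cong)

text \<open>The action is computed on a chosen representative, so these laws hold only for functions
  smooth on an open set and at points of that set.\<close>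

lemma weyl_act_simps:
  assumes "open S" "smooth_on S u" "x \<in> S"
  shows "weyl_act (P + Q) u x = weyl_act P u x + weyl_act Q u x"
    and "weyl_act (P * Q) u x = weyl_act P (weyl_act Q u) x"
    and "weyl_act (weyl_const c) u x = c * u x"
    and "weyl_act (weyl_var i) u x = of_real (x $ i) * u x"
    and "weyl_act (weyl_der i) u x = partial i u x"
proof -
  note abs = weyl_act_abs[OF assms(1)]
  obtain a b where ab: "P = abs_weyl a" "Q = abs_weyl b"
    by (metis Quotient3_abs_rep Quotient3_weyl)
  show "weyl_act (P + Q) u x = weyl_act P u x + weyl_act Q u x"
    by (simp add: ab plus_weyl.abs_eq abs[OF assms(2,3)])
  have "weyl_act (P * Q) u x = wexpr_act a (wexpr_act b u) x"
    by (simp add: ab times_weyl.abs_eq abs[OF assms(2,3)])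
  also have "\<dots> = wexpr_act a (weyl_act Q u) x"
    using assms abs[OF assms(2)] by (intro wexpr_act_cong[OF assms(1)]) (simp_all add: ab)
  also have "\<dots> = weyl_act P (weyl_act Q u) x"
    unfolding ab(1) by (rule abs[symmetric, OF weyl_act_smooth[OF assms(1,2)] assms(3)])
  finally show "weyl_act (P * Q) u x = weyl_act P (weyl_act Q u) x" .
  show "weyl_act (weyl_const c) u x = c * u x" "weyl_act (weyl_var i) u x = of_real (x $ i) * u x"
    "weyl_act (weyl_der i) u x = partial i u x"
    by (simp_all add: weyl_const.abs_eq weyl_var.abs_eq weyl_der.abs_eq abs[OF assms(2,3)])
qed

lemma weyl_act_linear:
  assumes "open S" "smooth_on S u" "x \<in> S"
  shows "weyl_act 0 u x = 0"
    and "weyl_act (- P) u x = - weyl_act P u x"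
    and "weyl_act (P - Q) u x = weyl_act P u x - weyl_act Q u x"
    and "weyl_act (2 * P) u x = 2 * weyl_act P u x"
    and "weyl_act (sum h K) u x = (\<Sum>k\<in>K. weyl_act (h k) u x)"
proof -
  note act = weyl_act_simps[OF assms]
  show 0: "weyl_act 0 u x = 0" using act(3)[of 0] by (simp add: weyl_const_simps)
  show m: "weyl_act (- P) u x = - weyl_act P u x" for P
    using act(1)[of "- P" P] 0 by (simp add: eq_neg_iff_add_eq_0)
  show "weyl_act (P - Q) u x = weyl_act P u x - weyl_act Q u x"
    by (simp only: diff_conv_add_uminus act(1) m)
  show "weyl_act (2 * P) u x = 2 * weyl_act P u x" by (simp only: mult_2 act(1))
  show "weyl_act (sum h K) u x = (\<Sum>k\<in>K. weyl_act (h k) u x)"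
    by (induction K rule: infinite_finite_induct) (simp_all add: 0 act(1))
qed

lemma pairing_linear:
  fixes T :: "(real^'d::finite \<Rightarrow> complex) \<Rightarrow> complex"
  assumes "differentiates_kernel T" "p \<in> Omega"
  shows "T (\<lambda>t. c * hkernel p t) = c * pairing T p"
proof -
  have "schwartz_linear T" using assms(1) by (simp add: differentiates_kernel_def)
  then show ?thesis
    unfolding pairing_def by (rule schwartz_linear_cmult[OF _ hkernel_schwartz[OF assms(2)]])
qed

text \<open>The statement ranges over all functionals with \<open>differentiates_kernel\<close>, not
  just tempered distributions, because the product case applies it to
  \<open>wexpr_dact b T\<close>.\<close>

lemma weyl_act_phi_expr:
  "differentiates_kernel T \<Longrightarrow> p \<in> Omega \<Longrightarrow>
    weyl_act (phi_expr a) (pairing T) p = pairing (wexpr_dact a T) p"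
proof (induction a arbitrary: T p)
  case (WConst c)
  then show ?case
    using weyl_act_simps(3)[OF open_Omega pairing_smooth[OF WConst(1)] WConst(2)]
    by (simp add: pairing_def[of "\<lambda>u. c * T u"] pairing_def[of T p])
next
  case (WVar i)
  then show ?case
    using weyl_act_simps(5)[OF open_Omega pairing_smooth[OF WVar(1)] WVar(2)]
    by (simp add: pairing_partial) (simp add: pairing_def symbol_mult_def symbol_y)
next
  case (WDer i)
  let ?u = "pairing T"
  have lin: "schwartz_linear T" using WDer by (simp add: differentiates_kernel_def)
  note sm = pairing_smooth[OF WDer(1)]
  note act = weyl_act_simps[OF open_Omega sm WDer(2)] weyl_act_linear[OF open_Omega sm WDer(2)]
  have xd: "weyl_act (weyl_var (xvar i k) * weyl_der (yvar k)) ?u p =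
      of_real (p $ xvar i k) * T (\<lambda>t. of_real (t $ k) * hkernel p t)" for k
    unfolding act(2) weyl_act_simps(4)[OF open_Omega weyl_act_smooth[OF open_Omega sm] WDer(2)] act(5)
    using WDer by (simp add: pairing_partial) (simp add: pairing_def symbol_mult_def symbol_y)
  have c: "(\<lambda>t. of_real (t $ k) * hkernel p t) \<in> schwartz_space" for k
    by (intro schwartz_space_coord hkernel_schwartz WDer)
  \<comment> \<open>The origin of the formula for \<open>phi\<close>: differentiating the kernel by
    \<open>t_i\<close> multiplies it by \<open>y_i\<close> plus twice the sum of the
    \<open>x_ik * t_k\<close>, multiplication by \<open>t_k\<close> corresponds to the derivative by
    \<open>y_k\<close>, and the sign comes from transposing the derivative.\<close>
  have "partial i (hkernel p) = (\<lambda>t. of_real (p $ yvar i) * hkernel p t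
      + 2 * (\<Sum>k\<in>UNIV. of_real (p $ xvar i k) * (of_real (t $ k) * hkernel p t)))"
    by (simp add: hkernel_partial hfun_grad_def fun_eq_iff distrib_right sum_distrib_right mult.assoc)
  then have "T (partial i (hkernel p)) = T (\<lambda>t. of_real (p $ yvar i) * hkernel p t
      + 2 * (\<Sum>k\<in>UNIV. of_real (p $ xvar i k) * (of_real (t $ k) * hkernel p t)))"
    by (simp only:)
  also have "\<dots> = T (\<lambda>t. of_real (p $ yvar i) * hkernel p t)
      + T (\<lambda>t. 2 * (\<Sum>k\<in>UNIV. of_real (p $ xvar i k) * (of_real (t $ k) * hkernel p t)))"
    by (intro schwartz_linear_add[OF lin] schwartz_space_cmult schwartz_space_sum c hkernel_schwartz WDer) auto
  also have "T (\<lambda>t. 2 * (\<Sum>k\<in>UNIV. of_real (p $ xvar i k) * (of_real (t $ k) * hkernel p t)))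
      = 2 * T (\<lambda>t. \<Sum>k\<in>UNIV. of_real (p $ xvar i k) * (of_real (t $ k) * hkernel p t))"
    by (intro schwartz_linear_cmult[OF lin] schwartz_space_cmult schwartz_space_sum c) auto
  also have "T (\<lambda>t. \<Sum>k\<in>UNIV. of_real (p $ xvar i k) * (of_real (t $ k) * hkernel p t))
      = (\<Sum>k\<in>UNIV. of_real (p $ xvar i k) * T (\<lambda>t. of_real (t $ k) * hkernel p t))"
    using schwartz_linear_sum[OF lin schwartz_space_cmult[OF c], of UNIV "\<lambda>k. of_real (p $ xvar i k)"]
      schwartz_linear_cmult[OF lin c] by simp
  finally have T: "T (partial i (hkernel p)) = of_real (p $ yvar i) * pairing T p
      + 2 * (\<Sum>k\<in>UNIV. of_real (p $ xvar i k) * T (\<lambda>t. of_real (t $ k) * hkernel p t))"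
    by (simp only: pairing_linear[OF WDer])
  have "weyl_act (phi_expr (WDer i)) ?u p = - (of_real (p $ yvar i) * pairing T p)
      - 2 * (\<Sum>k\<in>UNIV. of_real (p $ xvar i k) * T (\<lambda>t. of_real (t $ k) * hkernel p t))"
    by (simp only: phi_expr.simps weyl_act_linear[OF open_Omega sm WDer(2)] act(4) xd)
  then show ?case by (simp add: T pairing_def[of "\<lambda>u. - T (partial i u)"])
next
  case (WAdd a b)
  then show ?case
    using weyl_act_simps(1)[OF open_Omega pairing_smooth[OF WAdd.prems(1)] WAdd.prems(2)]
    by (simp add: pairing_def[of "\<lambda>u. wexpr_dact a T u + wexpr_dact b T u"] flip: pairing_def)
next
  case (WMul a b)
  have "weyl_act (phi_expr (WMul a b)) (pairing T) p = weyl_act (phi_expr a) (weyl_act (phi_expr b) (pairing T)) p"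
    using weyl_act_simps(2)[OF open_Omega pairing_smooth[OF WMul.prems(1)] WMul.prems(2)] by simp
  also have "\<dots> = weyl_act (phi_expr a) (pairing (wexpr_dact b T)) p"
    using WMul by (intro weyl_act_cong[OF open_Omega]) auto
  also have "\<dots> = pairing (wexpr_dact a (wexpr_dact b T)) p"
    using WMul differentiates_kernel_dact by blast
  finally show ?case by simp
qed

lemma phi_annihilates_pairing:
  assumes f: "tempered_distribution f" and P: "annihilates_dist P f"
  shows "annihilates_on Omega (phi P) (pairing f)"
proof -
  note T = tempered_differentiates_kernel[OF f]
  obtain a where a: "P = abs_weyl a" by (metis Quotient3_abs_rep Quotient3_weyl)
  have "weyl_act (phi P) (pairing f) p = 0" if p: "p \<in> Omega" for p
  proof -
    have "weyl_act (phi P) (pairing f) p = wexpr_dact a f (hkernel p)"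
      using weyl_act_phi_expr[OF T p, of a] by (simp add: a phi.abs_eq pairing_def)
    also have "\<dots> = weyl_dact P f (hkernel p)"
      unfolding a by (rule weyl_dact_abs[OF f hkernel_schwartz[OF p], symmetric])
    finally show ?thesis using P hkernel_schwartz[OF p] by (simp add: annihilates_dist_def)
  qed
  then show ?thesis using pairing_smooth[OF T] by (simp add: annihilates_on_def)
qed

text \<open>Both terms of a heat operator pair \<open>f\<close> with the kernel times the same
  multiple of \<open>t_i * t_j\<close>.\<close>

lemma heat_annihilates_pairing:
  fixes f :: "(real^'d::finite \<Rightarrow> complex) \<Rightarrow> complex"
  assumes f: "tempered_distribution f" and Q: "Q \<in> heat_ops"
  shows "annihilates_on Omega Q (pairing f)"
proof -
  note T = tempered_differentiates_kernel[OF f]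
  note sm = pairing_smooth[OF T]
  have yy: "weyl_act (weyl_der (yvar i) * weyl_der (yvar j)) (pairing f) p =
      f (\<lambda>t. of_real (t $ i * t $ j) * hkernel p t)" if p: "p \<in> Omega" for p and i j :: 'd
  proof -
    have "weyl_act (weyl_der (yvar i) * weyl_der (yvar j)) (pairing f) p =
        weyl_act (weyl_der (yvar i)) (weyl_act (weyl_der (yvar j)) (pairing f)) p"
      by (rule weyl_act_simps(2)[OF open_Omega sm p])
    also have "\<dots> = weyl_act (weyl_der (yvar i)) (pairing (symbol_mult (yvar j) f)) p"
      using weyl_act_simps(5)[OF open_Omega sm] pairing_partial[OF T]
      by (intro weyl_act_cong[OF open_Omega _ p]) simp
    also have "\<dots> = pairing (symbol_mult (yvar i) (symbol_mult (yvar j) f)) p"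
      using weyl_act_simps(5)[OF open_Omega pairing_smooth p] pairing_partial[OF _ p]
        differentiates_kernel_symbol[OF T] by metis
    finally show ?thesis by (simp add: pairing_def symbol_mult_def symbol_y mult_ac)
  qed
  have x: "weyl_act (weyl_der (xvar i j)) (pairing f) p =
      (if i = j then 1 else 2) * f (\<lambda>t. of_real (t $ i * t $ j) * hkernel p t)" if p: "p \<in> Omega" for p and i j :: 'd
  proof -
    have "(\<lambda>t. of_real (t $ i * t $ j) * hkernel p t) \<in> schwartz_space"
      using schwartz_space_coord[OF schwartz_space_coord[OF hkernel_schwartz[OF p]], of i j]
      by (simp add: mult.assoc)
    from schwartz_linear_cmult[OF tempered_distribution_linear[OF f] this, of "if i = j then 1 else 2"]
    have "f (\<lambda>t. of_real (symbol (xvar i j) t) * hkernel p t) =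
        (if i = j then 1 else 2) * f (\<lambda>t. of_real (t $ i * t $ j) * hkernel p t)"
      by (cases "i = j") (simp_all add: symbol_x mult.assoc)
    then show ?thesis
      using weyl_act_simps(5)[OF open_Omega sm p] pairing_partial[OF T p]
      by (simp add: pairing_def symbol_mult_def)
  qed
  have "weyl_act Q (pairing f) p = 0" if p: "p \<in> Omega" for p
  proof -
    note act = weyl_act_linear[OF open_Omega sm p]
    from Q consider i j :: 'd where "i \<noteq> j" "Q = weyl_der (xvar i j) - 2 * weyl_der (yvar i) * weyl_der (yvar j)"
      | i :: 'd where "Q = weyl_der (xvar i i) - weyl_der (yvar i) ^ 2"
      unfolding heat_ops_def by blast
    then show ?thesis
    proof cases
      case 1
      then show ?thesis by (simp only: act mult.assoc yy[OF p] x[OF p] if_False) simp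
    next
      case 2
      then show ?thesis by (simp only: act power2_eq_square yy[OF p] x[OF p]) simp
    qed
  qed
  then show ?thesis using sm by (simp add: annihilates_on_def)
qed

text \<open>Needed because the given function agrees with the pairing only on \<open>Omega\<close>
  and is arbitrary elsewhere.\<close>

lemma smooth_on_cong:
  fixes u v :: "real^'a::finite \<Rightarrow> complex"
  assumes S: "open S" and u: "smooth_on S u" and eq: "\<And>x. x \<in> S \<Longrightarrow> v x = u x"
  shows "smooth_on S v"
proof (rule smooth_on_coinduct[where Q = "\<lambda>w. \<exists>u. smooth_on S u \<and> (\<forall>x\<in>S. w x = u x)"])
  fix w :: "real^'a \<Rightarrow> complex" and i assume "\<exists>u. smooth_on S u \<and> (\<forall>x\<in>S. w x = u x)"
  then obtain u where u: "smooth_on S u" "\<forall>x\<in>S. w x = u x" by (elim exE conjE)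
  show "w differentiable (at x)" if "x \<in> S" for x
    using differentiable_cong_open[OF S that _ smooth_on_differentiable[OF u(1) that]] u(2) by blast
  have "\<forall>x\<in>S. partial i w x = partial i u x"
    using partial_cong[OF S] u(2) by blast
  then show "\<exists>v. (\<exists>u. smooth_on S u \<and> (\<forall>x\<in>S. v x = u x)) \<and> (\<forall>x\<in>S. partial i w x = v x)"
    using smooth_on_partial[OF u(1), of i] by (intro exI[of _ "partial i u"]) blast
qed (use S u eq in auto)

lemma annihilates_on_cong:
  assumes "open S" "annihilates_on S Q u" "\<And>x. x \<in> S \<Longrightarrow> v x = u x"
  shows "annihilates_on S Q v"
  using assms smooth_on_cong[OF assms(1) _ assms(3)] weyl_act_cong[OF assms(1) assms(3)]
  by (simp add: annihilates_on_def)

theorem theorem5: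
  fixes f :: "(real^'d::finite \<Rightarrow> complex) \<Rightarrow> complex"
    and g :: "real^('d xy) \<Rightarrow> complex"
    and P :: "nat \<Rightarrow> 'd weyl"
    and s :: nat
  assumes "tempered_distribution f"
    and "\<forall>p\<in>Omega. g p = f (\<lambda>t. exp (complex_of_real (hfun p t)))"
    and "\<forall>k\<in>{1..s}. annihilates_dist (P k) f"
  shows "(\<forall>Q \<in> phi ` P ` {1..s} \<union> heat_ops. annihilates_on Omega Q g) \<and>
    (holonomic_ideal (left_ideal hull (P ` {1..s})) \<longrightarrow>
     holonomic_ideal (left_ideal hull (phi ` P ` {1..s} \<union> heat_ops)))"
proof (intro conjI ballI impI)
  fix Q assume "Q \<in> phi ` P ` {1..s} \<union> heat_ops"
  then have "annihilates_on Omega Q (pairing f)"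
    using phi_annihilates_pairing[OF assms(1)] heat_annihilates_pairing[OF assms(1)] assms(3) by blast
  moreover have "g p = pairing f p" if "p \<in> Omega" for p
    using assms(2) that by (simp add: pairing_def hkernel_def[abs_def])
  ultimately show "annihilates_on Omega Q g" by (rule annihilates_on_cong[OF open_Omega])
next
  assume "holonomic_ideal (left_ideal hull (P ` {1..s}))"
  from holonomic_phi_ideal[OF this]
  show "holonomic_ideal (left_ideal hull (phi ` P ` {1..s} \<union> heat_ops))"
    unfolding phi_ideal_def .
qed

end
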